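(* There is an absolute constant $C>0$ such that the following holds. Let $d\ge 2$, let $K$ be a convex body in $\mathbb{R}^d$ and $p\in\mathrm{int}(K)$. Then \[\kappa'(K,p)\le\kappa(K,p)\le\left(\frac32\right)^d\frac{\mathrm{vol}(K-K)}{\mathrm{vol}((K-p)\cap(p-K))}\cdot C\,d\,\bigl(\log d+\log\theta(K,p)\bigr).\] Moreover, if $c$ is the centroid of $K$, then \[\kappa'(K,c)\le\kappa(K,c)\le 3^d\binom{2d}{d}\,C\,d\log d .\]
   Context: A convex body in $\mathbb{R}^d$ is a compact convex set with non-empty interior. A positive homothet of $K$ is a set $\lambda K+v$ with $\lambda>0$, $v\in\mathbb{R}^d$. For $p\in\mathrm{int}(K)$, a Minkowski arrangement of $K$ with respect to $p$ is a family $\{v_i+\lambda_iK\}$ of positive homothets of $K$ such that $v_i+p\notin v_j+\lambda_j\,\mathrm{int}(K)$ for all distinct $i,j$; a strict Minkowski arrangement of $K$ with respect to $p$ is such a family with $v_i+p\notin v_j+\lambda_jK$ for all distinct $i,j$. $\kappa(K,p)$ (resp. $\kappa'(K,p)$) is the largest number of homothets in a pairwise intersecting Minkowski arrangement (resp. strict Minkowski arrangement) of $K$ with respect to $p$. The measure of asymmetry of $K$ with respect to $p$ is $\theta(K,p)=\inf\{\theta: p-K\subseteq\theta(K-p)\}$. $K-K=\{x-y:x,y\in K\}$.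
   Formalization: The condition v_i+p ∉ v_j+λ_j int(K) (and its strict form) is read as v_i+λ_i p ∉ v_j+λ_j int(K), since as written κ(K,p) is infinite for every p ≠ 0; θ(K,p) is the infimum over positive θ only, since otherwise it is −∞. *)

theory Defs
  imports "HOL-Analysis.Analysis"
begin

text \<open>We model R^d uniformly in d (so that the constant C can be absolute, i.e. quantified
  before d) as the set E d of functions nat => real vanishing outside {..<d}.
  Vector operations are written out coordinatewise.\<close>

definition E :: "nat \<Rightarrow> (nat \<Rightarrow> real) set" where
  "E d = {x. \<forall>i\<ge>d. x i = 0}"

definition intd :: "nat \<Rightarrow> (nat \<Rightarrow> real) set \<Rightarrow> (nat \<Rightarrow> real) set" where
  "intd d K = {x \<in> K. \<exists>e>0. \<forall>y\<in>E d. sqrt (\<Sum>i<d. (y i - x i)\<^sup>2) < e \<longrightarrow> y \<in> K}"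

definition convex_body :: "nat \<Rightarrow> (nat \<Rightarrow> real) set \<Rightarrow> bool" where
  "convex_body d K \<longleftrightarrow> K \<subseteq> E d \<and> compact K \<and>
     (\<forall>x\<in>K. \<forall>y\<in>K. \<forall>u::real. 0 \<le> u \<and> u \<le> 1 \<longrightarrow> (\<lambda>i. (1 - u) * x i + u * y i) \<in> K) \<and>
     intd d K \<noteq> {}"

definition homothet :: "(nat \<Rightarrow> real) set \<Rightarrow> real \<Rightarrow> (nat \<Rightarrow> real) \<Rightarrow> (nat \<Rightarrow> real) set" where
  "homothet S lam v = {(\<lambda>i. v i + lam * x i) | x. x \<in> S}"

definition pw_int_family :: "nat \<Rightarrow> (nat \<Rightarrow> real) set \<Rightarrow> nat set \<Rightarrow> (nat \<Rightarrow> nat \<Rightarrow> real) \<Rightarrow> (nat \<Rightarrow> real) \<Rightarrow> bool" where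
  "pw_int_family d K I v lam \<longleftrightarrow> finite I \<and> (\<forall>i\<in>I. v i \<in> E d \<and> lam i > 0) \<and>
     (\<forall>i\<in>I. \<forall>j\<in>I. i \<noteq> j \<longrightarrow> homothet K (lam i) (v i) \<inter> homothet K (lam j) (v j) \<noteq> {})"

definition minkowski_arr :: "nat \<Rightarrow> (nat \<Rightarrow> real) set \<Rightarrow> (nat \<Rightarrow> real) \<Rightarrow> nat set \<Rightarrow> (nat \<Rightarrow> nat \<Rightarrow> real) \<Rightarrow> (nat \<Rightarrow> real) \<Rightarrow> bool" where
  "minkowski_arr d K p I v lam \<longleftrightarrow>
     (\<forall>i\<in>I. \<forall>j\<in>I. i \<noteq> j \<longrightarrow> (\<lambda>k. v i k + lam i * p k) \<notin> homothet (intd d K) (lam j) (v j))"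

definition strict_minkowski_arr :: "nat \<Rightarrow> (nat \<Rightarrow> real) set \<Rightarrow> (nat \<Rightarrow> real) \<Rightarrow> nat set \<Rightarrow> (nat \<Rightarrow> nat \<Rightarrow> real) \<Rightarrow> (nat \<Rightarrow> real) \<Rightarrow> bool" where
  "strict_minkowski_arr d K p I v lam \<longleftrightarrow>
     (\<forall>i\<in>I. \<forall>j\<in>I. i \<noteq> j \<longrightarrow> (\<lambda>k. v i k + lam i * p k) \<notin> homothet K (lam j) (v j))"

definition kappa :: "nat \<Rightarrow> (nat \<Rightarrow> real) set \<Rightarrow> (nat \<Rightarrow> real) \<Rightarrow> ereal" where
  "kappa d K p = Sup {ereal (real (card I)) | I v lam.
      pw_int_family d K I v lam \<and> minkowski_arr d K p I v lam}"

definition kappa' :: "nat \<Rightarrow> (nat \<Rightarrow> real) set \<Rightarrow> (nat \<Rightarrow> real) \<Rightarrow> ereal" where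
  "kappa' d K p = Sup {ereal (real (card I)) | I v lam.
      pw_int_family d K I v lam \<and> strict_minkowski_arr d K p I v lam}"

definition theta :: "(nat \<Rightarrow> real) set \<Rightarrow> (nat \<Rightarrow> real) \<Rightarrow> real" where
  "theta K p = Inf {t::real. t > 0 \<and>
      {(\<lambda>i. p i - x i) | x. x \<in> K} \<subseteq> {(\<lambda>i. t * (x i - p i)) | x. x \<in> K}}"

definition lebd :: "nat \<Rightarrow> (nat \<Rightarrow> real) measure" where
  "lebd d = Pi\<^sub>M {..<d} (\<lambda>_. lborel)"

definition vol :: "nat \<Rightarrow> (nat \<Rightarrow> real) set \<Rightarrow> real" where
  "vol d S = measure (lebd d) ((\<lambda>x. restrict x {..<d}) ` S)"

definition minus_set :: "(nat \<Rightarrow> real) set \<Rightarrow> (nat \<Rightarrow> real) set \<Rightarrow> (nat \<Rightarrow> real) set" where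
  "minus_set A B = {(\<lambda>i. x i - y i) | x y. x \<in> A \<and> y \<in> B}"

definition centroid :: "nat \<Rightarrow> (nat \<Rightarrow> real) set \<Rightarrow> (nat \<Rightarrow> real)" where
  "centroid d K = (\<lambda>i. if i < d then
      (set_lebesgue_integral (lebd d) ((\<lambda>x. restrict x {..<d}) ` K) (\<lambda>x. x i)) / vol d K
    else 0)"

end

theory Submission
  imports Defs "HOL-Library.Function_Algebras"
begin

text \<open>
  Put $p$ at the origin and let $P = K \cap -K$. Members whose scales agree up to a factor
  $1 + 1/d$ have centres whose differences avoid almost all of (scale times) $P$ but lie in roughly
  (scale times) $K - K$. Hence the union $X$ of the translates of $P/2$ at the centres is a packing with
  $X - X$ inside a copy of $(3/2 + 1/d)(K - K)$, and the Brunn--Minkowski inequality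
  $\mathrm{vol}(X) \le 2^{-d}\, \mathrm{vol}(X - X)$ bounds their number by
  $O((3/2)^d\, \mathrm{vol}(K - K) / \mathrm{vol}(P))$. There are $O(d (\log d + \log \theta))$ such
  classes below $d\theta$ times the smallest scale, and all the larger members form one more packing
  after projection to unit size. For the centroid, the Rogers--Shephard inequality, the
  Milman--Pajor inequality $\mathrm{vol}(P) \ge 2^{-d}\, \mathrm{vol}(K)$ and $\theta \le 9 d$ give
  the second bound.
\<close>

section \<open>Prekopa--Leindler on the line and Brunn--Minkowski\<close>

text \<open>The set to be measured, a union of translates of P/2, is not convex, so Brunn--Minkowski
  is needed for general compact sets. It is proved as vol((1-u)A + uB) >= vol(A)^(1-u) vol(B)^u:
  this form does not mention the dimension, so it passes through slices by induction, and B = -A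
  with u = 1/2 gives vol(A) <= vol((A - A)/2). The number 3/2 is 1 + 1/2: differences of centres
  cost one copy of K - K, and the two radii cost P/2 - P/2, at most half a copy. The ratio 1 + 1/d
  and the loss 1 - 1/d are harmless, since their d-th powers are at most 3 and at least 1/9. The
  symmetric P is packed instead of K because two overlapping translates of P/2 have a difference of
  centres in P, which is a subset of K; for K/2 the difference would only lie in (K - K)/2, which
  the arrangement does not exclude. The cut-off d theta is where reflection becomes cheap: replacing
  a point of the smallest member by its opposite costs theta times the smallest scale, at most a
  fraction 1/d of every scale beyond the cut-off.\<close>

instantiation "fun" :: (type, real_vector) real_vector
begin
text \<open>Pointwise scaling makes the ambient function space a real vector space, so that
  \<open>convex\<close> and \<open>convex_on\<close> apply to subsets of \<open>E d\<close> for all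
  \<open>d\<close> at once.\<close>

definition scaleR_fun :: "real \<Rightarrow> ('a \<Rightarrow> 'b) \<Rightarrow> 'a \<Rightarrow> 'b" where
  "scaleR_fun c f = (\<lambda>x. c *\<^sub>R f x)"
instance
  by standard (simp_all add: scaleR_fun_def fun_eq_iff scaleR_add_right scaleR_add_left)
end

lemma scaleR_fun_apply [simp]: "(c *\<^sub>R f) x = c *\<^sub>R f x"
  by (simp add: scaleR_fun_def)

lemma emeasure_lborel_affine_image:
  fixes A :: "real set"
  assumes A: "A \<in> sets borel" and c: "c \<noteq> 0" and B: "(\<lambda>x. t + c * x) ` A \<in> sets borel"
  shows "emeasure lborel ((\<lambda>x. t + c * x) ` A) = ennreal \<bar>c\<bar> * emeasure lborel A"
proof -
  have "emeasure lborel ((\<lambda>x. t + c * x) ` A)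
      = (\<integral>\<^sup>+x. indicator ((\<lambda>x. t + c * x) ` A) x \<partial>lborel)" using B by simp
  also have "\<dots> = \<bar>c\<bar> * (\<integral>\<^sup>+x. indicator ((\<lambda>x. t + c * x) ` A) (t + c * x) \<partial>lborel)"
    using B c by (intro nn_integral_real_affine) auto
  also have "(\<lambda>x. indicator ((\<lambda>x. t + c * x) ` A) (t + c * x) :: ennreal) = indicator A"
    using c by (auto simp: indicator_def fun_eq_iff)
  finally show ?thesis using A by simp
qed

text \<open>With a the maximum of \<open>A\<close> and b the minimum of \<open>B\<close>, the
  translates u b + (1-u) A and (1-u) a + u B both lie in \<open>C\<close> and share at most the
  point \<open>z\<close>, which is a null set. Hence their lengths add up.\<close>

lemma brunn_minkowski_real_compact:
  fixes A B C :: "real set"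
  assumes A: "compact A" "A \<noteq> {}" and B: "compact B" "B \<noteq> {}" and C: "C \<in> sets borel"
    and u: "0 < u" "u < 1"
    and sub: "\<And>a b. a \<in> A \<Longrightarrow> b \<in> B \<Longrightarrow> (1 - u) * a + u * b \<in> C"
  shows "ennreal (1 - u) * emeasure lborel A + ennreal u * emeasure lborel B \<le> emeasure lborel C"
proof -
  obtain a where a: "a \<in> A" "\<And>x. x \<in> A \<Longrightarrow> x \<le> a"
    using compact_attains_sup[OF A] by blast
  obtain b where b: "b \<in> B" "\<And>x. x \<in> B \<Longrightarrow> b \<le> x"
    using compact_attains_inf[OF B] by blast
  define A' where "A' = (\<lambda>x. u * b + (1 - u) * x) ` A"
  define B' where "B' = (\<lambda>x. (1 - u) * a + u * x) ` B"
  define z where "z = (1 - u) * a + u * b"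
  have cA: "compact A'" unfolding A'_def by (intro compact_continuous_image A continuous_intros)
  have cB: "compact B'" unfolding B'_def by (intro compact_continuous_image B continuous_intros)
  have [measurable]: "A \<in> sets borel" "B \<in> sets borel" "A' \<in> sets borel" "B' \<in> sets borel"
    using A B cA cB by (simp_all add: compact_imp_closed)
  have subs: "A' \<union> (B' - {z}) \<subseteq> C"
    using sub a(1) b(1) unfolding A'_def B'_def by (auto simp: add.commute)
  have "x \<le> z" if "x \<in> A'" for x
    using that a(2) u unfolding A'_def z_def by auto
  moreover have "z \<le> x" if "x \<in> B'" for x
    using that b(2) u unfolding B'_def z_def by auto
  ultimately have disj: "A' \<inter> (B' - {z}) = {}" by force
  have "ennreal (1 - u) * emeasure lborel A = emeasure lborel A'"
    unfolding A'_def using u cA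
    by (subst emeasure_lborel_affine_image) (auto simp: A'_def[symmetric])
  moreover have "ennreal u * emeasure lborel B = emeasure lborel B'"
    unfolding B'_def using u cB
    by (subst emeasure_lborel_affine_image) (auto simp: B'_def[symmetric])
  moreover have "emeasure lborel B' = emeasure lborel (B' - {z})"
    by (rule emeasure_Diff_null_set[symmetric]) auto
  moreover have "emeasure lborel A' + emeasure lborel (B' - {z}) = emeasure lborel (A' \<union> (B' - {z}))"
    by (rule plus_emeasure) (use disj in auto)
  moreover have "\<dots> \<le> emeasure lborel C"
    by (rule emeasure_mono) (use subs C in auto)
  ultimately show ?thesis by simp
qed

lemma inner_compact_real:
  fixes A :: "real set"
  assumes A: "A \<in> sets borel" "bounded A" "A \<noteq> {}" and e: "e > 0"
  obtains T where "compact T" "T \<noteq> {}" "T \<subseteq> A" "emeasure lborel A \<le> emeasure lborel T + ennreal e"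
proof -
  have "A \<in> sets lebesgue" using A by auto
  from sets_lebesgue_inner_closed[OF this e] obtain T where
    T: "closed T" "T \<subseteq> A" "A - T \<in> lmeasurable" "emeasure lebesgue (A - T) < ennreal e" by blast
  have "compact T" using T A by (meson bounded_subset compact_eq_bounded_closed)
  have TB: "T \<in> sets borel" using T by auto
  have "emeasure lborel A = emeasure lborel T + emeasure lborel (A - T)"
    using T A TB by (subst plus_emeasure) (auto simp: Un_absorb1)
  moreover have "emeasure lborel (A - T) = emeasure lebesgue (A - T)"
    using A TB by (simp add: main_part_sets)
  ultimately have le: "emeasure lborel A \<le> emeasure lborel T + ennreal e"
    using T(4) by (simp add: add_left_mono less_imp_le)
  show thesis
  proof (cases "T = {}")
    case False
    then show thesis using that \<open>compact T\<close> T le by blast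
  next
    \<comment> \<open>An empty \<open>T\<close> means that \<open>A\<close> has measure at most
      \<open>e\<close>; a single point of \<open>A\<close> then restores the nonemptiness that
      Brunn--Minkowski needs.\<close>
    case True
    obtain a where "a \<in> A" using A by blast
    show thesis
      by (rule that[of "{a}"]) (use \<open>a \<in> A\<close> le True in auto)
  qed
qed

text \<open>Both sets are approximated from inside up to \<open>e\<close>; the weights
  \<open>1 - u\<close> and \<open>u\<close> sum to 1, so the total error is again
  \<open>e\<close>.\<close>

lemma brunn_minkowski_real:
  fixes A B C :: "real set"
  assumes A: "A \<in> sets borel" "bounded A" "A \<noteq> {}" and B: "B \<in> sets borel" "bounded B" "B \<noteq> {}"
    and C: "C \<in> sets borel" and u: "0 < u" "u < 1"
    and sub: "\<And>a b. a \<in> A \<Longrightarrow> b \<in> B \<Longrightarrow> (1 - u) * a + u * b \<in> C"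
  shows "ennreal (1 - u) * emeasure lborel A + ennreal u * emeasure lborel B \<le> emeasure lborel C"
proof (rule ennreal_le_epsilon)
  fix e :: real assume e: "0 < e"
  obtain S where S: "compact S" "S \<noteq> {}" "S \<subseteq> A" "emeasure lborel A \<le> emeasure lborel S + ennreal e"
    using inner_compact_real[OF A e] .
  obtain T where T: "compact T" "T \<noteq> {}" "T \<subseteq> B" "emeasure lborel B \<le> emeasure lborel T + ennreal e"
    using inner_compact_real[OF B e] .
  have "ennreal (1 - u) * emeasure lborel A + ennreal u * emeasure lborel B
     \<le> ennreal (1 - u) * (emeasure lborel S + ennreal e) + ennreal u * (emeasure lborel T + ennreal e)"
    by (intro add_mono mult_left_mono S T) auto
  also have "\<dots> = (ennreal (1 - u) * emeasure lborel S + ennreal u * emeasure lborel T)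
     + (ennreal (1 - u) + ennreal u) * ennreal e"
    by (simp add: algebra_simps)
  also have "ennreal (1 - u) + ennreal u = 1"
    using u by (simp flip: ennreal_plus)
  also have "ennreal (1 - u) * emeasure lborel S + ennreal u * emeasure lborel T \<le> emeasure lborel C"
    by (rule brunn_minkowski_real_compact) (use S T C u sub in auto)
  finally show "ennreal (1 - u) * emeasure lborel A + ennreal u * emeasure lborel B
      \<le> emeasure lborel C + ennreal e" by (simp add: add_right_mono)
qed

text \<open>Layer-cake formula with levels written as fractions \<open>a * t\<close> of an upper
  bound, so that superlevel sets of functions with different suprema can be compared at the same t
  in (0,1).\<close>

lemma nn_integral_superlevel:
  fixes f :: "real \<Rightarrow> real"
  assumes [measurable]: "f \<in> borel_measurable borel" and a: "a > 0" and f: "\<And>s. 0 \<le> f s" "\<And>s. f s \<le> a"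
  shows "(\<integral>\<^sup>+s. ennreal (f s) \<partial>lborel)
       = ennreal a * (\<integral>\<^sup>+t. indicator {0<..<1} t * emeasure lborel {s. a * t < f s} \<partial>lborel)"
proof -
  have *: "ennreal (f s / a) = (\<integral>\<^sup>+t. indicator {0<..<1} t * indicator {s. a * t < f s} s \<partial>lborel)" for s
  proof -
    have "(\<integral>\<^sup>+t. indicator {0<..<1} t * indicator {s. a * t < f s} s \<partial>lborel)
       = (\<integral>\<^sup>+t. indicator {0<..<f s / a} t \<partial>lborel)"
    proof (intro nn_integral_cong)
      fix t
      have "t < 1" if "t < f s / a"
      proof -
        have "f s / a \<le> 1" using f(2)[of s] a by simp
        with that show ?thesis by linarith
      qed
      then show "indicator {0<..<1} t * indicator {s. a * t < f s} s = (indicator {0<..<f s / a} t :: ennreal)"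
        using a by (auto simp: indicator_def field_simps)
    qed
    also have "\<dots> = ennreal (f s / a)" using f a by simp
    finally show ?thesis by simp
  qed
  have "(\<integral>\<^sup>+s. ennreal (f s) \<partial>lborel) = (\<integral>\<^sup>+s. ennreal a * ennreal (f s / a) \<partial>lborel)"
    using a f by (intro nn_integral_cong) (simp flip: ennreal_mult)
  also have "\<dots> = ennreal a * (\<integral>\<^sup>+s. ennreal (f s / a) \<partial>lborel)"
    by (intro nn_integral_cmult) simp
  also have "(\<integral>\<^sup>+s. ennreal (f s / a) \<partial>lborel)
     = (\<integral>\<^sup>+s. \<integral>\<^sup>+t. indicator {0<..<1} t * indicator {s. a * t < f s} s \<partial>lborel \<partial>lborel)"
    unfolding * ..
  also have "\<dots> = (\<integral>\<^sup>+t. \<integral>\<^sup>+s. indicator {0<..<1} t * indicator {s. a * t < f s} s \<partial>lborel \<partial>lborel)"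
    by (rule lborel_pair.Fubini') measurable
  also have "\<dots> = (\<integral>\<^sup>+t. indicator {0<..<1} t * emeasure lborel {s. a * t < f s} \<partial>lborel)"
    by (intro nn_integral_cong, subst nn_integral_cmult) auto
  finally show ?thesis .
qed

text \<open>Only an inequality, since \<open>h\<close> may exceed \<open>c\<close> or be infinite:
  levels above \<open>c\<close> are discarded.\<close>

lemma nn_integral_superlevel_le:
  fixes h :: "real \<Rightarrow> ennreal"
  assumes [measurable]: "h \<in> borel_measurable borel" and c: "c > 0"
  shows "ennreal c * (\<integral>\<^sup>+t. indicator {0<..<1} t * emeasure lborel {s. ennreal (c * t) < h s} \<partial>lborel)
     \<le> (\<integral>\<^sup>+s. h s \<partial>lborel)"
proof -
  have *: "ennreal c * (\<integral>\<^sup>+t. indicator {0<..<1} t * indicator {s. ennreal (c * t) < h s} s \<partial>lborel) \<le> h s" for s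
  proof (cases "h s = \<infinity>")
    case False
    then obtain r where r: "h s = ennreal r" "r \<ge> 0" by (metis ennreal_cases infinity_ennreal_def)
    have "(\<integral>\<^sup>+t. indicator {0<..<1} t * indicator {s. ennreal (c * t) < h s} s \<partial>lborel)
       \<le> (\<integral>\<^sup>+t. indicator {0<..<r / c} t \<partial>lborel)"
      using c r by (intro nn_integral_mono) (auto simp: indicator_def field_simps ennreal_less_iff)
    also have "\<dots> = ennreal (r / c)" using c r by simp
    finally have "ennreal c * (\<integral>\<^sup>+t. indicator {0<..<1} t * indicator {s. ennreal (c * t) < h s} s \<partial>lborel)
       \<le> ennreal c * ennreal (r / c)" by (rule mult_left_mono) simp
    also have "\<dots> = h s" using c r by (simp flip: ennreal_mult)
    finally show ?thesis .
  qed simp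
  have "(\<integral>\<^sup>+t. indicator {0<..<1} t * emeasure lborel {s. ennreal (c * t) < h s} \<partial>lborel)
     = (\<integral>\<^sup>+t. \<integral>\<^sup>+s. indicator {0<..<1} t * indicator {s. ennreal (c * t) < h s} s \<partial>lborel \<partial>lborel)"
    by (intro nn_integral_cong, subst nn_integral_cmult) auto
  also have "\<dots> = (\<integral>\<^sup>+s. \<integral>\<^sup>+t. indicator {0<..<1} t * indicator {s. ennreal (c * t) < h s} s \<partial>lborel \<partial>lborel)"
    by (rule lborel_pair.Fubini') measurable
  finally have "ennreal c * (\<integral>\<^sup>+t. indicator {0<..<1} t * emeasure lborel {s. ennreal (c * t) < h s} \<partial>lborel)
    = (\<integral>\<^sup>+s. ennreal c * (\<integral>\<^sup>+t. indicator {0<..<1} t * indicator {s. ennreal (c * t) < h s} s \<partial>lborel) \<partial>lborel)"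
    by (simp add: nn_integral_cmult)
  also have "\<dots> \<le> (\<integral>\<^sup>+s. h s \<partial>lborel)"
    by (intro nn_integral_mono *)
  finally show ?thesis .
qed

lemma weighted_arith_geo_mean:
  fixes x y u :: real
  assumes "0 \<le> x" "0 \<le> y" "0 < u" "u < 1"
  shows "x powr (1 - u) * y powr u \<le> (1 - u) * x + u * y"
proof (cases "x = 0 \<or> y = 0")
  case True
  then show ?thesis using assms by auto
next
  case False
  then show ?thesis using Youngs_inequality_0[of "1 - u" u x y] assms by auto
qed

text \<open>The line inequality is additive while the claim is multiplicative. Dividing by the
  suprema makes both superlevel sets nonempty at every relative level below 1; the additive
  inequality for their lengths is integrated over the levels, and the weighted arithmetic-geometric
  mean inequality for the normalised integrals gives the product. \<open>M\<close> and
  \<open>R\<close> keep integrals finite and superlevel sets bounded.\<close>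

lemma prekopa_leindler_real:
  fixes f g :: "real \<Rightarrow> real" and h :: "real \<Rightarrow> ennreal"
  assumes [measurable]: "f \<in> borel_measurable borel" "g \<in> borel_measurable borel" "h \<in> borel_measurable borel"
    and f: "\<And>s. 0 \<le> f s" "\<And>s. f s \<le> M" "\<And>s. R < \<bar>s\<bar> \<Longrightarrow> f s = 0"
    and g: "\<And>s. 0 \<le> g s" "\<And>s. g s \<le> M" "\<And>s. R < \<bar>s\<bar> \<Longrightarrow> g s = 0"
    and u: "0 < u" "u < 1"
    and h: "\<And>s t. ennreal (f s powr (1 - u) * g t powr u) \<le> h ((1 - u) * s + u * t)"
  shows "ennreal (enn2real (\<integral>\<^sup>+s. ennreal (f s) \<partial>lborel) powr (1 - u)
       * enn2real (\<integral>\<^sup>+s. ennreal (g s) \<partial>lborel) powr u) \<le> (\<integral>\<^sup>+s. h s \<partial>lborel)"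
proof (cases "(\<forall>s. f s = 0) \<or> (\<forall>s. g s = 0)")
  case True
  then show ?thesis by auto
next
  case False
  define a where "a = (SUP s. f s)"
  define b where "b = (SUP s. g s)"
  have bf: "bdd_above (range f)" and bg: "bdd_above (range g)"
    using f(2) g(2) by (auto simp: bdd_above_def)
  have fa: "f s \<le> a" for s unfolding a_def by (rule cSUP_upper[OF _ bf]) simp
  have gb: "g s \<le> b" for s unfolding b_def by (rule cSUP_upper[OF _ bg]) simp
  have a: "a > 0" using False fa f(1) by (metis antisym order_trans not_le)
  have b: "b > 0" using False gb g(1) by (metis antisym order_trans not_le)
  \<comment> \<open>Chosen so that c t = (a t)^(1-u) (b t)^u: this is the level of \<open>h\<close>
    reached by combining the levels a t of \<open>f\<close> and b t of \<open>g\<close>.\<close>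
  define c where "c = a powr (1 - u) * b powr u"
  have c: "c > 0" using a b by (simp add: c_def)
  let ?F = "\<lambda>t. {s. a * t < f s}" and ?G = "\<lambda>t. {s. b * t < g s}" and ?H = "\<lambda>t. {s. ennreal (c * t) < h s}"
  have sup: "ennreal (1 - u) * emeasure lborel (?F t) + ennreal u * emeasure lborel (?G t)
      \<le> emeasure lborel (?H t)" if t: "0 < t" "t < 1" for t
  proof (rule brunn_minkowski_real)
    have "a * t < a" using t a by simp
    then show "?F t \<noteq> {}"
      unfolding a_def using less_cSUP_iff[OF _ bf] by auto
    have "b * t < b" using t b by simp
    then show "?G t \<noteq> {}"
      unfolding b_def using less_cSUP_iff[OF _ bg] by auto
    have at: "a * t > 0" and bt: "b * t > 0" using a b t by auto
    have "?F t \<subseteq> {- R..R}"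
    proof
      fix s assume "s \<in> ?F t"
      then have "f s \<noteq> 0" using at by auto
      then show "s \<in> {- R..R}" using f(3)[of s] by (cases "R < \<bar>s\<bar>") auto
    qed
    then show "bounded (?F t)" using bounded_closed_interval bounded_subset by blast
    have "?G t \<subseteq> {- R..R}"
    proof
      fix s assume "s \<in> ?G t"
      then have "g s \<noteq> 0" using bt by auto
      then show "s \<in> {- R..R}" using g(3)[of s] by (cases "R < \<bar>s\<bar>") auto
    qed
    then show "bounded (?G t)" using bounded_closed_interval bounded_subset by blast
    fix x y assume x: "x \<in> ?F t" and y: "y \<in> ?G t"
    have "c * t = (a * t) powr (1 - u) * (b * t) powr u"
      using a b t by (simp add: c_def powr_mult algebra_simps flip: powr_add)
    also have "\<dots> < f x powr (1 - u) * g y powr u"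
      using x y at bt u by (intro mult_strict_mono powr_less_mono2) auto
    finally have "ennreal (c * t) < ennreal (f x powr (1 - u) * g y powr u)"
      using c t by (subst ennreal_less_iff) auto
    also have "\<dots> \<le> h ((1 - u) * x + u * y)" by (rule h)
    finally show "(1 - u) * x + u * y \<in> ?H t" by simp
  qed (use u in auto)
  have fin: "(\<integral>\<^sup>+s. ennreal (q s) \<partial>lborel) < \<infinity>"
    if "\<And>s. q s \<le> M" "\<And>s. 0 \<le> q s" "\<And>s. R < \<bar>s\<bar> \<Longrightarrow> q s = 0" for q
  proof -
    have "(\<integral>\<^sup>+s. ennreal (q s) \<partial>lborel) \<le> (\<integral>\<^sup>+s. ennreal M * indicator {- R..R} s \<partial>lborel)"
    proof (rule nn_integral_mono)
      fix s show "ennreal (q s) \<le> ennreal M * indicator {- R..R} s"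
        using that(1)[of s] that(3)[of s] by (cases "R < \<bar>s\<bar>") (auto simp: indicator_def intro: ennreal_leI)
    qed
    also have "\<dots> = ennreal M * emeasure lborel {- R..R}"
      by (rule nn_integral_cmult_indicator) simp
    also have "\<dots> < \<infinity>" by (simp add: ennreal_mult_less_top emeasure_lborel_Icc_eq)
    finally show ?thesis .
  qed
  define If where "If = enn2real (\<integral>\<^sup>+s. ennreal (f s) \<partial>lborel)"
  define Ig where "Ig = enn2real (\<integral>\<^sup>+s. ennreal (g s) \<partial>lborel)"
  have If: "(\<integral>\<^sup>+s. ennreal (f s) \<partial>lborel) = ennreal If" "If \<ge> 0"
    using fin[of f] f by (auto simp: If_def)
  have Ig: "(\<integral>\<^sup>+s. ennreal (g s) \<partial>lborel) = ennreal Ig" "Ig \<ge> 0"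
    using fin[of g] g by (auto simp: Ig_def)
  have F: "(\<integral>\<^sup>+t. indicator {0<..<1} t * emeasure lborel (?F t) \<partial>lborel) = ennreal (If / a)"
  proof -
    have "ennreal a * (\<integral>\<^sup>+t. indicator {0<..<1} t * emeasure lborel (?F t) \<partial>lborel) = ennreal If"
      using nn_integral_superlevel[of f a] a f(1) fa If by simp
    also have "\<dots> = ennreal a * ennreal (If / a)" using a If by (simp flip: ennreal_mult)
    finally show ?thesis using a by (simp add: ennreal_mult_cancel_left)
  qed
  have G: "(\<integral>\<^sup>+t. indicator {0<..<1} t * emeasure lborel (?G t) \<partial>lborel) = ennreal (Ig / b)"
  proof -
    have "ennreal b * (\<integral>\<^sup>+t. indicator {0<..<1} t * emeasure lborel (?G t) \<partial>lborel) = ennreal Ig"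
      using nn_integral_superlevel[of g b] b g(1) gb Ig by simp
    also have "\<dots> = ennreal b * ennreal (Ig / b)" using b Ig by (simp flip: ennreal_mult)
    finally show ?thesis using b by (simp add: ennreal_mult_cancel_left)
  qed
  have "If powr (1 - u) * Ig powr u = c * ((If / a) powr (1 - u) * (Ig / b) powr u)"
    using a b If Ig by (simp add: c_def powr_divide)
  also have "\<dots> \<le> c * ((1 - u) * (If / a) + u * (Ig / b))"
    using a b c If Ig u by (intro mult_left_mono weighted_arith_geo_mean) auto
  finally have "ennreal (If powr (1 - u) * Ig powr u) \<le> ennreal (c * ((1 - u) * (If / a) + u * (Ig / b)))"
    by (rule ennreal_leI)
  also have "\<dots> = ennreal c * (ennreal (1 - u) * ennreal (If / a) + ennreal u * ennreal (Ig / b))"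
    using a b c If Ig u by (simp add: ennreal_mult ennreal_plus del: times_divide_eq_right)
  also have "\<dots> = ennreal c * (\<integral>\<^sup>+t. indicator {0<..<1} t * (ennreal (1 - u) * emeasure lborel (?F t) + ennreal u * emeasure lborel (?G t)) \<partial>lborel)"
    unfolding F[symmetric] G[symmetric]
    by (simp add: nn_integral_cmult[symmetric] nn_integral_add[symmetric] distrib_left mult_ac)
  also have "\<dots> \<le> ennreal c * (\<integral>\<^sup>+t. indicator {0<..<1} t * emeasure lborel (?H t) \<partial>lborel)"
    using sup by (intro mult_left_mono[OF nn_integral_mono]) (auto simp: indicator_def)
  also have "\<dots> \<le> (\<integral>\<^sup>+s. h s \<partial>lborel)"
    by (rule nn_integral_superlevel_le) (use c in auto)
  finally show ?thesis unfolding If_def Ig_def .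
qed

section \<open>Slices of product Lebesgue measure and induction on the dimension\<close>

lemma sets_lebd_section:
  assumes "A \<in> sets (lebd (Suc d))"
  shows "{x \<in> space (lebd d). x(d := t) \<in> A} \<in> sets (lebd d)"
proof -
  have "(\<lambda>x. x(d := t)) \<in> measurable (lebd d) (lebd (Suc d))"
    unfolding lebd_def by (rule measurable_fun_upd[where J = "{..<d}"]) auto
  from measurable_sets[OF this assms] show ?thesis
    by (simp add: vimage_def Int_def conj_commute)
qed

lemma product_sigma_finite_lborel: "product_sigma_finite (\<lambda>_::nat. lborel :: real measure)"
  by (simp add: product_sigma_finite_def lborel.sigma_finite_measure_axioms)

lemma sigma_finite_lebd: "sigma_finite_measure (lebd d)"
  unfolding lebd_def
  by (rule product_sigma_finite.sigma_finite[OF product_sigma_finite_lborel]) simp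

lemma emeasure_lebd_Suc:
  assumes "A \<in> sets (lebd (Suc d))"
  shows "emeasure (lebd (Suc d)) A = (\<integral>\<^sup>+t. emeasure (lebd d) {x \<in> space (lebd d). x(d := t) \<in> A} \<partial>lborel)"
proof -
  interpret product_sigma_finite "\<lambda>_::nat. lborel :: real measure" by (rule product_sigma_finite_lborel)
  have A: "A \<in> sets (Pi\<^sub>M (insert d {..<d}) (\<lambda>_. lborel))"
    using assms by (simp add: lebd_def lessThan_Suc)
  have "emeasure (lebd (Suc d)) A = (\<integral>\<^sup>+x. indicator A x \<partial>Pi\<^sub>M (insert d {..<d}) (\<lambda>_. lborel))"
    using A by (simp add: lebd_def lessThan_Suc)
  also have "\<dots> = (\<integral>\<^sup>+t. \<integral>\<^sup>+x. indicator A (x(d := t)) \<partial>(lebd d) \<partial>lborel)"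
    unfolding lebd_def by (rule product_nn_integral_insert_rev) (use A in auto)
  also have "\<dots> = (\<integral>\<^sup>+t. emeasure (lebd d) {x \<in> space (lebd d). x(d := t) \<in> A} \<partial>lborel)"
  proof (rule nn_integral_cong)
    fix t
    have "(\<integral>\<^sup>+x. indicator A (x(d := t)) \<partial>(lebd d)) = (\<integral>\<^sup>+x. indicator {x \<in> space (lebd d). x(d := t) \<in> A} x \<partial>(lebd d))"
      by (rule nn_integral_cong) (auto simp: indicator_def)
    also have "\<dots> = emeasure (lebd d) {x \<in> space (lebd d). x(d := t) \<in> A}"
      using sets_lebd_section[OF assms] by simp
    finally show "(\<integral>\<^sup>+x. indicator A (x(d := t)) \<partial>(lebd d)) = emeasure (lebd d) {x \<in> space (lebd d). x(d := t) \<in> A}" .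
  qed
  finally show ?thesis .
qed

lemma measurable_emeasure_lebd_section:
  assumes "A \<in> sets (lebd (Suc d))"
  shows "(\<lambda>t. emeasure (lebd d) {x \<in> space (lebd d). x(d := t) \<in> A}) \<in> borel_measurable borel"
proof -
  interpret sigma_finite_measure "lebd d" by (rule sigma_finite_lebd)
  have upd: "(\<lambda>(t, x). x(d := t)) \<in> measurable (borel \<Otimes>\<^sub>M lebd d) (lebd (Suc d))"
    unfolding lebd_def case_prod_beta by (rule measurable_fun_upd[where J = "{..<d}"]) (auto)
  then have S: "(\<lambda>(t, x). x(d := t)) -` A \<inter> space (borel \<Otimes>\<^sub>M lebd d) \<in> sets (borel \<Otimes>\<^sub>M lebd d)"
    using assms by (rule measurable_sets)
  have "(\<lambda>t. emeasure (lebd d) (Pair t -` ((\<lambda>(t, x). x(d := t)) -` A \<inter> space (borel \<Otimes>\<^sub>M lebd d)))) \<in> borel_measurable borel"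
    using S by (rule measurable_emeasure_Pair)
  moreover have "Pair t -` ((\<lambda>(t, x). x(d := t)) -` A \<inter> space (borel \<Otimes>\<^sub>M lebd d)) = {x \<in> space (lebd d). x(d := t) \<in> A}" for t
    by (auto simp: space_pair_measure)
  ultimately show ?thesis by simp
qed

lemma emeasure_lebd_cube:
  "emeasure (lebd d) (Pi\<^sub>E {..<d} (\<lambda>i. {l i..l i + r})) = ennreal (r ^ d)" if "r \<ge> 0"
  unfolding lebd_def
  by (subst product_sigma_finite.emeasure_PiM[OF product_sigma_finite_lborel])
     (use that in \<open>auto simp: prod_ennreal ennreal_power\<close>)

text \<open>The slice of \<open>C\<close> at height (1-u) s + u t contains the combinations of the
  slices of \<open>A\<close> at s and of \<open>B\<close> at t. So the induction hypothesis is
  exactly the pointwise hypothesis of Prekopa--Leindler for the slice volumes, and Fubini turns its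
  conclusion into the claim. Dimension 0 is a one-point space of mass 1, where an empty set makes
  the left side 0.\<close>

lemma brunn_minkowski_lebd:
  assumes "A \<in> sets (lebd d)" "B \<in> sets (lebd d)" "C \<in> sets (lebd d)"
    and "A \<subseteq> Pi\<^sub>E {..<d} (\<lambda>_. {- R..R})" "B \<subseteq> Pi\<^sub>E {..<d} (\<lambda>_. {- R..R})" and R: "0 \<le> R"
    and u: "0 < u" "u < 1"
    and "\<And>x y. x \<in> A \<Longrightarrow> y \<in> B \<Longrightarrow> (\<lambda>i\<in>{..<d}. (1 - u) * x i + u * y i) \<in> C"
  shows "ennreal (measure (lebd d) A powr (1 - u) * measure (lebd d) B powr u) \<le> emeasure (lebd d) C"
  using assms(1-5,9)
proof (induction d arbitrary: A B C)
  case 0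
  have sp: "space (lebd 0) = {\<lambda>_. undefined}" by (simp add: lebd_def space_PiM)
  have one: "emeasure (lebd 0) {\<lambda>_. undefined} = 1" by (simp add: lebd_def)
  have "A \<subseteq> {\<lambda>_. undefined}" "B \<subseteq> {\<lambda>_. undefined}" "C \<subseteq> {\<lambda>_. undefined}"
    using 0 sets.sets_into_space sp by metis+
  then consider "A = {} \<or> B = {}" | "A = {\<lambda>_. undefined}" "B = {\<lambda>_. undefined}" "C = {\<lambda>_. undefined}"
    using 0(6) by (auto simp: subset_singleton_iff restrict_def)
  then show ?case
    by cases (auto simp: one measure_def)
next
  case (Suc d)
  define sec where "sec = (\<lambda>A t. {x \<in> space (lebd d). x(d := t) \<in> A})"
  have sb: "sec S t \<subseteq> Pi\<^sub>E {..<d} (\<lambda>_. {- R..R})" if "S \<subseteq> Pi\<^sub>E {..<Suc d} (\<lambda>_. {- R..R})" for S t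
  proof
    fix x assume x: "x \<in> sec S t"
    then have "x(d := t) \<in> Pi\<^sub>E {..<Suc d} (\<lambda>_. {- R..R})" and "x \<in> extensional {..<d}"
      using that by (auto simp: sec_def lebd_def space_PiM PiE_def)
    moreover have "x i \<in> {-R..R}" if "i < d" for i
      using PiE_mem[OF \<open>x(d := t) \<in> Pi\<^sub>E {..<Suc d} (\<lambda>_. {- R..R})\<close>, of i] that by auto
    ultimately show "x \<in> Pi\<^sub>E {..<d} (\<lambda>_. {- R..R})" by (auto simp: PiE_def)
  qed
  have cube: "emeasure (lebd d) (Pi\<^sub>E {..<d} (\<lambda>_. {- R..R})) = ennreal ((2 * R) ^ d)"
    using emeasure_lebd_cube[of "2 * R" d "\<lambda>_. - R"] R by simp
  have cubeS: "Pi\<^sub>E {..<d} (\<lambda>_. {- R..R}) \<in> sets (lebd d)"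
    unfolding lebd_def by (intro sets_PiM_I_finite) auto
  have le: "emeasure (lebd d) (sec S t) \<le> ennreal ((2 * R) ^ d)"
    if "S \<subseteq> Pi\<^sub>E {..<Suc d} (\<lambda>_. {- R..R})" for S t
    using emeasure_mono[OF sb[OF that] cubeS] cube by simp
  define f where "f = (\<lambda>t. measure (lebd d) (sec A t))"
  define g where "g = (\<lambda>t. measure (lebd d) (sec B t))"
  have f: "ennreal (f t) = emeasure (lebd d) (sec A t)" for t
    unfolding f_def using le[OF Suc.prems(4), of t] by (intro emeasure_eq_ennreal_measure[symmetric]) (auto simp: top_unique)
  have g: "ennreal (g t) = emeasure (lebd d) (sec B t)" for t
    unfolding g_def using le[OF Suc.prems(5), of t] by (intro emeasure_eq_ennreal_measure[symmetric]) (auto simp: top_unique)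
  have eA: "emeasure (lebd (Suc d)) A = (\<integral>\<^sup>+t. ennreal (f t) \<partial>lborel)"
    using emeasure_lebd_Suc[OF Suc.prems(1)] by (simp add: f sec_def)
  have eB: "emeasure (lebd (Suc d)) B = (\<integral>\<^sup>+t. ennreal (g t) \<partial>lborel)"
    using emeasure_lebd_Suc[OF Suc.prems(2)] by (simp add: g sec_def)
  have eC: "emeasure (lebd (Suc d)) C = (\<integral>\<^sup>+t. emeasure (lebd d) (sec C t) \<partial>lborel)"
    using emeasure_lebd_Suc[OF Suc.prems(3)] by (simp add: sec_def)
  have empty: "sec S t = {}" if "S \<subseteq> Pi\<^sub>E {..<Suc d} (\<lambda>_. {- R..R})" "R < \<bar>t\<bar>" for S t
  proof -
    have False if "x(d := t) \<in> S" for x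
      using PiE_mem[OF subsetD[OF \<open>S \<subseteq> _\<close> that], of d] \<open>R < \<bar>t\<bar>\<close> by auto
    then show ?thesis by (auto simp: sec_def)
  qed
  have "ennreal (enn2real (\<integral>\<^sup>+s. ennreal (f s) \<partial>lborel) powr (1 - u)
       * enn2real (\<integral>\<^sup>+s. ennreal (g s) \<partial>lborel) powr u) \<le> (\<integral>\<^sup>+s. emeasure (lebd d) (sec C s) \<partial>lborel)"
  proof (rule prekopa_leindler_real[where M = "(2 * R) ^ d" and R = R])
    show "f \<in> borel_measurable borel" "g \<in> borel_measurable borel" 
      unfolding f_def g_def sec_def measure_def
      by (intro borel_measurable_enn2real measurable_emeasure_lebd_section Suc.prems)+
    show "(\<lambda>s. emeasure (lebd d) (sec C s)) \<in> borel_measurable borel"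
      unfolding sec_def by (intro measurable_emeasure_lebd_section Suc.prems)
    show "f s \<le> (2 * R) ^ d" for s
      using le[OF Suc.prems(4), of s] f R by (metis ennreal_le_iff zero_le_power mult_nonneg_nonneg zero_le_numeral)
    show "g s \<le> (2 * R) ^ d" for s
      using le[OF Suc.prems(5), of s] g R by (metis ennreal_le_iff zero_le_power mult_nonneg_nonneg zero_le_numeral)
    show "f s = 0" if "R < \<bar>s\<bar>" for s using empty[OF Suc.prems(4) that] by (simp add: f_def)
    show "g s = 0" if "R < \<bar>s\<bar>" for s using empty[OF Suc.prems(5) that] by (simp add: g_def)
    show "ennreal (f s powr (1 - u) * g t powr u) \<le> emeasure (lebd d) (sec C ((1 - u) * s + u * t))" for s t
      unfolding f_def g_def
    proof (rule Suc.IH)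
      show "sec A s \<in> sets (lebd d)" "sec B t \<in> sets (lebd d)" "sec C ((1 - u) * s + u * t) \<in> sets (lebd d)"
        unfolding sec_def by (intro sets_lebd_section Suc.prems)+
      show "sec A s \<subseteq> Pi\<^sub>E {..<d} (\<lambda>_. {- R..R})" "sec B t \<subseteq> Pi\<^sub>E {..<d} (\<lambda>_. {- R..R})"
        by (intro sb Suc.prems)+
      fix x y assume x: "x \<in> sec A s" and y: "y \<in> sec B t"
      let ?z = "\<lambda>i\<in>{..<d}. (1 - u) * x i + u * y i"
      have "x(d := s) \<in> A" "y(d := t) \<in> B"
        using x y unfolding sec_def by blast+
      then have "(\<lambda>i\<in>{..<Suc d}. (1 - u) * (x(d := s)) i + u * (y(d := t)) i) \<in> C"
        by (rule Suc.prems(6))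
      also have "(\<lambda>i\<in>{..<Suc d}. (1 - u) * (x(d := s)) i + u * (y(d := t)) i) = ?z(d := (1 - u) * s + u * t)"
        by (auto simp: fun_eq_iff restrict_def)
      finally have "?z(d := (1 - u) * s + u * t) \<in> C" .
      moreover have "?z \<in> space (lebd d)" by (auto simp: lebd_def space_PiM)
      ultimately show "?z \<in> sec C ((1 - u) * s + u * t)" unfolding sec_def by blast
    qed
  qed (use u in \<open>auto simp: f_def g_def\<close>)
  then show ?case
    by (simp add: measure_def eA eB eC)
qed

section \<open>Lebesgue measure on the coordinate subspace\<close>

text \<open>Points of \<open>lebd d\<close> are \<open>undefined\<close> from coordinate
  \<open>d\<close> on, points of \<open>E d\<close> are 0 there; \<open>emb\<close> passes from the
  first convention to the second.\<close>

definition emb :: "nat \<Rightarrow> (nat \<Rightarrow> real) \<Rightarrow> nat \<Rightarrow> real" where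
  "emb d x = (\<lambda>i. if i < d then x i else 0)"

text \<open>d-dimensional Lebesgue measure seen as a Borel measure on the whole function space,
  concentrated on \<open>E d\<close>. Sets and maps can thus be treated without
  restrictions.\<close>

definition lebE :: "nat \<Rightarrow> (nat \<Rightarrow> real) measure" where
  "lebE d = distr (lebd d) borel (emb d)"

lemma sets_lebE [simp, measurable_cong]: "sets (lebE d) = sets borel"
  and space_lebE [simp]: "space (lebE d) = UNIV"
  by (simp_all add: lebE_def)

lemma measurable_coord [measurable]: "(\<lambda>x::nat \<Rightarrow> real. x i) \<in> borel_measurable borel"
  by (rule borel_measurable_continuous_onI) (intro continuous_on_product_coordinates)

lemma measurable_emb [measurable]: "emb d \<in> measurable (lebd d) borel"
proof (rule measurable_coordinatewise_then_product)
  fix i show "(\<lambda>x. emb d x i) \<in> borel_measurable (lebd d)"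
  proof (cases "i < d")
    case True
    then have i: "i \<in> {..<d}" by simp
    from measurable_component_singleton[OF i, of "\<lambda>_. lborel :: real measure"] True
    show ?thesis by (simp add: emb_def lebd_def)
  qed (simp add: emb_def)
qed

lemma emb_in_E [simp]: "emb d x \<in> E d" by (simp add: emb_def E_def)

lemma emb_E [simp]: "x \<in> E d \<Longrightarrow> emb d x = x" by (auto simp: emb_def E_def fun_eq_iff)

lemma emb_restrict [simp]: "emb d (restrict x {..<d}) = emb d x"
  by (auto simp: emb_def)

lemma restrict_emb: "x \<in> space (lebd d) \<Longrightarrow> restrict (emb d x) {..<d} = x"
  by (auto simp: emb_def lebd_def space_PiM PiE_def extensional_def fun_eq_iff)

lemma E_add: "x \<in> E d \<Longrightarrow> y \<in> E d \<Longrightarrow> x + y \<in> E d"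
  and E_diff: "x \<in> E d \<Longrightarrow> y \<in> E d \<Longrightarrow> x - y \<in> E d"
  and E_scaleR: "x \<in> E d \<Longrightarrow> c *\<^sub>R x \<in> E d"
  and E_minus: "x \<in> E d \<Longrightarrow> - x \<in> E d"
  and E_zero: "0 \<in> E d"
  by (simp_all add: E_def)

lemma closed_E: "closed (E d)"
proof -
  have "E d = (\<Inter>i\<in>{d..}. {x. x i = 0})" by (auto simp: E_def)
  also have "closed \<dots>"
    by (intro closed_INT ballI closed_Collect_eq continuous_on_product_coordinates continuous_on_const)
  finally show ?thesis .
qed

lemma E_borel [measurable]: "E d \<in> sets borel" using closed_E by auto

lemma AE_lebE_E: "AE x in lebE d. x \<in> E d"
  unfolding lebE_def by (subst AE_distr_iff) auto

text \<open>Turns the image in the definition of \<open>vol\<close> into a preimage under a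
  measurable map, so that Borel sets need no further measurability argument.\<close>

lemma restrict_image_eq:
  assumes "S \<subseteq> E d"
  shows "(\<lambda>x. restrict x {..<d}) ` S = emb d -` S \<inter> space (lebd d)"
proof (intro set_eqI iffI)
  fix y assume "y \<in> (\<lambda>x. restrict x {..<d}) ` S"
  then obtain x where "x \<in> S" "y = restrict x {..<d}" by blast
  moreover have "restrict x {..<d} \<in> space (lebd d)" by (simp add: lebd_def space_PiM restrict_PiE_iff)
  ultimately show "y \<in> emb d -` S \<inter> space (lebd d)"
    using assms by auto
next
  fix y assume "y \<in> emb d -` S \<inter> space (lebd d)"
  then show "y \<in> (\<lambda>x. restrict x {..<d}) ` S"
    using restrict_emb[of y d] by (metis IntE image_eqI vimageE)
qed

lemma vol_eq:
  assumes "S \<subseteq> E d" "S \<in> sets borel"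
  shows "vol d S = measure (lebE d) S"
  unfolding vol_def restrict_image_eq[OF assms(1)] lebE_def
  using assms(2) by (subst measure_distr) auto

lemma sigma_finite_lebE: "sigma_finite_measure (lebE d)"
proof -
  interpret sigma_finite_measure "lebd d" by (rule sigma_finite_lebd)
  \<comment> \<open>Coordinates from \<open>d\<close> on are left free: these sets have to exhaust
    the whole function space, while \<open>lebE d\<close> only sees the first \<open>d\<close>
    coordinates.\<close>
  define F where "F = (\<lambda>n::nat. {x::nat \<Rightarrow> real. \<forall>i<d. \<bar>x i\<bar> \<le> real n})"
  have FB: "F n \<in> sets borel" for n
    unfolding F_def by measurable
  have fin: "emeasure (lebE d) (F n) \<noteq> \<infinity>" for n
  proof -
    have "emeasure (lebE d) (F n) = emeasure (lebd d) (emb d -` F n \<inter> space (lebd d))"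
      unfolding lebE_def using FB by (intro emeasure_distr) auto
    also have "emb d -` F n \<inter> space (lebd d) = Pi\<^sub>E {..<d} (\<lambda>i. {- real n..- real n + 2 * real n})"
      by (auto simp: F_def emb_def lebd_def space_PiM PiE_def Pi_def abs_le_iff)
    also have "emeasure (lebd d) \<dots> = ennreal ((2 * real n) ^ d)"
      by (rule emeasure_lebd_cube) simp
    finally show ?thesis by simp
  qed
  have un: "(\<Union>n. F n) = UNIV"
  proof -
    have "\<exists>n. x \<in> F n" for x
    proof -
      obtain n :: nat where "(\<Sum>i<d. \<bar>x i\<bar>) \<le> real n" using real_arch_simple by blast
      moreover have "\<bar>x i\<bar> \<le> (\<Sum>i<d. \<bar>x i\<bar>)" if "i < d" for i
        using that by (intro member_le_sum) auto
      ultimately have "\<bar>x i\<bar> \<le> real n" if "i < d" for i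
        using that by (meson order_trans)
      then show ?thesis unfolding F_def by blast
    qed
    then show ?thesis by blast
  qed
  have "countable (range F)" "range F \<subseteq> sets (lebE d)" "\<Union>(range F) = space (lebE d)"
    "\<forall>a\<in>range F. emeasure (lebE d) a \<noteq> \<infinity>"
    using FB fin un by auto
  then show ?thesis
    by (intro sigma_finite_measure.intro exI[of _ "range F"]) blast
qed

text \<open>A product measure is determined by its values on boxes, and there each of the
  \<open>d\<close> coordinates contributes one factor \<open>\<bar>c\<bar>\<close>.\<close>

lemma lebd_affine:
  assumes c: "c \<noteq> 0"
  shows "lebd d = density (distr (lebd d) (lebd d) (\<lambda>x. \<lambda>i\<in>{..<d}. v i + c * x i)) (\<lambda>_. ennreal (\<bar>c\<bar> ^ d))"
proof -
  interpret product_sigma_finite "\<lambda>_::nat. lborel :: real measure" by (rule product_sigma_finite_lborel)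
  let ?T = "\<lambda>x. \<lambda>i\<in>{..<d}. v i + c * x i"
  let ?P = "density (distr (lebd d) (lebd d) ?T) (\<lambda>_. ennreal (\<bar>c\<bar> ^ d))"
  have T: "?T \<in> measurable (lebd d) (lebd d)"
    unfolding lebd_def by (intro measurable_restrict) measurable
  have "?P = Pi\<^sub>M {..<d} (\<lambda>_. lborel)"
  proof (rule PiM_eqI)
    fix A :: "nat \<Rightarrow> real set" assume A: "\<And>i. i \<in> {..<d} \<Longrightarrow> A i \<in> sets lborel"
    have S: "Pi\<^sub>E {..<d} A \<in> sets (lebd d)"
      unfolding lebd_def using A by (intro sets_PiM_I_finite) auto
    have one: "emeasure lborel (A i) = ennreal \<bar>c\<bar> * emeasure lborel ((\<lambda>x. v i + c * x) -` A i)" if "i < d" for i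
    proof -
      have [measurable]: "A i \<in> sets borel" using A that by auto
      have "emeasure lborel (A i) = (\<integral>\<^sup>+x. indicator (A i) x \<partial>lborel)" by simp
      also have "\<dots> = ennreal \<bar>c\<bar> * (\<integral>\<^sup>+x. indicator (A i) (v i + c * x) \<partial>lborel)"
        using c by (intro nn_integral_real_affine) auto
      also have "(\<lambda>x. indicator (A i) (v i + c * x) :: ennreal) = indicator ((\<lambda>x. v i + c * x) -` A i)"
        by (auto simp: indicator_def fun_eq_iff)
      also have "(\<lambda>x. v i + c * x) -` A i \<in> sets borel"
        using measurable_sets[of "\<lambda>x. v i + c * x" borel borel "A i"] by simp
      ultimately show ?thesis by simp
    qed
    have pre: "?T -` Pi\<^sub>E {..<d} A \<inter> space (lebd d) = Pi\<^sub>E {..<d} (\<lambda>i. (\<lambda>x. v i + c * x) -` A i)"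
      by (auto simp: lebd_def space_PiM PiE_def Pi_def)
    have "emeasure ?P (Pi\<^sub>E {..<d} A) = ennreal (\<bar>c\<bar> ^ d) * emeasure (distr (lebd d) (lebd d) ?T) (Pi\<^sub>E {..<d} A)"
      using S by (subst emeasure_density_const) auto
    also have "emeasure (distr (lebd d) (lebd d) ?T) (Pi\<^sub>E {..<d} A)
        = emeasure (lebd d) (Pi\<^sub>E {..<d} (\<lambda>i. (\<lambda>x. v i + c * x) -` A i))"
      using T S by (subst emeasure_distr) (auto simp: pre)
    also have "\<dots> = (\<Prod>i<d. emeasure lborel ((\<lambda>x. v i + c * x) -` A i))"
    proof -
      have "(\<lambda>x. v i + c * x) -` A i \<in> sets lborel" if "i \<in> {..<d}" for i
        using measurable_sets[of "\<lambda>x. v i + c * x" borel borel "A i"] A[OF that] by simp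
      from emeasure_PiM[OF finite_lessThan this] show ?thesis unfolding lebd_def .
    qed
    also have "ennreal (\<bar>c\<bar> ^ d) * \<dots> = (\<Prod>i<d. ennreal \<bar>c\<bar> * emeasure lborel ((\<lambda>x. v i + c * x) -` A i))"
      by (simp add: prod.distrib ennreal_power)
    also have "\<dots> = (\<Prod>i<d. emeasure lborel (A i))"
      by (intro prod.cong) (auto simp: one)
    finally show "emeasure ?P (Pi\<^sub>E {..<d} A) = (\<Prod>i<d. emeasure lborel (A i))" .
  qed (auto simp: lebd_def)
  then show ?thesis by (simp add: lebd_def)
qed

lemma nn_integral_lebE: "f \<in> borel_measurable borel \<Longrightarrow> (\<integral>\<^sup>+x. f x \<partial>lebE d) = (\<integral>\<^sup>+x. f (emb d x) \<partial>lebd d)"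
  unfolding lebE_def by (rule nn_integral_distr) auto

lemma measurable_affine [measurable]: "(\<lambda>x::nat \<Rightarrow> real. v + c *\<^sub>R x) \<in> measurable borel borel"
  by (rule measurable_coordinatewise_then_product) (simp, measurable)

lemma nn_integral_lebE_affine:
  fixes f :: "(nat \<Rightarrow> real) \<Rightarrow> ennreal"
  assumes [measurable]: "f \<in> borel_measurable borel" and c: "c \<noteq> 0" and v: "v \<in> E d"
  shows "(\<integral>\<^sup>+x. f x \<partial>lebE d) = ennreal (\<bar>c\<bar> ^ d) * (\<integral>\<^sup>+x. f (v + c *\<^sub>R x) \<partial>lebE d)"
proof -
  let ?T = "\<lambda>x. \<lambda>i\<in>{..<d}. v i + c * x i"
  have T [measurable]: "?T \<in> measurable (lebd d) (lebd d)"
    unfolding lebd_def by (intro measurable_restrict) measurable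
  have "(\<integral>\<^sup>+x. f x \<partial>lebE d) = (\<integral>\<^sup>+x. f (emb d x) \<partial>lebd d)" by (rule nn_integral_lebE) simp
  also have "\<dots> = (\<integral>\<^sup>+x. f (emb d x) \<partial>density (distr (lebd d) (lebd d) ?T) (\<lambda>_. ennreal (\<bar>c\<bar> ^ d)))"
    by (subst lebd_affine[OF c, of d v]) rule
  also have "\<dots> = (\<integral>\<^sup>+x. ennreal (\<bar>c\<bar> ^ d) * f (emb d x) \<partial>distr (lebd d) (lebd d) ?T)"
    by (subst nn_integral_density) auto
  also have "\<dots> = (\<integral>\<^sup>+x. ennreal (\<bar>c\<bar> ^ d) * f (emb d (?T x)) \<partial>lebd d)"
    by (subst nn_integral_distr) auto
  also have "\<dots> = (\<integral>\<^sup>+x. ennreal (\<bar>c\<bar> ^ d) * f (v + c *\<^sub>R emb d x) \<partial>lebd d)"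
  proof (intro nn_integral_cong arg_cong2[where f = "(*)"] refl arg_cong[where f = f])
    fix x show "emb d (?T x) = v + c *\<^sub>R emb d x"
      using v by (auto simp: emb_def E_def fun_eq_iff)
  qed
  also have "\<dots> = ennreal (\<bar>c\<bar> ^ d) * (\<integral>\<^sup>+x. f (v + c *\<^sub>R emb d x) \<partial>lebd d)"
    by (rule nn_integral_cmult) simp
  also have "(\<integral>\<^sup>+x. f (v + c *\<^sub>R emb d x) \<partial>lebd d) = (\<integral>\<^sup>+x. f (v + c *\<^sub>R x) \<partial>lebE d)"
    by (rule nn_integral_lebE[symmetric]) simp
  finally show ?thesis .
qed

lemma continuous_on_affine [continuous_intros]: "continuous_on S (\<lambda>x::nat \<Rightarrow> real. v + c *\<^sub>R x)"
  unfolding continuous_on_coordinatewise_iff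
  by (auto intro!: continuous_intros continuous_on_subset[OF continuous_on_product_coordinates])

lemma compact_borel: "compact S \<Longrightarrow> S \<in> sets borel" for S :: "(nat \<Rightarrow> real) set"
  by (simp add: compact_imp_closed)

lemma compact_affine: "compact S \<Longrightarrow> compact ((\<lambda>x::nat \<Rightarrow> real. v + c *\<^sub>R x) ` S)"
  by (intro compact_continuous_image continuous_intros)

lemma compact_diff_image:
  fixes S T :: "(nat \<Rightarrow> real) set"
  assumes "compact S" "compact T"
  shows "compact ((\<lambda>(x, y). x - y) ` (S \<times> T))"
proof (rule compact_continuous_image)
  have "continuous_on (S \<times> T) (\<lambda>x. (case x of (x, y) \<Rightarrow> x - y) i)" for i
    unfolding case_prod_beta fun_diff_def
    by (intro continuous_intros continuous_on_product_then_coordinatewise)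
  then show "continuous_on (S \<times> T) (\<lambda>(x, y). x - y)"
    by (rule continuous_on_coordinatewise_then_product)
qed (use assms in \<open>rule compact_Times\<close>)

lemma emeasure_affine_image:
  assumes S: "S \<in> sets borel" and S': "(\<lambda>x. v + c *\<^sub>R x) ` S \<in> sets borel" and c: "c \<noteq> 0" and v: "v \<in> E d"
  shows "emeasure (lebE d) ((\<lambda>x. v + c *\<^sub>R x) ` S) = ennreal (\<bar>c\<bar> ^ d) * emeasure (lebE d) S"
proof -
  let ?T = "\<lambda>x. v + c *\<^sub>R x"
  have "inj ?T" using c by (auto simp: inj_def)
  then have *: "(\<lambda>x. indicator (?T ` S) (?T x) :: ennreal) = indicator S"
    unfolding indicator_def by (simp only: inj_image_mem_iff[OF \<open>inj ?T\<close>])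
  have "emeasure (lebE d) (?T ` S) = (\<integral>\<^sup>+x. indicator (?T ` S) x \<partial>lebE d)"
    using S' by simp
  also have "\<dots> = ennreal (\<bar>c\<bar> ^ d) * (\<integral>\<^sup>+x. indicator (?T ` S) (?T x) \<partial>lebE d)"
    using S' by (intro nn_integral_lebE_affine c v) auto
  also have "\<dots> = ennreal (\<bar>c\<bar> ^ d) * emeasure (lebE d) S"
    unfolding * using S by simp
  finally show ?thesis .
qed

lemma measure_affine_image:
  assumes "compact S" "c \<noteq> 0" "v \<in> E d"
  shows "measure (lebE d) ((\<lambda>x. v + c *\<^sub>R x) ` S) = \<bar>c\<bar> ^ d * measure (lebE d) S"
  using emeasure_affine_image[OF compact_borel[OF assms(1)] compact_borel[OF compact_affine[OF assms(1)]] assms(2,3)]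
  by (simp add: measure_def enn2real_mult)

text \<open>The closed sup-norm ball of \<open>E d\<close>. It serves as the standard neighbourhood
  of 0: its volume is read off the product structure, and membership is checked coordinate by
  coordinate.\<close>

definition cube :: "nat \<Rightarrow> real \<Rightarrow> (nat \<Rightarrow> real) set" where
  "cube d r = {x \<in> E d. \<forall>i<d. \<bar>x i\<bar> \<le> r}"

lemma cube_borel [measurable]: "cube d r \<in> sets borel"
  unfolding cube_def by measurable

lemma emb_vimage_cube:
  "emb d -` cube d r \<inter> space (lebd d) = Pi\<^sub>E {..<d} (\<lambda>i. {- r..r})"
  by (auto simp: cube_def lebd_def space_PiM PiE_def Pi_def abs_le_iff)
     (auto simp: emb_def minus_le_iff split: if_splits)

lemma emeasure_cube: "r \<ge> 0 \<Longrightarrow> emeasure (lebE d) (cube d r) = ennreal ((2 * r) ^ d)"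
  using emeasure_lebd_cube[of "2 * r" d "\<lambda>_. - r"]
  by (simp add: lebE_def emeasure_distr emb_vimage_cube)

lemma compact_bounded_cube:
  assumes "compact S" "S \<subseteq> E d"
  obtains R where "R > 0" "S \<subseteq> cube d R"
proof -
  have "\<exists>R. \<forall>x\<in>S. \<bar>x i\<bar> \<le> R" for i
  proof -
    have "compact ((\<lambda>x. x i) ` S)"
      by (intro compact_continuous_image assms continuous_on_subset[OF continuous_on_product_coordinates]) auto
    then show ?thesis using compact_imp_bounded bounded_iff by (metis imageI real_norm_def)
  qed
  then obtain f where f: "\<And>i x. x \<in> S \<Longrightarrow> \<bar>x i\<bar> \<le> f i" by metis
  define R where "R = (\<Sum>i<d. \<bar>f i\<bar>) + 1"
  have "S \<subseteq> cube d R"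
  proof
    fix x assume x: "x \<in> S"
    have "\<bar>x i\<bar> \<le> R" if "i < d" for i
    proof -
      have "\<bar>f i\<bar> \<le> (\<Sum>i<d. \<bar>f i\<bar>)" using that by (intro member_le_sum) auto
      then show ?thesis using f[OF x, of i] abs_ge_self[of "f i"] unfolding R_def by linarith
    qed
    then show "x \<in> cube d R" using x assms(2) by (auto simp: cube_def)
  qed
  moreover have "0 \<le> (\<Sum>i<d. \<bar>f i\<bar>)" by (rule sum_nonneg) simp
  then have "R > 0" unfolding R_def by linarith
  ultimately show thesis using that by blast
qed

lemma emeasure_compact_finite: "compact S \<Longrightarrow> S \<subseteq> E d \<Longrightarrow> emeasure (lebE d) S < \<infinity>"
proof -
  assume S: "compact S" "S \<subseteq> E d"
  then obtain R where R: "R > 0" "S \<subseteq> cube d R" using compact_bounded_cube by blast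
  have "emeasure (lebE d) S \<le> emeasure (lebE d) (cube d R)" by (rule emeasure_mono) (use R in auto)
  also have "\<dots> < \<infinity>" using R by (simp add: emeasure_cube)
  finally show ?thesis .
qed

theorem brunn_minkowski:
  assumes A: "compact A" "A \<subseteq> E d" and B: "compact B" "B \<subseteq> E d" and C: "compact C" "C \<subseteq> E d"
    and u: "0 < u" "u < 1"
    and sub: "\<And>x y. x \<in> A \<Longrightarrow> y \<in> B \<Longrightarrow> (1 - u) *\<^sub>R x + u *\<^sub>R y \<in> C"
  shows "measure (lebE d) A powr (1 - u) * measure (lebE d) B powr u \<le> measure (lebE d) C"
proof -
  obtain R1 where R1: "R1 > 0" "A \<subseteq> cube d R1" using compact_bounded_cube A by blast
  obtain R2 where R2: "R2 > 0" "B \<subseteq> cube d R2" using compact_bounded_cube B by blast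
  define R where "R = max R1 R2"
  have mono: "cube d r \<subseteq> cube d s" if "r \<le> s" for r s using that by (auto simp: cube_def)
  have AR: "A \<subseteq> cube d R" and BR: "B \<subseteq> cube d R"
    using R1 R2 mono[of R1 R] mono[of R2 R] by (auto simp: R_def)
  let ?e = "\<lambda>S. emb d -` S \<inter> space (lebd d)"
  have meas: "?e S \<in> sets (lebd d)" if "compact S" for S
    using compact_borel[OF that] by (rule measurable_sets[OF measurable_emb])
  have m: "measure (lebE d) S = measure (lebd d) (?e S)" if "compact S" for S
    unfolding lebE_def by (rule measure_distr) (use compact_borel[OF that] in auto)
  have "ennreal (measure (lebd d) (?e A) powr (1 - u) * measure (lebd d) (?e B) powr u) \<le> emeasure (lebd d) (?e C)"
  proof (rule brunn_minkowski_lebd[where R = R])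
    show "?e A \<subseteq> Pi\<^sub>E {..<d} (\<lambda>_. {- R..R})" "?e B \<subseteq> Pi\<^sub>E {..<d} (\<lambda>_. {- R..R})"
      using AR BR emb_vimage_cube[of d R] by blast+
    fix x y assume x: "x \<in> ?e A" and y: "y \<in> ?e B"
    have "emb d (\<lambda>i\<in>{..<d}. (1 - u) * x i + u * y i) = (1 - u) *\<^sub>R emb d x + u *\<^sub>R emb d y"
      by (auto simp: emb_def fun_eq_iff)
    also have "\<dots> \<in> C" using x y by (intro sub) auto
    finally show "(\<lambda>i\<in>{..<d}. (1 - u) * x i + u * y i) \<in> ?e C"
      by (auto simp: lebd_def space_PiM)
  qed (use u A B C meas R1 in \<open>auto simp: R_def\<close>)
  also have "\<dots> = emeasure (lebE d) C"
    unfolding lebE_def using compact_borel[OF C(1)] by (intro emeasure_distr[symmetric]) auto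
  also have "\<dots> = ennreal (measure (lebE d) C)"
    using emeasure_compact_finite[OF C] by (intro emeasure_eq_ennreal_measure) auto
  finally show ?thesis using A B by (simp add: m)
qed

section \<open>Supporting functionals and barycentres\<close>

lemma cube_translate_coord:
  assumes "k < d" "0 \<le> r" "\<bar>t\<bar> \<le> r"
  shows "(\<lambda>i. if i = k then t else 0) \<in> cube d r"
  using assms by (auto simp: cube_def E_def)

text \<open>Finite-dimensional Hahn--Banach: the functional is extended one coordinate at a time.\<close>

lemma supporting_functional:
  fixes g :: "(nat \<Rightarrow> real) \<Rightarrow> real"
  assumes g: "convex_on S g" and SE: "S \<subseteq> E d" and r: "r > 0"
    and q: "\<And>y. y \<in> cube d r \<Longrightarrow> q + y \<in> S"
  obtains a :: "nat \<Rightarrow> real" where "\<And>x. x \<in> S \<Longrightarrow> g q + (\<Sum>i<d. a i * (x i - q i)) \<le> g x"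
proof -
  have "0 \<in> cube d r" using r by (simp add: cube_def E_zero)
  from q[OF this] have qS: "q \<in> S" by simp
  have "\<exists>a. \<forall>x\<in>S. (\<forall>i\<ge>k. x i = q i) \<longrightarrow> g q + (\<Sum>i<k. a i * (x i - q i)) \<le> g x" if "k \<le> d" for k
    using that
  proof (induction k)
    case 0
    have "x = q" if "\<forall>i\<ge>0. x i = q i" for x using that by auto
    then show ?case by auto
  next
    case (Suc k)
    then obtain a where a: "\<And>x. x \<in> S \<Longrightarrow> (\<And>i. i \<ge> k \<Longrightarrow> x i = q i) \<Longrightarrow> g q + (\<Sum>i<k. a i * (x i - q i)) \<le> g x"
      by auto
    define l where "l = (\<lambda>x::nat \<Rightarrow> real. \<Sum>i<k. a i * (x i - q i))"
    define D where "D = (\<lambda>x. g x - g q - l x)"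
    define T where "T = {x \<in> S. \<forall>i\<ge>Suc k. x i = q i}"
    have key: "0 \<le> D x * s + D y * t"
      if x: "x \<in> T" and t: "t = x k - q k" "t > 0" and y: "y \<in> T" and s: "s = q k - y k" "s > 0" for x y s t
    proof -
      \<comment> \<open>\<open>x\<close> lies above and \<open>y\<close> below the hyperplane on
        which coordinate \<open>k\<close> equals \<open>q k\<close>. With this weight the
        combination \<open>z\<close> lies on it, where the induction hypothesis applies.\<close>
      define u where "u = t / (s + t)"
      have u: "0 \<le> u" "u \<le> 1" "1 - u = s / (s + t)" using s t by (auto simp: u_def field_simps)
      define z where "z = (1 - u) *\<^sub>R x + u *\<^sub>R y"
      have "convex S" using g by (rule convex_on_imp_convex)
      then have zS: "z \<in> S" unfolding z_def by (rule convexD_alt) (use x y u(1,2) in \<open>auto simp: T_def\<close>)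
      have "z i = q i" if "i \<ge> k" for i
      proof (cases "i = k")
        case True
        have "x k = q k + t" "y k = q k - s" using s t by auto
        moreover have "(1 - u) * t = u * s" using s t by (simp add: u(3)) (simp add: u_def)
        moreover have "(1 - u) * (q k + t) + u * (q k - s) = q k + ((1 - u) * t - u * s)"
          by (simp add: algebra_simps)
        ultimately show ?thesis unfolding True z_def by simp
      next
        case False
        then have "x i = q i" "y i = q i" using x y \<open>i \<ge> k\<close> by (auto simp: T_def)
        then show ?thesis by (simp add: z_def algebra_simps)
      qed
      from a[OF zS this] have "g q + l z \<le> g z" by (simp add: l_def)
      also have "g z \<le> (1 - u) * g x + u * g y"
        unfolding z_def by (rule convex_onD[OF g]) (use x y u(1,2) in \<open>auto simp: T_def\<close>)
      also have "l z = (1 - u) * l x + u * l y"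
        unfolding l_def z_def by (simp add: sum_distrib_left sum.distrib[symmetric] algebra_simps)
      finally have "0 \<le> (1 - u) * D x + u * D y" by (simp add: D_def algebra_simps)
      then have "0 \<le> (s + t) * ((1 - u) * D x + u * D y)" using s t by simp
      also have "\<dots> = ((s + t) * (1 - u)) * D x + ((s + t) * u) * D y" by (simp only: distrib_left mult.assoc)
      also have "(s + t) * (1 - u) = s" using s t by (simp add: u(3))
      also have "(s + t) * u = t" using s t by (simp add: u_def)
      also have "s * D x + t * D y = D x * s + D y * t" by (simp only: mult.commute)
      finally show ?thesis .
    qed
    define e where "e = (\<lambda>t::real. \<lambda>i. if i = k then t else 0)"
    have eT: "q + e t \<in> T" if "\<bar>t\<bar> \<le> r" for t
      using q[OF cube_translate_coord, of k t] that Suc.prems r by (auto simp: T_def e_def)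
    \<comment> \<open>A slope in the new coordinate must be at most every quotient coming from
      points above the hyperplane and at least every quotient from points below. By
      \<open>key\<close> the lower quotients never exceed the upper ones, so the infimum of the
      upper ones works.\<close>
    define Up where "Up = {D x / (x k - q k) | x. x \<in> T \<and> q k < x k}"
    define b where "b = Inf Up"
    have low: "- D y / (q k - y k) \<le> v" if "y \<in> T" "y k < q k" "v \<in> Up" for y v
    proof -
      from that obtain x where x: "x \<in> T" "q k < x k" "v = D x / (x k - q k)" by (auto simp: Up_def)
      have "0 \<le> D x * (q k - y k) + D y * (x k - q k)"
        using key[OF x(1) refl _ that(1) refl] x that by simp
      also have "D x = v * (x k - q k)" using x by simp
      finally have "0 \<le> (x k - q k) * (v * (q k - y k) + D y)" by (simp add: algebra_simps)
      then have "0 \<le> v * (q k - y k) + D y" using x(2) by (simp add: zero_le_mult_iff)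
      then have "- D y \<le> v * (q k - y k)" by linarith
      then show ?thesis using that(2) by (subst pos_divide_le_eq) auto
    qed
    \<comment> \<open>The cube around \<open>q\<close> supplies a point on each side of the
      hyperplane, so the infimum is over a nonempty set that is bounded below.\<close>
    have ne: "Up \<noteq> {}" unfolding Up_def using eT[of r] r
      by (auto intro!: exI[of _ "q + e r"] simp: e_def)
    have "q + e (- r) \<in> T" "(q + e (- r)) k < q k" using eT[of "- r"] r by (auto simp: e_def)
    from low[OF this] have bdd: "bdd_below Up" by (auto simp: bdd_below_def)
    have "g q + (\<Sum>i<Suc k. (a(k := b)) i * (x i - q i)) \<le> g x"
      if xS: "x \<in> S" and xq: "\<forall>i\<ge>Suc k. x i = q i" for x
    proof -
      have xT: "x \<in> T" using xS xq by (simp add: T_def)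
      have "b * (x k - q k) \<le> D x"
      proof (cases rule: linorder_cases[of "x k" "q k"])
        case less
        have "- D x / (q k - x k) \<le> b" unfolding b_def
          by (rule cInf_greatest[OF ne]) (use low xT less in auto)
        then show ?thesis using less by (simp add: field_simps)
      next
        case equal
        then have "x i = q i" if "i \<ge> k" for i using xq that by (cases "i = k") auto
        from a[OF xS this] show ?thesis using equal by (simp add: D_def l_def)
      next
        case greater
        have "b \<le> D x / (x k - q k)" unfolding b_def
          by (rule cInf_lower[OF _ bdd]) (use xT greater in \<open>auto simp: Up_def\<close>)
        then show ?thesis using greater by (simp add: field_simps)
      qed
      moreover have "(\<Sum>i<Suc k. (a(k := b)) i * (x i - q i)) = l x + b * (x k - q k)"
        by (simp add: l_def)
      ultimately show ?thesis by (simp add: D_def)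
    qed
    then show ?case by blast
  qed
  from this[OF order_refl] obtain a where
    a: "\<And>x. x \<in> S \<Longrightarrow> (\<forall>i\<ge>d. x i = q i) \<Longrightarrow> g q + (\<Sum>i<d. a i * (x i - q i)) \<le> g x" by blast
  have "g q + (\<Sum>i<d. a i * (x i - q i)) \<le> g x" if "x \<in> S" for x
  proof (rule a[OF that])
    have "x \<in> E d" "q \<in> E d" using that qS SE by auto
    then show "\<forall>i\<ge>d. x i = q i" by (simp add: E_def)
  qed
  then show thesis by (rule that)
qed

lemma integrable_bounded_lebE:
  assumes A: "A \<in> sets borel" "emeasure (lebE d) A < \<infinity>"
    and f: "f \<in> borel_measurable borel" "\<And>x. x \<in> A \<Longrightarrow> \<bar>f x\<bar> \<le> B"
  shows "integrable (lebE d) (\<lambda>x. indicator A x * f x :: real)"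
proof (rule integrableI_bounded_set[where A = A and B = B])
  show "(\<lambda>x. indicator A x * f x) \<in> borel_measurable (lebE d)"
    using A f by measurable
qed (use A f in auto)

text \<open>The change of variables as an identity of measures, which makes it available for signed
  integrands too.\<close>

lemma lebE_affine:
  assumes c: "c \<noteq> 0" and v: "v \<in> E d"
  shows "lebE d = density (distr (lebE d) borel (\<lambda>x. v + c *\<^sub>R x)) (\<lambda>_. ennreal (\<bar>c\<bar> ^ d))"
proof (rule measure_eqI)
  fix A assume "A \<in> sets (lebE d)"
  then have A [measurable]: "A \<in> sets borel" by simp
  have "emeasure (lebE d) A = (\<integral>\<^sup>+x. indicator A x \<partial>lebE d)" by simp
  also have "\<dots> = ennreal (\<bar>c\<bar> ^ d) * (\<integral>\<^sup>+x. indicator A (v + c *\<^sub>R x) \<partial>lebE d)"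
    by (rule nn_integral_lebE_affine[OF _ c v]) simp
  also have "(\<integral>\<^sup>+x. indicator A (v + c *\<^sub>R x) \<partial>lebE d) = (\<integral>\<^sup>+x. indicator A x \<partial>distr (lebE d) borel (\<lambda>x. v + c *\<^sub>R x))"
    by (rule nn_integral_distr[symmetric]) measurable
  also have "\<dots> = emeasure (distr (lebE d) borel (\<lambda>x. v + c *\<^sub>R x)) A" by simp
  also have "ennreal (\<bar>c\<bar> ^ d) * \<dots> = emeasure (density (distr (lebE d) borel (\<lambda>x. v + c *\<^sub>R x)) (\<lambda>_. ennreal (\<bar>c\<bar> ^ d))) A"
    by (subst emeasure_density_const) auto
  finally show "emeasure (lebE d) A = emeasure (density (distr (lebE d) borel (\<lambda>x. v + c *\<^sub>R x)) (\<lambda>_. ennreal (\<bar>c\<bar> ^ d))) A" .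
qed simp

lemma integral_lebE_affine:
  fixes f :: "(nat \<Rightarrow> real) \<Rightarrow> real"
  assumes [measurable]: "f \<in> borel_measurable borel" and c: "c \<noteq> 0" and v: "v \<in> E d"
  shows "(\<integral>x. f x \<partial>lebE d) = \<bar>c\<bar> ^ d * (\<integral>x. f (v + c *\<^sub>R x) \<partial>lebE d)"
  by (subst lebE_affine[OF c v]) (simp add: integral_real_density integral_distr)

definition bary :: "nat \<Rightarrow> (nat \<Rightarrow> real) set \<Rightarrow> nat \<Rightarrow> real" where
  "bary d A = (\<lambda>i. if i < d then (\<integral>x. indicator A x * x i \<partial>lebE d) / measure (lebE d) A else 0)"

lemma centroid_eq_bary:
  assumes "K \<subseteq> E d" "K \<in> sets borel"
  shows "centroid d K = bary d K"
proof
  fix i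
  note [measurable] = assms(2)
  have "set_lebesgue_integral (lebd d) ((\<lambda>x. restrict x {..<d}) ` K) (\<lambda>x. x i)
      = (\<integral>x. indicator K x * x i \<partial>lebE d)" if "i < d"
  proof -
    have "(\<integral>x. indicator K x * x i \<partial>lebE d) = (\<integral>x. indicator K (emb d x) * emb d x i \<partial>lebd d)"
      unfolding lebE_def by (intro integral_distr) measurable
    also have "\<dots> = (\<integral>x. indicator ((\<lambda>x. restrict x {..<d}) ` K) x *\<^sub>R x i \<partial>lebd d)"
      by (intro Bochner_Integration.integral_cong refl)
        (use that in \<open>auto simp: restrict_image_eq[OF assms(1)] indicator_def emb_def\<close>)
    finally show ?thesis by (simp add: set_lebesgue_integral_def)
  qed
  then show "centroid d K i = bary d K i"
    by (simp add: centroid_def bary_def vol_eq[OF assms])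
qed

text \<open>The distance to \<open>K\<close> is convex, vanishes on \<open>K\<close> and would be
  positive at a barycentre outside \<open>K\<close>. An affine function supporting it there is at
  most 0 on \<open>A\<close>; but its linear part integrates to 0 over \<open>A\<close>, so its
  integral is the positive value at the barycentre times the measure of \<open>A\<close>.\<close>

lemma bary_in_convex:
  assumes K: "compact K" "convex K" "K \<subseteq> E d"
    and A: "A \<in> sets borel" "A \<subseteq> K" "measure (lebE d) A > 0"
  shows "bary d A \<in> K"
proof (rule ccontr)
  assume notin: "bary d A \<notin> K"
  define c where "c = bary d A"
  have cE: "c \<in> E d" by (simp add: c_def bary_def E_def)
  have Kne: "K \<noteq> {}" using A by auto
  \<comment> \<open>Distance is measured in the l1 norm of the first \<open>d\<close> coordinates;
    compactness of \<open>K\<close> gives a nearest point \<open>P x\<close>, and combining nearest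
    points shows that the distance is convex.\<close>
  define N where "N = (\<lambda>x::nat \<Rightarrow> real. \<Sum>i<d. \<bar>x i\<bar>)"
  have "continuous_on K (\<lambda>k. N (x - k))" for x
    unfolding N_def by (auto intro!: continuous_intros continuous_on_subset[OF continuous_on_product_coordinates])
  then have "\<exists>k\<in>K. \<forall>l\<in>K. N (x - k) \<le> N (x - l)" for x
    using continuous_attains_inf[OF K(1) Kne] by blast
  then obtain P where P: "\<And>x. P x \<in> K" "\<And>x l. l \<in> K \<Longrightarrow> N (x - P x) \<le> N (x - l)" by metis
  define g where "g = (\<lambda>x. N (x - P x))"
  have Ntri: "N ((1 - u) *\<^sub>R x + u *\<^sub>R y) \<le> (1 - u) * N x + u * N y" if "0 \<le> u" "u \<le> 1" for u x y
  proof -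
    have "\<bar>(1 - u) * x i + u * y i\<bar> \<le> (1 - u) * \<bar>x i\<bar> + u * \<bar>y i\<bar>" for i
      using that abs_triangle_ineq[of "(1 - u) * x i" "u * y i"] by (simp add: abs_mult)
    then have "N ((1 - u) *\<^sub>R x + u *\<^sub>R y) \<le> (\<Sum>i<d. (1 - u) * \<bar>x i\<bar> + u * \<bar>y i\<bar>)"
      unfolding N_def by (intro sum_mono) simp
    also have "\<dots> = (1 - u) * N x + u * N y" by (simp add: N_def sum.distrib sum_distrib_left)
    finally show ?thesis .
  qed
  have "convex (E d)" by (auto simp: convex_alt E_def)
  have "convex_on (E d) g"
  proof (rule convex_onI)
    fix t :: real and x y assume t: "0 < t" "t < 1"
    let ?k = "(1 - t) *\<^sub>R P x + t *\<^sub>R P y"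
    have "?k \<in> K" using K(2) P(1) t unfolding convex_alt by auto
    then have "g ((1 - t) *\<^sub>R x + t *\<^sub>R y) \<le> N ((1 - t) *\<^sub>R x + t *\<^sub>R y - ?k)"
      unfolding g_def by (rule P(2))
    also have "(1 - t) *\<^sub>R x + t *\<^sub>R y - ?k = (1 - t) *\<^sub>R (x - P x) + t *\<^sub>R (y - P y)"
      by (simp add: algebra_simps)
    also have "N \<dots> \<le> (1 - t) * g x + t * g y" unfolding g_def using t by (intro Ntri) auto
    finally show "g ((1 - t) *\<^sub>R x + t *\<^sub>R y) \<le> (1 - t) * g x + t * g y" .
  qed fact
  then obtain a where a: "\<And>x. x \<in> E d \<Longrightarrow> g c + (\<Sum>i<d. a i * (x i - c i)) \<le> g x"
    by (rule supporting_functional[where r = 1 and q = c]) (use cE in \<open>auto simp: cube_def intro: E_add\<close>)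
  have g0: "g x = 0" if "x \<in> K" for x
  proof -
    have "g x \<le> 0" unfolding g_def using P(2)[OF that, of x] by (simp add: N_def)
    moreover have "0 \<le> g x" unfolding g_def N_def by (simp add: sum_nonneg)
    ultimately show ?thesis by simp
  qed
  have "g c > 0"
  proof -
    have "c \<noteq> P c" using notin P(1)[of c] by (auto simp: c_def)
    then obtain j where j: "c j \<noteq> P c j" by blast
    have "P c \<in> E d" using P(1) K(3) by auto
    then have "j < d" using j cE by (auto simp: E_def not_le[symmetric])
    then have "\<bar>(c - P c) j\<bar> \<le> g c" unfolding g_def N_def by (intro member_le_sum) auto
    then show ?thesis using j by simp
  qed
  obtain R where R: "R > 0" "K \<subseteq> cube d R" using compact_bounded_cube K by blast
  have "emeasure (lebE d) A \<le> emeasure (lebE d) K" by (rule emeasure_mono) (use A compact_borel K in auto)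
  then have fin: "emeasure (lebE d) A < \<infinity>" using emeasure_compact_finite[OF K(1,3)] by (rule le_less_trans)
  let ?m = "measure (lebE d) A"
  have int1: "integrable (lebE d) (indicator A :: _ \<Rightarrow> real)"
    using fin A(1) by (simp add: integrable_indicator_iff)
  have inti: "integrable (lebE d) (\<lambda>x. indicator A x * x i :: real)" if "i < d" for i
    by (rule integrable_bounded_lebE[where B = R]) (use A R fin that in \<open>auto simp: cube_def subset_eq\<close>)
  have "(\<integral>x. indicator A x * (g c + (\<Sum>i<d. a i * (x i - c i))) \<partial>lebE d) \<le> (\<integral>x. 0 \<partial>lebE d)"
  proof (rule integral_mono)
    show "indicator A x * (g c + (\<Sum>i<d. a i * (x i - c i))) \<le> 0" for x
    proof (cases "x \<in> A")
      case True
      then have "x \<in> K" "x \<in> E d" using A K by auto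
      from a[OF this(2)] g0[OF this(1)] True show ?thesis by simp
    qed simp
    have "integrable (lebE d) (\<lambda>x. g c * indicator A x + (\<Sum>i<d. a i * (indicator A x * x i) - a i * c i * indicator A x) :: real)"
      using int1 inti by (intro Bochner_Integration.integrable_add Bochner_Integration.integrable_sum
        Bochner_Integration.integrable_diff integrable_mult_right) auto
    then show "integrable (lebE d) (\<lambda>x. indicator A x * (g c + (\<Sum>i<d. a i * (x i - c i))))"
      by (simp add: algebra_simps sum_distrib_left)
  qed simp
  also have "(\<integral>x. indicator A x * (g c + (\<Sum>i<d. a i * (x i - c i))) \<partial>lebE d)
     = (\<integral>x. g c * indicator A x + (\<Sum>i<d. a i * (indicator A x * x i) - a i * c i * indicator A x) \<partial>lebE d)"
    by (simp add: algebra_simps sum_distrib_left)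
  also have "\<dots> = g c * ?m + (\<Sum>i<d. a i * (\<integral>x. indicator A x * x i \<partial>lebE d) - a i * c i * ?m)"
    using int1 inti A(1)
    by (subst Bochner_Integration.integral_add Bochner_Integration.integral_sum)+
       (auto simp: Bochner_Integration.integral_diff intro!: sum.cong)
  \<comment> \<open>By the definition of the barycentre every term of the sum is 0.\<close>
  also have "\<dots> = g c * ?m"
    using A(3) by (simp add: c_def bary_def)
  finally show False using \<open>g c > 0\<close> A(3) by (simp add: mult_le_0_iff)
qed

section \<open>Covariograms and the Rogers--Shephard inequality\<close>

lemma convex_combination_mem:
  "convex K \<Longrightarrow> x \<in> K \<Longrightarrow> y \<in> K \<Longrightarrow> 0 \<le> u \<Longrightarrow> u \<le> 1 \<Longrightarrow> (1 - u) *\<^sub>R x + u *\<^sub>R y \<in> K"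
  by (rule convexD_alt)

lemma emeasure_lebE_compact:
  "compact S \<Longrightarrow> S \<subseteq> E d \<Longrightarrow> emeasure (lebE d) S = ennreal (measure (lebE d) S)"
  using emeasure_compact_finite[of S d] by (intro emeasure_eq_ennreal_measure) auto

lemma measure_compact_mono:
  assumes "compact S" "compact T" "S \<subseteq> T" "T \<subseteq> E d"
  shows "measure (lebE d) S \<le> measure (lebE d) T"
  using emeasure_lebE_compact[OF assms(2,4)] assms compact_borel
  by (intro measure_mono_fmeasurable) (auto simp: fmeasurable_def)

lemma compact_cube: "compact (cube d r)"
proof -
  have "cube d r = Pi\<^sub>E UNIV (\<lambda>i. if i < d then {- r..r} else {0})"
    by (auto simp: cube_def E_def PiE_def Pi_def abs_le_iff minus_le_iff not_less split: if_splits)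
  moreover have "compactin (product_topology (\<lambda>_. euclidean) UNIV) (Pi\<^sub>E UNIV (\<lambda>i. if i < d then {- r..r} else {0 :: real}))"
    unfolding compactin_PiE by auto
  ultimately show ?thesis by (simp add: euclidean_product_topology)
qed

lemma measure_pos_of_cube:
  assumes K: "compact K" "K \<subseteq> E d" and q: "q \<in> E d" and r: "r > 0" "\<And>y. y \<in> cube d r \<Longrightarrow> q + y \<in> K"
  shows "measure (lebE d) K > 0"
proof -
  have "0 < (2 * r) ^ d" using r by simp
  also have "\<dots> = measure (lebE d) (cube d r)"
    using emeasure_cube[of r d] r by (simp add: measure_def)
  also have "\<dots> = measure (lebE d) ((\<lambda>x. q + 1 *\<^sub>R x) ` cube d r)"
    by (subst measure_affine_image[OF compact_cube _ q]) auto
  also have "\<dots> \<le> measure (lebE d) K"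
    by (rule measure_compact_mono[OF compact_affine[OF compact_cube] K(1)]) (use r K in auto)
  finally show ?thesis .
qed

lemma measurable_add_scaleR [measurable]:
  "(\<lambda>(x, y). x + c *\<^sub>R y :: nat \<Rightarrow> real) \<in> measurable (borel \<Otimes>\<^sub>M borel) borel"
proof (rule measurable_coordinatewise_then_product)
  fix i
  have "(\<lambda>p. fst p i + c * snd p i) \<in> borel_measurable (borel \<Otimes>\<^sub>M (borel :: (nat \<Rightarrow> real) measure))"
    using measurable_compose[OF measurable_fst measurable_coord] measurable_compose[OF measurable_snd measurable_coord]
    by (intro borel_measurable_add borel_measurable_times) auto
  then show "(\<lambda>p. (case p of (x, y) \<Rightarrow> x + c *\<^sub>R y) i) \<in> borel_measurable (borel \<Otimes>\<^sub>M (borel :: (nat \<Rightarrow> real) measure))"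
    by (simp add: case_prod_beta)
qed

text \<open>For s = 1 this is K \<inter> (K - x), whose volume is the covariogram of K; for s = -1
  it is K \<inter> (x - K), whose volume is the convolution of the indicator of K with
  itself.\<close>

definition overlap :: "(nat \<Rightarrow> real) set \<Rightarrow> real \<Rightarrow> (nat \<Rightarrow> real) \<Rightarrow> (nat \<Rightarrow> real) set" where
  "overlap K s x = {y \<in> K. x + s *\<^sub>R y \<in> K}"

lemma overlap_measurable:
  fixes K :: "(nat \<Rightarrow> real) set"
  assumes [measurable]: "K \<in> sets borel"
  shows "{(x, y). y \<in> K \<and> x + s *\<^sub>R y \<in> K} \<in> sets (borel \<Otimes>\<^sub>M borel)"
proof -
  let ?B = "(borel :: (nat \<Rightarrow> real) measure) \<Otimes>\<^sub>M (borel :: (nat \<Rightarrow> real) measure)"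
  have "(\<lambda>(x, y). x + s *\<^sub>R y) -` K \<inter> space ?B \<in> sets ?B"
    by (rule measurable_sets[OF measurable_add_scaleR]) fact
  moreover have "snd -` K \<inter> space ?B \<in> sets ?B"
    by (rule measurable_sets[OF measurable_snd]) fact
  ultimately have "((\<lambda>(x, y). x + s *\<^sub>R y) -` K \<inter> space ?B) \<inter> (snd -` K \<inter> space ?B) \<in> sets ?B"
    by (rule sets.Int)
  also have "((\<lambda>(x, y). x + s *\<^sub>R y) -` K \<inter> space ?B) \<inter> (snd -` K \<inter> space ?B)
      = {(x, y). y \<in> K \<and> x + s *\<^sub>R y \<in> K}"
    by (auto simp: space_pair_measure)
  finally show ?thesis .
qed

lemma compact_overlap:
  assumes "compact K" and s: "s \<noteq> 0"
  shows "compact (overlap K s x)"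
proof -
  have "overlap K s x = K \<inter> (\<lambda>z. (- (1 / s)) *\<^sub>R x + (1 / s) *\<^sub>R z) ` K"
  proof (intro set_eqI iffI)
    fix y assume y: "y \<in> overlap K s x"
    have "y = (- (1 / s)) *\<^sub>R x + (1 / s) *\<^sub>R (x + s *\<^sub>R y)" using s by (simp add: algebra_simps)
    then show "y \<in> K \<inter> (\<lambda>z. (- (1 / s)) *\<^sub>R x + (1 / s) *\<^sub>R z) ` K"
      using y by (auto simp: overlap_def)
  next
    fix y assume "y \<in> K \<inter> (\<lambda>z. (- (1 / s)) *\<^sub>R x + (1 / s) *\<^sub>R z) ` K"
    then obtain z where z: "y \<in> K" "z \<in> K" "y = (- (1 / s)) *\<^sub>R x + (1 / s) *\<^sub>R z" by blast
    have "x + s *\<^sub>R y = z" using s unfolding z(3) by (simp add: algebra_simps)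
    then show "y \<in> overlap K s x" using z by (simp add: overlap_def)
  qed
  also have "compact \<dots>"
    by (intro compact_Int_closed assms compact_imp_closed compact_affine)
  finally show ?thesis .
qed

lemma overlap_subset: "overlap K s x \<subseteq> K" by (auto simp: overlap_def)

lemma borel_measurable_overlap:
  assumes "K \<in> sets borel"
  shows "(\<lambda>x. emeasure (lebE d) (overlap K s x)) \<in> borel_measurable borel"
proof -
  interpret sigma_finite_measure "lebE d" by (rule sigma_finite_lebE)
  have "{(x, y). y \<in> K \<and> x + s *\<^sub>R y \<in> K} \<in> sets (borel \<Otimes>\<^sub>M lebE d)"
    using overlap_measurable[OF assms] by (simp cong: sets_pair_measure_cong)
  from measurable_emeasure_Pair[OF this] show ?thesis
    by (simp add: overlap_def vimage_def)
qed

text \<open>Fubini, followed by the substitution z = x + s y for fixed y. The constant weight gives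
  the total mass of the overlap volume, a coordinate weight its first moments.\<close>

lemma nn_integral_overlap:
  fixes h :: "(nat \<Rightarrow> real) \<Rightarrow> ennreal"
  assumes [measurable]: "K \<in> sets borel" "h \<in> borel_measurable borel" and KE: "K \<subseteq> E d"
  shows "(\<integral>\<^sup>+x. h x * emeasure (lebE d) (overlap K s x) \<partial>lebE d)
       = (\<integral>\<^sup>+y. \<integral>\<^sup>+z. indicator K y * (h (z - s *\<^sub>R y) * indicator K z) \<partial>lebE d \<partial>lebE d)"
proof -
  interpret P: pair_sigma_finite "lebE d" "lebE d"
    by (simp add: pair_sigma_finite_def sigma_finite_lebE)
  note om = overlap_measurable[OF assms(1), of s]
  have ob: "overlap K s x \<in> sets borel" for x
  proof -
    have "Pair x -` {(x, y). y \<in> K \<and> x + s *\<^sub>R y \<in> K} \<in> sets borel"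
      by (rule sets_Pair1[OF om])
    then show ?thesis by (simp add: overlap_def vimage_def)
  qed
  have "(\<integral>\<^sup>+x. h x * emeasure (lebE d) (overlap K s x) \<partial>lebE d)
      = (\<integral>\<^sup>+x. \<integral>\<^sup>+y. h x * indicator {(x, y). y \<in> K \<and> x + s *\<^sub>R y \<in> K} (x, y) \<partial>lebE d \<partial>lebE d)"
  proof (rule nn_integral_cong)
    fix x
    have "(\<integral>\<^sup>+y. h x * indicator {(x, y). y \<in> K \<and> x + s *\<^sub>R y \<in> K} (x, y) \<partial>lebE d)
        = (\<integral>\<^sup>+y. h x * indicator (overlap K s x) y \<partial>lebE d)"
      by (intro nn_integral_cong) (simp add: overlap_def indicator_def)
    also have "\<dots> = h x * emeasure (lebE d) (overlap K s x)"
      using ob by (simp add: nn_integral_cmult_indicator)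
    finally show "h x * emeasure (lebE d) (overlap K s x)
      = (\<integral>\<^sup>+y. h x * indicator {(x, y). y \<in> K \<and> x + s *\<^sub>R y \<in> K} (x, y) \<partial>lebE d)" by simp
  qed
  also have "\<dots> = (\<integral>\<^sup>+y. \<integral>\<^sup>+x. h x * indicator {(x, y). y \<in> K \<and> x + s *\<^sub>R y \<in> K} (x, y) \<partial>lebE d \<partial>lebE d)"
  proof (rule P.Fubini'[symmetric])
    have "(\<lambda>p. h (fst p) * indicator {(x, y). y \<in> K \<and> x + s *\<^sub>R y \<in> K} p) \<in> borel_measurable (borel \<Otimes>\<^sub>M borel)"
      using measurable_compose[OF measurable_fst assms(2)] om
      by (intro borel_measurable_times_ennreal borel_measurable_indicator) auto
    then show "(\<lambda>(x, y). h x * indicator {(x, y). y \<in> K \<and> x + s *\<^sub>R y \<in> K} (x, y)) \<in> borel_measurable (lebE d \<Otimes>\<^sub>M lebE d)"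
      by (simp add: case_prod_beta cong: measurable_cong_sets sets_pair_measure_cong)
  qed
  also have "\<dots> = (\<integral>\<^sup>+y. \<integral>\<^sup>+z. indicator K y * (h (z - s *\<^sub>R y) * indicator K z) \<partial>lebE d \<partial>lebE d)"
  proof (rule nn_integral_cong)
    fix y
    show "(\<integral>\<^sup>+x. h x * indicator {(x, y). y \<in> K \<and> x + s *\<^sub>R y \<in> K} (x, y) \<partial>lebE d)
       = (\<integral>\<^sup>+z. indicator K y * (h (z - s *\<^sub>R y) * indicator K z) \<partial>lebE d)"
    proof (cases "y \<in> K")
      case True
      have m: "(\<lambda>z. indicator K y * (h (z - s *\<^sub>R y) * indicator K z)) \<in> borel_measurable borel"
      proof -
        have "(\<lambda>z. h ((- (s *\<^sub>R y)) + 1 *\<^sub>R z)) \<in> borel_measurable borel"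
          by (rule measurable_compose[OF measurable_affine assms(2)])
        then show ?thesis by simp
      qed
      have "(\<integral>\<^sup>+z. indicator K y * (h (z - s *\<^sub>R y) * indicator K z) \<partial>lebE d)
         = ennreal (\<bar>1\<bar> ^ d) * (\<integral>\<^sup>+x. indicator K y * (h ((s *\<^sub>R y + 1 *\<^sub>R x) - s *\<^sub>R y) * indicator K (s *\<^sub>R y + 1 *\<^sub>R x)) \<partial>lebE d)"
        by (rule nn_integral_lebE_affine[OF m]) (use True KE in \<open>auto intro: E_scaleR\<close>)
      also have "\<dots> = (\<integral>\<^sup>+x. h x * indicator {(x, y). y \<in> K \<and> x + s *\<^sub>R y \<in> K} (x, y) \<partial>lebE d)"
        using True by (auto simp: indicator_def add.commute intro!: nn_integral_cong)
      finally show ?thesis by simp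
    qed simp
  qed
  finally show ?thesis .
qed

lemma nn_integral_overlap_total:
  assumes K: "compact K" "K \<subseteq> E d"
  shows "(\<integral>\<^sup>+x. emeasure (lebE d) (overlap K s x) \<partial>lebE d) = ennreal ((measure (lebE d) K)\<^sup>2)"
proof -
  have [measurable]: "K \<in> sets borel" using compact_borel[OF K(1)] .
  have "(\<integral>\<^sup>+x. emeasure (lebE d) (overlap K s x) \<partial>lebE d)
     = (\<integral>\<^sup>+y. \<integral>\<^sup>+z. indicator K y * indicator K z \<partial>lebE d \<partial>lebE d)"
    using nn_integral_overlap[of K "\<lambda>_. 1" d s] K by simp
  also have "\<dots> = (\<integral>\<^sup>+y. emeasure (lebE d) K * indicator K y \<partial>lebE d)"
    by (simp add: nn_integral_cmult mult.commute)
  also have "\<dots> = emeasure (lebE d) K * emeasure (lebE d) K"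
    by (rule nn_integral_cmult_indicator) simp
  also have "\<dots> = ennreal ((measure (lebE d) K)\<^sup>2)"
    by (simp add: emeasure_lebE_compact[OF K] power2_eq_square ennreal_mult)
  finally show ?thesis .
qed

text \<open>The integral is d times Beta(d, d+1), that is d (d-1)! d! / (2d)!. This is where the
  central binomial coefficient of the difference body comes from.\<close>

lemma nn_integral_beta:
  assumes d: "d > 0"
  shows "(\<integral>\<^sup>+s. indicator {0<..<1} s * ennreal (real d * s ^ (d - 1) * (1 - s) ^ d) \<partial>lborel)
       = ennreal (1 / real ((2 * d) choose d))"
proof -
  have B: "Beta (real d) (real (Suc d)) = 1 / (real d * real ((2 * d) choose d))"
  proof -
    obtain n where n: "d = Suc n" using d by (cases d) auto
    have "Beta (real d) (real (Suc d)) = fact n * fact d / fact (2 * d)"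
      unfolding Beta_def n
      using Gamma_fact[of n, where 'a = real] Gamma_fact[of "Suc n", where 'a = real] Gamma_fact[of "2 * Suc n", where 'a = real]
      by (simp add: add_ac)
    moreover have "real ((2 * d) choose d) = fact (2 * d) / (fact d * fact d)"
      by (subst binomial_fact) auto
    moreover have "fact d = real d * fact n" by (simp add: n)
    then have "fact n * fact d / F = 1 / (real d * (F / (fact d * fact d)))" if "F > 0" for F :: real
      using that d by (simp add: field_simps)
    ultimately show ?thesis by (simp only: fact_gt_zero)
  qed
  have "((\<lambda>t. t powr (real d - 1) * (1 - t) powr (real (Suc d) - 1)) has_integral Beta (real d) (real (Suc d))) {0..1}"
    using d by (intro has_integral_Beta_real) auto
  then have "((\<lambda>t. t powr (real d - 1) * (1 - t) powr (real (Suc d) - 1)) has_integral Beta (real d) (real (Suc d))) {0<..<1}"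
    by (simp add: has_integral_Icc_iff_Ioo)
  then have "((\<lambda>t. t ^ (d - 1) * (1 - t) ^ d) has_integral Beta (real d) (real (Suc d))) {0<..<1}"
  proof (rule has_integral_eq[rotated])
    fix t :: real assume "t \<in> {0<..<1}"
    then have "t powr real (d - 1) = t ^ (d - 1)" "(1 - t) powr real d = (1 - t) ^ d"
      by (simp_all only: powr_realpow greaterThanLessThan_iff diff_gt_0_iff_gt)
    moreover have "real d - 1 = real (d - 1)" "real (Suc d) - 1 = real d" using d by (simp_all add: of_nat_diff)
    ultimately show "t powr (real d - 1) * (1 - t) powr (real (Suc d) - 1) = t ^ (d - 1) * (1 - t) ^ d"
      by (simp only:)
  qed
  then have "((\<lambda>t. real d * (t ^ (d - 1) * (1 - t) ^ d)) has_integral real d * Beta (real d) (real (Suc d))) {0<..<1}"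
    by (rule has_integral_mult_right)
  moreover have "real d * Beta (real d) (real (Suc d)) = 1 / real ((2 * d) choose d)"
    unfolding B using d by simp
  ultimately have hi: "((\<lambda>t. real d * (t ^ (d - 1) * (1 - t) ^ d)) has_integral 1 / real ((2 * d) choose d)) {0<..<1}" by (simp only:)
  have "(\<integral>\<^sup>+s. ennreal (real d * (s ^ (d - 1) * (1 - s) ^ d)) * indicator {0<..<1} s \<partial>lborel)
      = ennreal (1 / real ((2 * d) choose d))"
    by (rule nn_integral_has_integral_lebesgue'[OF _ hi]) auto
  then show ?thesis by (simp only: mult.assoc mult.commute[of "indicator _ _"])
qed

text \<open>If x lies in (1-s)(K - K), then by convexity K \<inter> (K - x) contains a translate of
  s K, so the covariogram is at least s^d vol(K) there. Its total mass is vol(K)^2, and integrating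
  the lower bound gives vol(K) vol(K - K) divided by the binomial coefficient. In place of the gauge
  of K - K, the levels s are integrated with density d s^(d-1).\<close>

theorem rogers_shephard:
  assumes K: "compact K" "K \<subseteq> E d" "convex K" and V: "measure (lebE d) K > 0" and d: "d > 0"
  shows "measure (lebE d) ((\<lambda>(x, y). x - y) ` (K \<times> K)) \<le> real ((2 * d) choose d) * measure (lebE d) K"
proof -
  let ?V = "measure (lebE d) K"
  define D where "D = (\<lambda>(x, y). x - y) ` (K \<times> K)"
  have Dc: "compact D" unfolding D_def by (rule compact_diff_image) (use K in auto)
  have DE: "D \<subseteq> E d" using K(2) by (auto simp: D_def intro: E_diff)
  have [measurable]: "D \<in> sets borel" "K \<in> sets borel" using Dc K compact_borel by auto
  define T where "T = {(s::real, x). (1 / (1 - s)) *\<^sub>R x \<in> D}"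
  have "(\<lambda>p. (1 / (1 - fst p)) *\<^sub>R snd p) \<in> measurable ((borel :: real measure) \<Otimes>\<^sub>M (borel :: (nat \<Rightarrow> real) measure)) borel"
  proof (rule measurable_coordinatewise_then_product)
    fix i
    show "(\<lambda>p. ((1 / (1 - fst p)) *\<^sub>R snd p) i) \<in> borel_measurable ((borel :: real measure) \<Otimes>\<^sub>M (borel :: (nat \<Rightarrow> real) measure))"
    proof -
      have "(\<lambda>p. snd p i) \<in> borel_measurable ((borel :: real measure) \<Otimes>\<^sub>M (borel :: (nat \<Rightarrow> real) measure))"
        by (rule measurable_compose[OF measurable_snd measurable_coord])
      then show ?thesis by simp
    qed
  qed
  from measurable_sets[OF this, of D] have T: "T \<in> sets (borel \<Otimes>\<^sub>M borel)"
    by (simp add: T_def vimage_def space_pair_measure case_prod_beta')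
  let ?w = "\<lambda>s. indicator {0<..<1} s * ennreal (real d * s ^ (d - 1))"
  have lower: "s ^ d * ?V \<le> measure (lebE d) (overlap K 1 x)" if s: "0 < s" "s < 1" and x: "(1 / (1 - s)) *\<^sub>R x \<in> D" for s x
  proof -
    obtain a b where ab: "a \<in> K" "b \<in> K" "(1 / (1 - s)) *\<^sub>R x = b - a" using x by (auto simp: D_def)
    have "x = (1 - s) *\<^sub>R ((1 / (1 - s)) *\<^sub>R x)" using s by simp
    then have xe: "x = (1 - s) *\<^sub>R (b - a)" unfolding ab(3) .
    \<comment> \<open>The copy of K shrunk by \<open>s\<close> and placed at (1-s) a; adding
      \<open>x\<close> moves it to the copy placed at (1-s) b, which also lies in K.\<close>
    have sub: "(\<lambda>k. (1 - s) *\<^sub>R a + s *\<^sub>R k) ` K \<subseteq> overlap K 1 x"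
    proof (rule image_subsetI)
      fix k assume k: "k \<in> K"
      have e: "x + 1 *\<^sub>R ((1 - s) *\<^sub>R a + s *\<^sub>R k) = (1 - s) *\<^sub>R b + s *\<^sub>R k"
        unfolding xe by (simp add: algebra_simps)
      show "(1 - s) *\<^sub>R a + s *\<^sub>R k \<in> overlap K 1 x"
        using convex_combination_mem[OF K(3) ab(1) k, of s] convex_combination_mem[OF K(3) ab(2) k, of s] s
        unfolding overlap_def mem_Collect_eq e by simp
    qed
    have aE: "(1 - s) *\<^sub>R a \<in> E d" using ab K by (auto intro: E_scaleR)
    have "s ^ d * ?V = measure (lebE d) ((\<lambda>k. (1 - s) *\<^sub>R a + s *\<^sub>R k) ` K)"
      using measure_affine_image[OF K(1) _ aE, of s] s by simp
    also have "\<dots> \<le> measure (lebE d) (overlap K 1 x)"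
      using sub overlap_subset[of K 1 x] K by (intro measure_compact_mono compact_affine compact_overlap) auto
    finally show ?thesis .
  qed
  have pt: "ennreal ?V * (\<integral>\<^sup>+s. ?w s * indicator T (s, x) \<partial>lborel) \<le> emeasure (lebE d) (overlap K 1 x)" for x
  proof -
    define m where "m = measure (lebE d) (overlap K 1 x)"
    \<comment> \<open>The largest level that \<open>lower\<close> permits at \<open>x\<close>; the
      density d s^(d-1) has integral \<open>\<rho> ^ d\<close> up to this level, which is the
      overlap volume divided by the volume of K.\<close>
    define \<rho> where "\<rho> = root d (m / ?V)"
    have m0: "0 \<le> m / ?V" using V by (simp add: m_def)
    have \<rho>: "0 \<le> \<rho>" "\<rho> ^ d = m / ?V" using d m0 by (auto simp: \<rho>_def)
    have "(\<integral>\<^sup>+s. ?w s * indicator T (s, x) \<partial>lborel) \<le> (\<integral>\<^sup>+s. ennreal (real d * s ^ (d - 1)) * indicator {0..\<rho>} s \<partial>lborel)"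
    proof (rule nn_integral_mono)
      fix s
      show "?w s * indicator T (s, x) \<le> ennreal (real d * s ^ (d - 1)) * indicator {0..\<rho>} s"
      proof (cases "s \<in> {0<..<1} \<and> (s, x) \<in> T")
        case True
        then have "s ^ d * ?V \<le> m" unfolding m_def by (intro lower) (auto simp: T_def)
        then have "s ^ d \<le> \<rho> ^ d" unfolding \<rho>(2) using V by (simp add: pos_le_divide_eq)
        then have "s \<le> \<rho>" using \<rho> d by (rule_tac power_le_imp_le_base[of s "d - 1"]) auto
        then show ?thesis using True by (simp add: indicator_def)
      qed (auto simp: indicator_def)
    qed
    also have "\<dots> = ennreal (\<rho> ^ d - 0 ^ d)"
      by (rule nn_integral_FTC_Icc) (use d \<rho> in \<open>auto intro!: derivative_eq_intros\<close>)
    also have "\<dots> = ennreal (m / ?V)" unfolding \<rho>(2) using d by (simp add: zero_power)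
    finally have "ennreal ?V * (\<integral>\<^sup>+s. ?w s * indicator T (s, x) \<partial>lborel) \<le> ennreal ?V * ennreal (m / ?V)"
      by (rule mult_left_mono) simp
    also have "\<dots> = ennreal m" using V m0 by (simp flip: ennreal_mult)
    also have "\<dots> = emeasure (lebE d) (overlap K 1 x)" unfolding m_def
      using overlap_subset[of K 1 x] K by (intro emeasure_lebE_compact[symmetric] compact_overlap) auto
    finally show ?thesis .
  qed
  interpret P: pair_sigma_finite "lebE d" "lborel :: real measure"
    by (simp add: pair_sigma_finite_def sigma_finite_lebE lborel.sigma_finite_measure_axioms)
  have WT: "(\<lambda>(x, s). ?w s * indicator T (s, x)) \<in> borel_measurable (lebE d \<Otimes>\<^sub>M lborel)"
  proof -
    have T': "(\<lambda>p. indicator T (snd p, fst p) :: ennreal) \<in> borel_measurable ((borel :: (nat \<Rightarrow> real) measure) \<Otimes>\<^sub>M borel)"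
      by (rule measurable_compose[OF _ borel_measurable_indicator[OF T]]) measurable
    have "(\<lambda>p. ?w (snd p)) \<in> borel_measurable ((borel :: (nat \<Rightarrow> real) measure) \<Otimes>\<^sub>M borel)"
      by measurable
    from borel_measurable_times_ennreal[OF this T'] show ?thesis
      by (simp add: case_prod_beta cong: measurable_cong_sets sets_pair_measure_cong)
  qed
  have Dmeas: "emeasure (lebE d) {x. (1 / (1 - s)) *\<^sub>R x \<in> D} = ennreal ((1 - s) ^ d) * emeasure (lebE d) D" if "s < 1" for s
  proof -
    have "{x. (1 / (1 - s)) *\<^sub>R x \<in> D} = (\<lambda>x. 0 + (1 - s) *\<^sub>R x) ` D"
    proof (intro set_eqI iffI)
      fix x assume "x \<in> {x. (1 / (1 - s)) *\<^sub>R x \<in> D}"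
      then show "x \<in> (\<lambda>x. 0 + (1 - s) *\<^sub>R x) ` D" using that
        by (intro image_eqI[of _ _ "(1 / (1 - s)) *\<^sub>R x"]) auto
    qed (use that in auto)
    also have "emeasure (lebE d) \<dots> = ennreal (\<bar>1 - s\<bar> ^ d) * emeasure (lebE d) D"
      using that by (intro emeasure_affine_image compact_borel[OF compact_affine[OF Dc]] E_zero) auto
    finally show ?thesis using that by simp
  qed
  \<comment> \<open>The double integral taken in the other order: for fixed s the points x fill the
    dilate (1-s) D, of volume (1-s)^d vol(D), which produces the beta integral.\<close>
  have "ennreal ?V * (emeasure (lebE d) D * ennreal (1 / real ((2 * d) choose d)))
     = ennreal ?V * (emeasure (lebE d) D * (\<integral>\<^sup>+s. indicator {0<..<1} s * ennreal (real d * s ^ (d - 1) * (1 - s) ^ d) \<partial>lborel))"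
    by (simp only: nn_integral_beta[OF d])
  also have "\<dots> = ennreal ?V * (\<integral>\<^sup>+s. emeasure (lebE d) D * (indicator {0<..<1} s * ennreal (real d * s ^ (d - 1) * (1 - s) ^ d)) \<partial>lborel)"
    by (subst nn_integral_cmult) auto
  also have "\<dots> = ennreal ?V * (\<integral>\<^sup>+s. \<integral>\<^sup>+x. ?w s * indicator T (s, x) \<partial>lebE d \<partial>lborel)"
  proof (intro arg_cong2[where f = "(*)"] refl nn_integral_cong)
    fix s :: real
    have Ts: "{x. (1 / (1 - s)) *\<^sub>R x \<in> D} \<in> sets borel"
      using sets_Pair1[OF T, of s] by (simp add: T_def vimage_def)
    have "(\<integral>\<^sup>+x. ?w s * indicator T (s, x) \<partial>lebE d) = (\<integral>\<^sup>+x. ?w s * indicator {x. (1 / (1 - s)) *\<^sub>R x \<in> D} x \<partial>lebE d)"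
      by (intro nn_integral_cong) (simp add: T_def indicator_def)
    also have "\<dots> = ?w s * emeasure (lebE d) {x. (1 / (1 - s)) *\<^sub>R x \<in> D}"
      using Ts by (intro nn_integral_cmult_indicator) simp
    also have "\<dots> = emeasure (lebE d) D * (indicator {0<..<1} s * ennreal (real d * s ^ (d - 1) * (1 - s) ^ d))"
      by (cases "s \<in> {0<..<1}") (auto simp: Dmeas ennreal_mult mult_ac)
    finally show "emeasure (lebE d) D * (indicator {0<..<1} s * ennreal (real d * s ^ (d - 1) * (1 - s) ^ d))
      = (\<integral>\<^sup>+x. ?w s * indicator T (s, x) \<partial>lebE d)" by simp
  qed
  also have "(\<integral>\<^sup>+s. \<integral>\<^sup>+x. ?w s * indicator T (s, x) \<partial>lebE d \<partial>lborel) = (\<integral>\<^sup>+x. \<integral>\<^sup>+s. ?w s * indicator T (s, x) \<partial>lborel \<partial>lebE d)"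
    by (rule P.Fubini'[OF WT])
  also have "ennreal ?V * \<dots> = (\<integral>\<^sup>+x. ennreal ?V * (\<integral>\<^sup>+s. ?w s * indicator T (s, x) \<partial>lborel) \<partial>lebE d)"
    using lborel.borel_measurable_nn_integral[OF WT] by (intro nn_integral_cmult[symmetric]) simp
  also have "\<dots> \<le> (\<integral>\<^sup>+x. emeasure (lebE d) (overlap K 1 x) \<partial>lebE d)"
    by (rule nn_integral_mono) (rule pt)
  also have "\<dots> = ennreal (?V\<^sup>2)" by (rule nn_integral_overlap_total[OF K(1,2)])
  finally have fin: "ennreal ?V * (ennreal (measure (lebE d) D) * ennreal (1 / real ((2 * d) choose d))) \<le> ennreal (?V\<^sup>2)"
    by (simp only: emeasure_lebE_compact[OF Dc DE])
  have "ennreal x * (ennreal y * ennreal z) = ennreal (x * (y * z))" if "0 \<le> x" "0 \<le> y" "0 \<le> z" for x y z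
    using that by (simp add: ennreal_mult)
  from fin[unfolded this[OF measure_nonneg measure_nonneg zero_le_divide_1_iff[THEN iffD2, OF of_nat_0_le_iff]]]
  have "?V * (measure (lebE d) D * (1 / real ((2 * d) choose d))) \<le> ?V\<^sup>2"
    by (subst (asm) ennreal_le_iff) auto
  moreover have "real ((2 * d) choose d) > 0" by simp
  ultimately have "measure (lebE d) D \<le> real ((2 * d) choose d) * ?V"
    using V by (simp add: power2_eq_square field_simps)
  then show ?thesis by (simp add: D_def)
qed

section \<open>The centroid\<close>

text \<open>For x at most 1/2, ln(1-x) >= -x - 2x^2 >= -2x, so the power is at least exp(-2), and e
  <= 3. This is the source of the 9 both in the packing bound and in the estimate of theta at the
  centroid.\<close>

lemma one_ninth_le_power:
  assumes "2 \<le> d"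
  shows "1 / 9 \<le> (1 - 1 / real d) ^ d"
proof -
  define x where "x = 1 / real d"
  have x: "0 < x" "x \<le> 1 / 2" using assms by (auto simp: x_def field_simps)
  have "- x - 2 * x\<^sup>2 \<le> ln (1 - x)"
    by (rule ln_one_minus_pos_lower_bound) (use x in auto)
  moreover have "x\<^sup>2 \<le> x / 2" using x by (simp add: power2_eq_square)
  ultimately have "- 2 * x \<le> ln (1 - x)" by linarith
  then have "real d * (- 2 * x) \<le> real d * ln (1 - x)" by (rule mult_left_mono) simp
  also have "real d * (- 2 * x) = - 2" using assms by (simp add: x_def)
  also have "real d * ln (1 - x) = ln ((1 - x) ^ d)" using x by (simp add: ln_realpow)
  finally have "exp (- 2) \<le> exp (ln ((1 - x) ^ d))" by simp
  also have "exp (ln ((1 - x) ^ d)) = (1 - x) ^ d" using x by (intro exp_ln) auto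
  finally have e: "exp (- 2) \<le> (1 - x) ^ d" .
  have "exp (2::real) = (exp 1)\<^sup>2" by (simp flip: exp_double)
  also have "\<dots> \<le> 3\<^sup>2" by (intro power_mono exp_le) simp
  finally have "1 / 9 \<le> exp (- 2 :: real)" by (simp add: exp_minus field_simps)
  with e show ?thesis unfolding x_def by linarith
qed

lemma integrable_coord_compact:
  assumes "compact K" "K \<subseteq> E d" "A \<in> sets borel" "A \<subseteq> K" "i < d"
  shows "integrable (lebE d) (\<lambda>x. indicator A x * x i :: real)"
proof -
  obtain R where R: "R > 0" "K \<subseteq> cube d R" using compact_bounded_cube assms(1,2) by blast
  have "emeasure (lebE d) A \<le> emeasure (lebE d) K" by (rule emeasure_mono) (use assms compact_borel in auto)
  then have "emeasure (lebE d) A < \<infinity>" using emeasure_compact_finite[OF assms(1,2)] by (rule le_less_trans)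
  then show ?thesis
    by (intro integrable_bounded_lebE[where B = R]) (use assms R in \<open>auto simp: cube_def subset_eq\<close>)
qed

lemma integral_coord_affine_image:
  assumes K: "compact K" "K \<subseteq> E d" and c: "c > 0" and v: "v \<in> E d" and i: "i < d"
  shows "(\<integral>x. indicator ((\<lambda>x. v + c *\<^sub>R x) ` K) x * x i \<partial>lebE d)
       = c ^ d * (v i * measure (lebE d) K + c * (\<integral>x. indicator K x * x i \<partial>lebE d))"
proof -
  let ?T = "\<lambda>x. v + c *\<^sub>R x"
  have [measurable]: "?T ` K \<in> sets borel" "K \<in> sets borel" using K compact_affine compact_borel by auto
  have inj: "inj ?T" using c by (auto simp: inj_def)
  have int1: "integrable (lebE d) (indicator K :: _ \<Rightarrow> real)"
    using emeasure_compact_finite[OF K] by (simp add: integrable_indicator_iff)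
  have "(\<integral>x. indicator (?T ` K) x * x i \<partial>lebE d)
      = \<bar>c\<bar> ^ d * (\<integral>x. indicator (?T ` K) (?T x) * (?T x) i \<partial>lebE d)"
    by (rule integral_lebE_affine) (use c v in auto)
  also have "(\<integral>x. indicator (?T ` K) (?T x) * (?T x) i \<partial>lebE d)
      = (\<integral>x. v i * indicator K x + c * (indicator K x * x i) \<partial>lebE d)"
    by (intro Bochner_Integration.integral_cong refl)
       (auto simp: indicator_def inj_image_mem_iff[OF inj])
  also have "\<dots> = v i * measure (lebE d) K + c * (\<integral>x. indicator K x * x i \<partial>lebE d)"
    using int1 integrable_coord_compact[OF K, of K i] i
    by (subst Bochner_Integration.integral_add) auto
  finally show ?thesis using c by (simp only: abs_of_pos)
qed

text \<open>The barycenter of the shell \<open>K - (x + s (K - x))\<close> lies on the line through \<open>x\<close> and the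
  centroid of \<open>K\<close>, beyond the centroid.\<close>

lemma reflect_through_centroid:
  assumes K: "compact K" "K \<subseteq> E d" "convex K" and V: "measure (lebE d) K > 0" and d: "2 \<le> d" and x: "x \<in> K"
  shows "bary d K - (1 / (9 * real d)) *\<^sub>R (x - bary d K) \<in> K"
proof -
  define c where "c = bary d K"
  \<comment> \<open>This ratio balances two demands: s^d stays above 1/9, while the homothety moves
    the centroid towards \<open>x\<close> by the fraction 1 - s = 1/d. Together they give a reach of
    at least 1/(9d).\<close>
  define s where "s = 1 - 1 / real d"
  let ?V = "measure (lebE d) K"
  have s: "0 < s" "s < 1" using d by (auto simp: s_def field_simps)
  have sd: "1 / 9 \<le> s ^ d" unfolding s_def by (rule one_ninth_le_power[OF d])
  have sd1: "s ^ d < 1" using s d by (simp add: power_less_one_iff)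
  define v where "v = (1 - s) *\<^sub>R x"
  have vE: "v \<in> E d" unfolding v_def using x K by (auto intro: E_scaleR)
  define H where "H = (\<lambda>y. v + s *\<^sub>R y) ` K"
  have HK: "H \<subseteq> K" unfolding H_def v_def using convex_combination_mem[OF K(3) x] s by auto
  have Hc: "compact H" unfolding H_def by (rule compact_affine[OF K(1)])
  have [measurable]: "H \<in> sets borel" "K \<in> sets borel" using Hc K compact_borel by auto
  have mH: "measure (lebE d) H = s ^ d * ?V"
    unfolding H_def using measure_affine_image[OF K(1) _ vE, of s] s by simp
  define A where "A = K - H"
  have Ab: "A \<in> sets borel" "A \<subseteq> K" by (auto simp: A_def)
  have mA: "measure (lebE d) A = (1 - s ^ d) * ?V"
  proof -
    have "measure (lebE d) A = ?V - measure (lebE d) H"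
      unfolding A_def using emeasure_compact_finite[OF K(1,2)] HK by (intro measure_Diff) auto
    then show ?thesis by (simp add: mH algebra_simps)
  qed
  have mA0: "measure (lebE d) A > 0" unfolding mA using V sd1 by simp
  have intA: "(\<integral>y. indicator A y * y i \<partial>lebE d) = ?V * c i - s ^ d * (v i * ?V + s * (?V * c i))" if i: "i < d" for i
  proof -
    have "(\<integral>y. indicator A y * y i \<partial>lebE d) = (\<integral>y. indicator K y * y i - indicator H y * y i \<partial>lebE d)"
      by (intro Bochner_Integration.integral_cong refl) (use HK in \<open>auto simp: A_def indicator_def\<close>)
    also have "\<dots> = (\<integral>y. indicator K y * y i \<partial>lebE d) - (\<integral>y. indicator H y * y i \<partial>lebE d)"
      using integrable_coord_compact[OF K(1,2) _ _ i] HK by (intro Bochner_Integration.integral_diff) auto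
    also have "(\<integral>y. indicator H y * y i \<partial>lebE d) = s ^ d * (v i * ?V + s * (\<integral>y. indicator K y * y i \<partial>lebE d))"
      unfolding H_def by (rule integral_coord_affine_image[OF K(1,2) s(1) vE i])
    also have "(\<integral>y. indicator K y * y i \<partial>lebE d) = ?V * c i"
      using V i by (simp add: c_def bary_def)
    finally show ?thesis .
  qed
  \<comment> \<open>The centroid c of K is the mean of the centroid c + (1-s)(x - c) of
    \<open>H\<close>, with weight s^d, and that of the shell, with weight 1 - s^d. Solving for the
    latter gives c - t (x - c).\<close>
  define t where "t = s ^ d * (1 - s) / (1 - s ^ d)"
  have "bary d A i = (c - t *\<^sub>R (x - c)) i" for i
  proof (cases "i < d")
    case True
    have "bary d A i = (?V * c i - s ^ d * (v i * ?V + s * (?V * c i))) / ((1 - s ^ d) * ?V)"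
      using True by (simp add: bary_def intA mA)
    also have "\<dots> = (c i - s ^ d * ((1 - s) * x i + s * c i)) / (1 - s ^ d)"
    proof -
      have "?V * c i - s ^ d * (v i * ?V + s * (?V * c i)) = (c i - s ^ d * ((1 - s) * x i + s * c i)) * ?V"
        by (simp add: v_def algebra_simps)
      then show ?thesis using V by simp
    qed
    also have "\<dots> = c i - t * (x i - c i)"
    proof -
      have "c i - s ^ d * ((1 - s) * x i + s * c i) = c i * (1 - s ^ d) - s ^ d * (1 - s) * (x i - c i)"
        by (simp add: algebra_simps)
      then show ?thesis using sd1 by (simp add: t_def diff_divide_distrib)
    qed
    finally show ?thesis by simp
  next
    case False
    then have "x i = 0" using x K by (auto simp: E_def)
    then show ?thesis using False by (simp add: bary_def c_def)
  qed
  then have bA: "bary d A = c - t *\<^sub>R (x - c)" by (rule ext)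
  have aK: "c - t *\<^sub>R (x - c) \<in> K" unfolding bA[symmetric] by (rule bary_in_convex[OF K(1,3,2) Ab mA0])
  have cK: "c \<in> K" unfolding c_def by (rule bary_in_convex[OF K(1,3,2) _ order_refl V]) simp
  have "1 / (9 * real d) \<le> s ^ d * (1 - s)" using sd d by (simp add: s_def field_simps)
  also have "\<dots> \<le> t" unfolding t_def using s sd1 sd
    by (simp add: pos_le_divide_eq mult_left_le)
  finally have t: "1 / (9 * real d) \<le> t" .
  moreover have "0 < 1 / (9 * real d)" using d by simp
  ultimately have t0: "t > 0" by linarith
  \<comment> \<open>Convexity shortens the reach from \<open>t\<close> to exactly 1/(9d), moving
    from \<open>c\<close> towards the barycentre of the shell.\<close>
  define w where "w = 1 / (9 * real d) / t"
  have w: "0 \<le> w" "w * t = 1 / (9 * real d)" using t t0 by (simp_all add: w_def)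
  have w1: "w \<le> 1" unfolding w_def using t t0 by (subst pos_divide_le_eq) auto
  have "(1 - w) *\<^sub>R c + w *\<^sub>R (c - t *\<^sub>R (x - c)) \<in> K"
    by (rule convex_combination_mem[OF K(3) cK aK w(1) w1])
  also have "(1 - w) *\<^sub>R c + w *\<^sub>R (c - t *\<^sub>R (x - c)) = c - (w * t) *\<^sub>R (x - c)"
    by (simp add: scaleR_diff_left scaleR_diff_right)
  also have "\<dots> = c - (1 / (9 * real d)) *\<^sub>R (x - c)" by (simp only: w(2))
  finally show ?thesis unfolding c_def .
qed

text \<open>The centroid lies strictly between an interior point \<open>q\<close> and a point k = c
  - t (q - c) of K on the far side. Contracting the cube around \<open>q\<close> towards k yields a
  cube around the centroid that lies in K.\<close>

lemma bary_interior:
  assumes K: "compact K" "K \<subseteq> E d" "convex K" and d: "2 \<le> d"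
    and q: "q \<in> E d" and r: "r > 0" "\<And>y. y \<in> cube d r \<Longrightarrow> q + y \<in> K"
  obtains r' where "r' > 0" "\<And>y. y \<in> cube d r' \<Longrightarrow> bary d K + y \<in> K"
proof -
  have V: "measure (lebE d) K > 0" by (rule measure_pos_of_cube[OF K(1,2) q r])
  have "0 \<in> cube d r" using r by (simp add: cube_def E_zero)
  then have qK: "q \<in> K" using r(2)[of 0] by simp
  define c where "c = bary d K"
  define t where "t = 1 / (9 * real d)"
  have t: "t > 0" using d by (simp add: t_def)
  have kK: "c - t *\<^sub>R (q - c) \<in> K" unfolding c_def t_def by (rule reflect_through_centroid[OF K V d qK])
  \<comment> \<open>The solution of (1-u) k + u q = c for k = c - t (q - c).\<close>
  define u where "u = t / (1 + t)"
  have u: "0 < u" "u \<le> 1" using t by (auto simp: u_def)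
  have u1: "1 - u = 1 / (1 + t)" "(1 - u) * t = u" using t by (auto simp: u_def field_simps)
  have "c + y \<in> K" if y: "y \<in> cube d (u * r)" for y
  proof -
    have "(1 / u) *\<^sub>R y \<in> cube d r"
      using y u by (auto simp: cube_def E_scaleR abs_mult field_simps)
    then have "q + (1 / u) *\<^sub>R y \<in> K" by (rule r)
    then have "(1 - u) *\<^sub>R (c - t *\<^sub>R (q - c)) + u *\<^sub>R (q + (1 / u) *\<^sub>R y) \<in> K"
      using u by (intro convex_combination_mem[OF K(3) kK]) auto
    also have "(1 - u) *\<^sub>R (c - t *\<^sub>R (q - c)) + u *\<^sub>R (q + (1 / u) *\<^sub>R y)
       = (1 - u) *\<^sub>R c - ((1 - u) * t) *\<^sub>R (q - c) + u *\<^sub>R q + y"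
      using u by (simp add: algebra_simps)
    also have "\<dots> = c + y" unfolding u1(2) by (simp add: algebra_simps)
    finally show ?thesis .
  qed
  then show thesis using that[of "u * r"] u r by (simp add: c_def)
qed

text \<open>The self-convolution of the uniform density on \<open>K\<close> is log-concave with barycenter \<open>2c\<close>, so it
  lies below \<open>\<phi>(2c) exp(a \<bullet> (x - 2c))\<close>; the bound then comes from integrating
  \<open>t ln t \<ge> t - 1\<close> at \<open>t = \<phi>(x) / m\<close> over \<open>2K\<close>, which carries total mass \<open>m vol(2K)\<close>.\<close>

theorem milman_pajor:
  assumes K: "compact K" "K \<subseteq> E d" "convex K"
    and r: "r > 0" "\<And>y. y \<in> cube d r \<Longrightarrow> bary d K + y \<in> K"
  shows "measure (lebE d) K \<le> 2 ^ d * measure (lebE d) (overlap K (- 1) (2 *\<^sub>R bary d K))"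
proof -
  define c where "c = bary d K"
  define V where "V = measure (lebE d) K"
  define \<phi> where "\<phi> = (\<lambda>x. measure (lebE d) (overlap K (- 1) x))"
  have cE: "c \<in> E d" by (simp add: c_def bary_def E_def)
  have V: "V > 0" unfolding V_def by (rule measure_pos_of_cube[OF K(1,2) cE r(1)]) (use r in \<open>simp add: c_def\<close>)
  have [measurable]: "K \<in> sets borel" using compact_borel K by auto
  have ovc: "compact (overlap K (- 1) x)" for x by (rule compact_overlap[OF K(1)]) simp
  have ovE: "overlap K (- 1) x \<subseteq> E d" for x using overlap_subset[of K "- 1" x] K by blast
  have e\<phi>: "emeasure (lebE d) (overlap K (- 1) x) = ennreal (\<phi> x)" for x
    unfolding \<phi>_def by (rule emeasure_lebE_compact[OF ovc ovE])
  have \<phi>0: "0 \<le> \<phi> x" for x by (simp add: \<phi>_def)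
  have \<phi>V: "\<phi> x \<le> V" for x
    unfolding \<phi>_def V_def by (rule measure_compact_mono[OF ovc K(1) overlap_subset K(2)])
  have \<phi>m [measurable]: "\<phi> \<in> borel_measurable borel"
    unfolding \<phi>_def measure_def by (intro borel_measurable_enn2real borel_measurable_overlap) simp
  define D where "D = (\<lambda>x. 0 + 2 *\<^sub>R x) ` K"
  have Dc: "compact D" unfolding D_def by (rule compact_affine[OF K(1)])
  have DE: "D \<subseteq> E d" using K by (auto simp: D_def intro: E_scaleR)
  have [measurable]: "D \<in> sets borel" using compact_borel Dc by auto
  have mD: "measure (lebE d) D = 2 ^ d * V"
    unfolding D_def V_def using measure_affine_image[OF K(1) _ E_zero, of 2] by simp
  have \<phi>out: "\<phi> x = 0" if "x \<notin> D" for x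
  proof -
    have "overlap K (- 1) x = {}"
    proof (rule ccontr)
      assume "overlap K (- 1) x \<noteq> {}"
      then obtain y where y: "y \<in> K" "x + (- 1) *\<^sub>R y \<in> K" by (auto simp: overlap_def)
      have "(1 - 1 / 2) *\<^sub>R y + (1 / 2) *\<^sub>R (x + (- 1) *\<^sub>R y) \<in> K"
        by (rule convex_combination_mem[OF K(3) y]) auto
      also have "(1 - 1 / 2) *\<^sub>R y + (1 / 2) *\<^sub>R (x + (- 1) *\<^sub>R y) = (1 / 2) *\<^sub>R x"
        by (simp add: scaleR_diff_right)
      finally have "0 + 2 *\<^sub>R ((1 / 2) *\<^sub>R x) \<in> D" unfolding D_def by (rule imageI)
      then show False using that by simp
    qed
    then show ?thesis by (simp add: \<phi>_def)
  qed
  have finD: "emeasure (lebE d) D < \<infinity>" by (rule emeasure_compact_finite[OF Dc DE])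
  obtain R where R: "R > 0" "K \<subseteq> cube d R" using compact_bounded_cube K by blast
  have KR: "\<bar>x i\<bar> \<le> R" if "x \<in> K" "i < d" for x i using R that by (auto simp: cube_def)
  have DR: "\<bar>x i\<bar> \<le> 2 * R" if "x \<in> D" "i < d" for x i using KR that by (auto simp: D_def abs_mult)
  have \<phi>D: "indicator D x * \<phi> x = \<phi> x" for x using \<phi>out by (cases "x \<in> D") auto
  have int\<phi>: "integrable (lebE d) \<phi>"
  proof -
    have "integrable (lebE d) (\<lambda>x. indicator D x * \<phi> x)"
      by (rule integrable_bounded_lebE[where B = V]) (use finD \<phi>0 \<phi>V in auto)
    then show ?thesis by (simp add: \<phi>D)
  qed
  have int\<phi>i: "integrable (lebE d) (\<lambda>x. \<phi> x * x i)" if i: "i < d" for i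
  proof -
    have "integrable (lebE d) (\<lambda>x. indicator D x * (\<phi> x * x i))"
    proof (rule integrable_bounded_lebE[where B = "V * (2 * R)"])
      show "\<bar>\<phi> x * x i\<bar> \<le> V * (2 * R)" if "x \<in> D" for x
        unfolding abs_mult using \<phi>0 \<phi>V DR[OF that i] V by (intro mult_mono) auto
    qed (use finD in auto)
    then show ?thesis by (simp add: mult.assoc[symmetric] \<phi>D)
  qed
  have intK: "integrable (lebE d) (indicator K :: _ \<Rightarrow> real)"
    using emeasure_compact_finite[OF K(1,2)] by (simp add: integrable_indicator_iff)
  have I\<phi>: "(\<integral>x. \<phi> x \<partial>lebE d) = V\<^sup>2"
  proof -
    have "ennreal (\<integral>x. \<phi> x \<partial>lebE d) = (\<integral>\<^sup>+x. ennreal (\<phi> x) \<partial>lebE d)"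
      using int\<phi> \<phi>0 by (intro nn_integral_eq_integral[symmetric]) auto
    also have "\<dots> = ennreal (V\<^sup>2)"
      using nn_integral_overlap_total[OF K(1,2), of "- 1"] by (simp add: e\<phi> V_def)
    finally show ?thesis by (subst (asm) ennreal_inj) (auto simp: \<phi>0 integral_nonneg_AE)
  qed
  have I\<phi>i: "(\<integral>x. \<phi> x * x i \<partial>lebE d) = 2 * V\<^sup>2 * c i" if i: "i < d" for i
  proof -
    \<comment> \<open>Fubini for the overlap is available for nonnegative weights, so coordinates
      are shifted: by \<open>R\<close> on K and by \<open>2 * R\<close> on 2K. \<open>J\<close> is
      the shifted first moment of K.\<close>
    define J where "J = V * (c i + R)"
    have intKi: "integrable (lebE d) (\<lambda>x. indicator K x * x i :: real)"
      by (rule integrable_bounded_lebE[where B = R]) (use KR i emeasure_compact_finite[OF K(1,2)] in auto)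
    have "(\<integral>x. indicator K x * (x i + R) \<partial>lebE d) = (\<integral>x. indicator K x * x i + R * indicator K x \<partial>lebE d)"
      by (intro Bochner_Integration.integral_cong) (auto simp: algebra_simps)
    also have "\<dots> = (\<integral>x. indicator K x * x i \<partial>lebE d) + R * V"
      using intKi intK by (subst Bochner_Integration.integral_add) (auto simp: V_def)
    also have "(\<integral>x. indicator K x * x i \<partial>lebE d) = V * c i"
      using V i by (simp add: c_def bary_def V_def)
    finally have J: "(\<integral>x. indicator K x * (x i + R) \<partial>lebE d) = J" by (simp add: J_def algebra_simps)
    have intJ: "integrable (lebE d) (\<lambda>x. indicator K x * (x i + R) :: real)"
      by (rule integrable_bounded_lebE[where B = "2 * R"]) 
         (use KR i emeasure_compact_finite[OF K(1,2)] in \<open>auto simp: abs_le_iff, fastforce+\<close>)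
    have Kpos: "0 \<le> x i + R" if "x \<in> K" for x using KR[OF that i] by auto
    have J0: "0 \<le> J" unfolding J[symmetric] using Kpos by (intro integral_nonneg_AE) (auto simp: indicator_def)
    let ?p = "\<lambda>z. ennreal (indicator K z * (z i + R))"
    have nJ: "(\<integral>\<^sup>+z. ?p z \<partial>lebE d) = ennreal J"
      unfolding J[symmetric] using intJ Kpos by (intro nn_integral_eq_integral) (auto simp: indicator_def)
    have pm [measurable]: "?p \<in> borel_measurable borel" by measurable
    have Dpos: "0 \<le> \<phi> x * (x i + 2 * R)" for x
      using DR[of x i] i \<phi>0[of x] \<phi>out[of x] by (cases "x \<in> D") auto
    have "ennreal (\<integral>x. \<phi> x * (x i + 2 * R) \<partial>lebE d) = (\<integral>\<^sup>+x. ennreal (\<phi> x * (x i + 2 * R)) \<partial>lebE d)"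
      using int\<phi>i[OF i] int\<phi> Dpos by (intro nn_integral_eq_integral[symmetric]) (auto simp: distrib_left)
    also have "\<dots> = (\<integral>\<^sup>+x. ennreal (x i + 2 * R) * emeasure (lebE d) (overlap K (- 1) x) \<partial>lebE d)"
    proof (rule nn_integral_cong)
      fix x
      show "ennreal (\<phi> x * (x i + 2 * R)) = ennreal (x i + 2 * R) * emeasure (lebE d) (overlap K (- 1) x)"
      proof (cases "x \<in> D")
        case True
        then have "0 \<le> x i + 2 * R" using DR[OF True i] by auto
        then show ?thesis by (simp add: e\<phi> \<phi>0 ennreal_mult' mult.commute)
      qed (simp add: e\<phi> \<phi>out)
    qed
    also have "\<dots> = (\<integral>\<^sup>+y. \<integral>\<^sup>+z. indicator K y * (ennreal ((z - (- 1) *\<^sub>R y) i + 2 * R) * indicator K z) \<partial>lebE d \<partial>lebE d)"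
      by (rule nn_integral_overlap) (use K in auto)
    also have "\<dots> = (\<integral>\<^sup>+y. \<integral>\<^sup>+z. indicator K y * ?p z + ?p y * indicator K z \<partial>lebE d \<partial>lebE d)"
    proof (intro nn_integral_cong)
      fix y z
      show "indicator K y * (ennreal ((z - (- 1) *\<^sub>R y) i + 2 * R) * indicator K z) = indicator K y * ?p z + ?p y * indicator K z"
      proof (cases "y \<in> K \<and> z \<in> K")
        case True
        have e: "(z - (- 1) *\<^sub>R y) i + 2 * R = (z i + R) + (y i + R)" by simp
        have "ennreal ((z i + R) + (y i + R)) = ennreal (z i + R) + ennreal (y i + R)"
          using Kpos True by (intro ennreal_plus) auto
        then show ?thesis unfolding e using True by (simp only: indicator_simps mult_1 mult_1_right)
      qed (auto simp: indicator_def)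
    qed
    also have "\<dots> = (\<integral>\<^sup>+y. indicator K y * ennreal J + ?p y * ennreal V \<partial>lebE d)"
    proof (rule nn_integral_cong)
      fix y
      have "(\<integral>\<^sup>+z. indicator K y * ?p z + ?p y * indicator K z \<partial>lebE d)
         = (\<integral>\<^sup>+z. indicator K y * ?p z \<partial>lebE d) + (\<integral>\<^sup>+z. ?p y * indicator K z \<partial>lebE d)"
        by (rule nn_integral_add) auto
      also have "(\<integral>\<^sup>+z. indicator K y * ?p z \<partial>lebE d) = indicator K y * ennreal J"
        by (subst nn_integral_cmult) (auto simp: nJ)
      also have "(\<integral>\<^sup>+z. ?p y * indicator K z \<partial>lebE d) = ?p y * ennreal V"
        using emeasure_lebE_compact[OF K(1,2)] by (subst nn_integral_cmult_indicator) (auto simp: V_def)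
      finally show "(\<integral>\<^sup>+z. indicator K y * ?p z + ?p y * indicator K z \<partial>lebE d) = indicator K y * ennreal J + ?p y * ennreal V" .
    qed
    also have "\<dots> = (\<integral>\<^sup>+y. indicator K y * ennreal J \<partial>lebE d) + (\<integral>\<^sup>+y. ?p y * ennreal V \<partial>lebE d)"
      by (rule nn_integral_add) auto
    also have "(\<integral>\<^sup>+y. indicator K y * ennreal J \<partial>lebE d) = ennreal V * ennreal J"
      using emeasure_lebE_compact[OF K(1,2)] by (simp add: nn_integral_multc V_def)
    also have "(\<integral>\<^sup>+y. ?p y * ennreal V \<partial>lebE d) = ennreal J * ennreal V"
      by (simp add: nn_integral_multc nJ)
    also have "ennreal V * ennreal J + ennreal J * ennreal V = ennreal (2 * V * J)"
      using V J0 by (simp add: ennreal_mult'[symmetric] ennreal_plus[symmetric] mult_ac del: ennreal_plus)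
    finally have "(\<integral>x. \<phi> x * (x i + 2 * R) \<partial>lebE d) = 2 * V * J"
      using V J0 Dpos by (subst (asm) ennreal_inj) (auto intro!: integral_nonneg_AE)
    moreover have "(\<integral>x. \<phi> x * (x i + 2 * R) \<partial>lebE d) = (\<integral>x. \<phi> x * x i \<partial>lebE d) + V\<^sup>2 * (2 * R)"
      using int\<phi>i[OF i] int\<phi> by (simp add: distrib_left Bochner_Integration.integral_add I\<phi>)
    ultimately show ?thesis by (simp add: J_def power2_eq_square algebra_simps)
  qed
  define S where "S = {x \<in> E d. \<phi> x > 0}"
  \<comment> \<open>Log-concavity of the self-convolution: convex combinations of points from the
    overlaps at \<open>x\<close> and \<open>y\<close> lie in the overlap at the combined position,
    so Brunn--Minkowski applies.\<close>
  have bm: "\<phi> x powr (1 - t) * \<phi> y powr t \<le> \<phi> ((1 - t) *\<^sub>R x + t *\<^sub>R y)" if t: "0 < t" "t < 1" for x y t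
    unfolding \<phi>_def
  proof (rule brunn_minkowski[OF ovc ovE ovc ovE ovc ovE t])
    fix a b assume a: "a \<in> overlap K (- 1) x" and b: "b \<in> overlap K (- 1) y"
    have e: "(1 - t) *\<^sub>R x + t *\<^sub>R y + (- 1) *\<^sub>R ((1 - t) *\<^sub>R a + t *\<^sub>R b)
       = (1 - t) *\<^sub>R (x + (- 1) *\<^sub>R a) + t *\<^sub>R (y + (- 1) *\<^sub>R b)"
      by (simp add: algebra_simps)
    show "(1 - t) *\<^sub>R a + t *\<^sub>R b \<in> overlap K (- 1) ((1 - t) *\<^sub>R x + t *\<^sub>R y)"
      unfolding overlap_def mem_Collect_eq e
      using a b t by (intro conjI convex_combination_mem[OF K(3)]) (auto simp: overlap_def)
  qed
  have Sconv: "(1 - t) *\<^sub>R x + t *\<^sub>R y \<in> S" if "x \<in> S" "y \<in> S" "0 < t" "t < 1" for x y t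
  proof -
    have "0 < \<phi> x powr (1 - t) * \<phi> y powr t" using that by (simp add: S_def)
    with bm[OF that(3,4), of x y] have "0 < \<phi> ((1 - t) *\<^sub>R x + t *\<^sub>R y)" by linarith
    moreover have "(1 - t) *\<^sub>R x + t *\<^sub>R y \<in> E d" using that by (intro E_add E_scaleR) (auto simp: S_def)
    ultimately show ?thesis by (simp add: S_def)
  qed
  have "convex S"
    unfolding convex_alt
  proof (intro ballI allI impI)
    fix x y and t :: real assume "x \<in> S" "y \<in> S" "0 \<le> t \<and> t \<le> 1"
    then show "(1 - t) *\<^sub>R x + t *\<^sub>R y \<in> S"
      using Sconv[of x y t] by (cases "t = 0 \<or> t = 1") auto
  qed
  have cvx: "convex_on S (\<lambda>x. - ln (\<phi> x))"
  proof (rule convex_onI)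
    fix t :: real and x y assume t: "0 < t" "t < 1" and x: "x \<in> S" and y: "y \<in> S"
    have p: "\<phi> x > 0" "\<phi> y > 0" using x y by (auto simp: S_def)
    have "(1 - t) * ln (\<phi> x) + t * ln (\<phi> y) = ln (\<phi> x powr (1 - t) * \<phi> y powr t)"
      using p by (simp add: ln_mult ln_powr)
    also have "\<dots> \<le> ln (\<phi> ((1 - t) *\<^sub>R x + t *\<^sub>R y))"
      using bm[OF t, of x y] p by (intro ln_mono) auto
    finally show "- ln (\<phi> ((1 - t) *\<^sub>R x + t *\<^sub>R y)) \<le> (1 - t) * - ln (\<phi> x) + t * - ln (\<phi> y)" by simp
  qed fact
  \<comment> \<open>A cube around 2c lies in the support: for y and z of sup norm at most r/2, both
    c + y and c + (z - y) lie in K. The supporting functional at 2c needs this room.\<close>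
  have near: "2 *\<^sub>R c + z \<in> S" if z: "z \<in> cube d (r / 2)" for z
  proof -
    have sub: "(\<lambda>y. c + 1 *\<^sub>R y) ` cube d (r / 2) \<subseteq> overlap K (- 1) (2 *\<^sub>R c + z)"
    proof (rule image_subsetI)
      fix y assume y: "y \<in> cube d (r / 2)"
      have "y \<in> cube d r" using y r(1) by (force simp: cube_def)
      moreover have "z - y \<in> cube d r"
      proof -
        have "\<bar>z i - y i\<bar> \<le> r" if "i < d" for i
        proof -
          have "\<bar>z i\<bar> \<le> r / 2" "\<bar>y i\<bar> \<le> r / 2" using y z that by (auto simp: cube_def)
          then show ?thesis by linarith
        qed
        then show ?thesis using y z by (auto simp: cube_def intro: E_diff)
      qed
      moreover have "2 *\<^sub>R c + z + (- 1) *\<^sub>R (c + 1 *\<^sub>R y) = c + (z - y)" by (simp add: scaleR_2)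
      ultimately show "c + 1 *\<^sub>R y \<in> overlap K (- 1) (2 *\<^sub>R c + z)"
        unfolding overlap_def using r(2) by (simp add: c_def)
    qed
    have "0 < \<phi> (2 *\<^sub>R c + z)"
      unfolding \<phi>_def by (rule measure_pos_of_cube[OF ovc ovE cE, of "r / 2"]) (use sub r in auto)
    moreover have "2 *\<^sub>R c + z \<in> E d" using z cE by (intro E_add E_scaleR) (auto simp: cube_def)
    ultimately show ?thesis by (simp add: S_def)
  qed
  have SE: "S \<subseteq> E d" by (auto simp: S_def)
  have half: "r / 2 > 0" using r(1) by simp
  obtain a where a: "\<And>x. x \<in> S \<Longrightarrow> - ln (\<phi> (2 *\<^sub>R c)) + (\<Sum>i<d. a i * (x i - (2 *\<^sub>R c) i)) \<le> - ln (\<phi> x)"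
    by (rule supporting_functional[OF cvx SE half near]) (assumption, rule that)
  have "2 *\<^sub>R c + 0 \<in> S" by (rule near) (use r(1) in \<open>simp add: cube_def E_zero\<close>)
  then have \<phi>c: "\<phi> (2 *\<^sub>R c) > 0" by (simp add: S_def)
  \<comment> \<open>The average of \<open>\<phi>\<close> over 2K: total mass V^2 divided by the
    volume 2^d V. The theorem says that the value at 2c is at least this average.\<close>
  define m where "m = V / 2 ^ d"
  have m: "m > 0" using V by (simp add: m_def)
  define L where "L = ln (\<phi> (2 *\<^sub>R c)) - ln m"
  have pt: "\<phi> x - m * indicator D x \<le> \<phi> x * (L - (\<Sum>i<d. a i * (x i - 2 * c i)))" if "x \<in> E d" for x
  proof (cases "\<phi> x > 0")
    case True
    have "- ln (\<phi> x / m) \<le> m / \<phi> x - 1"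
      using ln_le_minus_one[of "m / \<phi> x"] True m by (simp add: ln_div)
    then have "1 - m / \<phi> x \<le> ln (\<phi> x / m)" by linarith
    also have "\<dots> = ln (\<phi> x) - ln m" using True m by (simp add: ln_div)
    also have "\<dots> \<le> L - (\<Sum>i<d. a i * (x i - 2 * c i))"
      using a[of x] True that by (simp add: S_def L_def)
    finally have "\<phi> x * (1 - m / \<phi> x) \<le> \<phi> x * (L - (\<Sum>i<d. a i * (x i - 2 * c i)))"
      by (rule mult_left_mono) (rule \<phi>0)
    moreover have "\<phi> x * (1 - m / \<phi> x) = \<phi> x - m" using True by (simp add: right_diff_distrib)
    moreover have "x \<in> D" using \<phi>out[of x] True by fastforce
    ultimately show ?thesis by simp
  next
    case False
    then have "\<phi> x = 0" using \<phi>0[of x] by simp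
    then show ?thesis using m by simp
  qed
  have intD: "integrable (lebE d) (indicator D :: _ \<Rightarrow> real)"
    using finD by (simp add: integrable_indicator_iff)
  let ?F = "\<lambda>x. L * \<phi> x - (\<Sum>i<d. a i * (\<phi> x * x i) - a i * (2 * c i) * \<phi> x)"
  have F: "\<phi> x * (L - (\<Sum>i<d. a i * (x i - 2 * c i))) = ?F x" for x
    by (simp add: algebra_simps sum_distrib_left)
  have intF: "integrable (lebE d) ?F"
    using int\<phi> int\<phi>i by (intro Bochner_Integration.integrable_diff Bochner_Integration.integrable_sum integrable_mult_right) auto
  have "(\<integral>x. \<phi> x - m * indicator D x \<partial>lebE d) \<le> (\<integral>x. ?F x \<partial>lebE d)"
  proof (rule integral_mono_AE)
    show "integrable (lebE d) (\<lambda>x. \<phi> x - m * indicator D x)"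
      using int\<phi> intD by (intro Bochner_Integration.integrable_diff integrable_mult_right) auto
    show "AE x in lebE d. \<phi> x - m * indicator D x \<le> ?F x"
      using AE_lebE_E[of d] by (rule AE_mp) (use pt F in \<open>auto intro!: AE_I2\<close>)
  qed (rule intF)
  also have "(\<integral>x. \<phi> x - m * indicator D x \<partial>lebE d) = V\<^sup>2 - m * (2 ^ d * V)"
    using int\<phi> intD by (subst Bochner_Integration.integral_diff) (auto simp: I\<phi> mD)
  also have "\<dots> = 0" by (simp add: m_def power2_eq_square)
  also have "(\<integral>x. ?F x \<partial>lebE d) = L * V\<^sup>2 - (\<Sum>i<d. a i * (2 * V\<^sup>2 * c i) - a i * (2 * c i) * V\<^sup>2)"
  proof -
    have t: "integrable (lebE d) (\<lambda>x. a i * (\<phi> x * x i) - a i * (2 * c i) * \<phi> x)" if "i < d" for i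
      using int\<phi> int\<phi>i[OF that] by (intro Bochner_Integration.integrable_diff integrable_mult_right)
    have "(\<integral>x. ?F x \<partial>lebE d) = (\<integral>x. L * \<phi> x \<partial>lebE d) - (\<integral>x. (\<Sum>i<d. a i * (\<phi> x * x i) - a i * (2 * c i) * \<phi> x) \<partial>lebE d)"
      using int\<phi> t by (intro Bochner_Integration.integral_diff Bochner_Integration.integrable_sum integrable_mult_right) auto
    also have "(\<integral>x. (\<Sum>i<d. a i * (\<phi> x * x i) - a i * (2 * c i) * \<phi> x) \<partial>lebE d)
      = (\<Sum>i<d. \<integral>x. a i * (\<phi> x * x i) - a i * (2 * c i) * \<phi> x \<partial>lebE d)"
      using t by (intro Bochner_Integration.integral_sum) auto
    also have "\<dots> = (\<Sum>i<d. a i * (2 * V\<^sup>2 * c i) - a i * (2 * c i) * V\<^sup>2)"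
    proof (intro sum.cong refl)
      fix i assume "i \<in> {..<d}"
      then have i: "i < d" by simp
      have "(\<integral>x. a i * (\<phi> x * x i) - a i * (2 * c i) * \<phi> x \<partial>lebE d)
        = (\<integral>x. a i * (\<phi> x * x i) \<partial>lebE d) - (\<integral>x. a i * (2 * c i) * \<phi> x \<partial>lebE d)"
        using int\<phi> int\<phi>i[OF i] by (intro Bochner_Integration.integral_diff integrable_mult_right) 
      then show "(\<integral>x. a i * (\<phi> x * x i) - a i * (2 * c i) * \<phi> x \<partial>lebE d) = a i * (2 * V\<^sup>2 * c i) - a i * (2 * c i) * V\<^sup>2"
        by (simp only: integral_mult_right_zero I\<phi> I\<phi>i[OF i])
    qed
    finally show ?thesis by (simp only: integral_mult_right_zero I\<phi>)
  qed
  \<comment> \<open>The barycentre of \<open>\<phi>\<close> is 2c, so the linear terms drop out and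
    only the sign of \<open>L\<close> remains.\<close>
  also have "\<dots> = L * V\<^sup>2"
  proof -
    have "(\<Sum>i<d. a i * (2 * V\<^sup>2 * c i) - a i * (2 * c i) * V\<^sup>2) = 0" by (rule sum.neutral) simp
    then show ?thesis by simp
  qed
  finally have "0 \<le> L" using V by (simp add: zero_le_mult_iff)
  then have "m \<le> \<phi> (2 *\<^sub>R c)" using \<phi>c m by (simp add: L_def)
  then show ?thesis by (simp add: m_def V_def \<phi>_def c_def field_simps)
qed

section \<open>Packing the centres\<close>

text \<open>For convex L the set \<alpha> L + \<beta> L lies in (\<alpha> + \<beta>) L, and the
  dilates of a convex set containing 0 are nested. In this way coefficients of different sizes are
  brought to a common scale.\<close>

lemma convex_cone_combination:
  assumes L: "convex L" "0 \<in> L" and ab: "a \<in> L" "b \<in> L"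
    and c: "0 \<le> \<alpha>" "0 \<le> \<beta>" "\<alpha> + \<beta> \<le> \<gamma>" "0 < \<gamma>"
  obtains l where "l \<in> L" "\<alpha> *\<^sub>R a + \<beta> *\<^sub>R b = \<gamma> *\<^sub>R l"
proof (cases "\<alpha> + \<beta> = 0")
  case True
  then have "\<alpha> = 0" "\<beta> = 0" using c by auto
  then show thesis using that[of 0] L by simp
next
  case False
  then have p: "\<alpha> + \<beta> > 0" using c by simp
  define k where "k = (1 - \<beta> / (\<alpha> + \<beta>)) *\<^sub>R a + (\<beta> / (\<alpha> + \<beta>)) *\<^sub>R b"
  have k: "k \<in> L" unfolding k_def
    by (rule convex_combination_mem[OF L(1) ab]) (use c p in \<open>auto simp: pos_divide_le_eq\<close>)
  have "1 - \<beta> / (\<alpha> + \<beta>) = \<alpha> / (\<alpha> + \<beta>)" using p by (simp add: field_simps)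
  then have kk: "(\<alpha> + \<beta>) *\<^sub>R k = \<alpha> *\<^sub>R a + \<beta> *\<^sub>R b" using p by (simp add: k_def scaleR_add_right)
  define l where "l = (1 - (\<alpha> + \<beta>) / \<gamma>) *\<^sub>R 0 + ((\<alpha> + \<beta>) / \<gamma>) *\<^sub>R k"
  have "l \<in> L" unfolding l_def
    by (rule convex_combination_mem[OF L(1) L(2) k]) (use c p in \<open>auto simp: pos_divide_le_eq\<close>)
  moreover have "\<gamma> *\<^sub>R l = \<alpha> *\<^sub>R a + \<beta> *\<^sub>R b" using c(4) by (simp add: l_def kk)
  ultimately show thesis using that[of l] by simp
qed

lemma convex_scale_mem:
  assumes "convex L" "0 \<in> L" "a \<in> L" "0 \<le> \<alpha>" "\<alpha> \<le> \<gamma>" "0 < \<gamma>"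
  obtains l where "l \<in> L" "\<alpha> *\<^sub>R a = \<gamma> *\<^sub>R l"
  using convex_cone_combination[OF assms(1,2,3,2), of \<alpha> 0 \<gamma>] assms by auto

definition core :: "(nat \<Rightarrow> real) set \<Rightarrow> (nat \<Rightarrow> real) set" where
  "core L = {x \<in> L. - x \<in> L}"

lemma core_minus: "x \<in> core L \<Longrightarrow> - x \<in> core L" by (simp add: core_def)

lemma compact_core: "compact L \<Longrightarrow> compact (core L)"
proof -
  assume L: "compact L"
  have "core L = overlap L (- 1) 0" by (simp add: core_def overlap_def)
  then show ?thesis using compact_overlap[OF L, of "- 1" 0] by simp
qed

lemma convex_core: "convex L \<Longrightarrow> convex (core L)"
  unfolding convex_alt core_def
proof (intro ballI allI impI CollectI conjI)
  fix x y and u :: real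
  assume L: "\<forall>x\<in>L. \<forall>y\<in>L. \<forall>u. 0 \<le> u \<and> u \<le> 1 \<longrightarrow> (1 - u) *\<^sub>R x + u *\<^sub>R y \<in> L"
    and x: "x \<in> {x \<in> L. - x \<in> L}" and y: "y \<in> {x \<in> L. - x \<in> L}" and u: "0 \<le> u \<and> u \<le> 1"
  show "(1 - u) *\<^sub>R x + u *\<^sub>R y \<in> L" using L x y u by blast
  have "(1 - u) *\<^sub>R (- x) + u *\<^sub>R (- y) \<in> L" using L x y u by blast
  then show "- ((1 - u) *\<^sub>R x + u *\<^sub>R y) \<in> L" by (simp add: add.commute)
qed

text \<open>Since 3/2 + 1/d <= (3/2)(1 + 1/d), the price of letting scales vary by the ratio 1 + 1/d
  is (1 + 1/d)^d <= e <= 3.\<close>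

lemma power_three_halves_bound:
  assumes "2 \<le> d"
  shows "(3 / 2 + 1 / real d) ^ d \<le> 3 * (3 / 2) ^ d"
proof -
  have d: "real d > 0" using assms by simp
  have "1 + 1 / real d \<le> exp (1 / real d)" by (rule exp_ge_add_one_self)
  then have "(1 + 1 / real d) ^ d \<le> exp (1 / real d) ^ d" by (rule power_mono) simp
  also have "\<dots> = exp (real d * (1 / real d))" by (rule exp_of_nat_mult[symmetric])
  also have "\<dots> = exp 1" using d by simp
  also have "\<dots> \<le> 3" by (rule exp_le)
  finally have e: "(1 + 1 / real d) ^ d \<le> 3" .
  have "(3 / 2 + 1 / real d) ^ d \<le> ((3 / 2) * (1 + 1 / real d)) ^ d"
    by (rule power_mono) (use d in \<open>auto simp: field_simps\<close>)
  also have "\<dots> = (3 / 2) ^ d * (1 + 1 / real d) ^ d" by (rule power_mult_distrib)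
  also have "\<dots> \<le> (3 / 2) ^ d * 3" using e by (rule mult_left_mono) simp
  finally show ?thesis by simp
qed

text \<open>Packing of translates of the core combined with the isodiametric consequence
  \<open>vol X \<le> vol ((X - X) / 2)\<close> of the Brunn--Minkowski inequality.\<close>

lemma packing_bound:
  fixes w :: "'i \<Rightarrow> nat \<Rightarrow> real"
  assumes L: "compact L" "L \<subseteq> E d" "convex L" "0 \<in> L" and d: "2 \<le> d" and \<mu>: "\<mu> > 0"
    and J: "finite J" "\<And>j. j \<in> J \<Longrightarrow> w j \<in> E d"
    and sep: "\<And>i j p. i \<in> J \<Longrightarrow> j \<in> J \<Longrightarrow> i \<noteq> j \<Longrightarrow> p \<in> core L \<Longrightarrow> w i - w j \<noteq> ((1 - 1 / real d) * \<mu>) *\<^sub>R p"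
    and near: "\<And>i j. i \<in> J \<Longrightarrow> j \<in> J \<Longrightarrow> i \<noteq> j \<Longrightarrow>
      \<exists>a\<in>L. \<exists>b\<in>L. w i - w j = (\<mu> * (1 + 1 / real d)) *\<^sub>R (a - b)"
  shows "real (card J) * measure (lebE d) (core L)
      \<le> 27 * (3 / 2) ^ d * measure (lebE d) ((\<lambda>(x, y). x - y) ` (L \<times> L))"
proof -
  define P where "P = core L"
  define D where "D = (\<lambda>(x, y). x - y) ` (L \<times> L)"
  define s where "s = 1 - 1 / real d"
  \<comment> \<open>\<open>\<beta>\<close> is half the guaranteed separation, so copies of
    \<open>P\<close> of this radius are disjoint; \<open>\<alpha>\<close> is the spread of the
    centres; \<open>\<gamma>\<close> dominates their sum, and the half in its 3/2 is the share of
    \<open>\<beta>\<close>.\<close>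
  define \<beta> where "\<beta> = s * \<mu> / 2"
  define \<alpha> where "\<alpha> = \<mu> * (1 + 1 / real d)"
  define \<gamma> where "\<gamma> = \<mu> * (3 / 2 + 1 / real d)"
  have s: "0 < s" "s < 1" using d by (auto simp: s_def)
  have \<beta>: "\<beta> > 0" using s \<mu> by (simp add: \<beta>_def)
  have \<alpha>: "\<alpha> > 0" unfolding \<alpha>_def using \<mu> by (intro mult_pos_pos add_pos_nonneg) auto
  have "s * \<mu> \<le> \<mu>" using s \<mu> by simp
  then have \<gamma>: "\<alpha> + \<beta> \<le> \<gamma>" by (simp add: \<alpha>_def \<beta>_def \<gamma>_def algebra_simps)
  have \<gamma>0: "\<gamma> > 0" using \<alpha> \<beta> \<gamma> by linarith
  have Pc: "compact P" "P \<subseteq> E d" "P \<subseteq> L" unfolding P_def using compact_core[OF L(1)] L(2) by (auto simp: core_def)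
  have Dc: "compact D" unfolding D_def by (rule compact_diff_image[OF L(1) L(1)])
  have DE: "D \<subseteq> E d" using L(2) by (auto simp: D_def intro: E_diff)
  define Y where "Y = (\<lambda>j. (\<lambda>x. w j + \<beta> *\<^sub>R x) ` P)"
  have Yc: "compact (Y j)" for j unfolding Y_def by (rule compact_affine[OF Pc(1)])
  have YE: "Y j \<subseteq> E d" if "j \<in> J" for j unfolding Y_def using J(2)[OF that] Pc(2) by (auto intro: E_add E_scaleR)
  define X where "X = (\<Union>j\<in>J. Y j)"
  have Xc: "compact X" unfolding X_def by (rule compact_UN[OF J(1)]) (rule Yc)
  have XE: "X \<subseteq> E d" using YE by (auto simp: X_def)
  have disj: "disjoint_family_on Y J"
    unfolding disjoint_family_on_def
  proof (intro ballI impI)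
    fix i j assume ij: "i \<in> J" "j \<in> J" "i \<noteq> j"
    show "Y i \<inter> Y j = {}"
    proof (rule ccontr)
      assume "Y i \<inter> Y j \<noteq> {}"
      then obtain p q where pq: "p \<in> P" "q \<in> P" "w i + \<beta> *\<^sub>R p = w j + \<beta> *\<^sub>R q" by (auto simp: Y_def)
      then have e: "w i - w j = \<beta> *\<^sub>R q - \<beta> *\<^sub>R p" by (metis add_diff_cancel_left' add_diff_eq diff_diff_eq2 add.commute)
      \<comment> \<open>The core is symmetric and convex, so it contains (q - p)/2; a common point
        of the two translates thus puts the difference of centres into s \<mu> times the
        core.\<close>
      have "(1 - 1 / 2) *\<^sub>R q + (1 / 2) *\<^sub>R (- p) \<in> core L"
        by (rule convex_combination_mem[OF convex_core[OF L(3)]]) (use pq core_minus in \<open>auto simp: P_def\<close>)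
      moreover have "w i - w j = (s * \<mu>) *\<^sub>R ((1 - 1 / 2) *\<^sub>R q + (1 / 2) *\<^sub>R (- p))"
        unfolding e by (simp add: \<beta>_def scaleR_diff_right)
      ultimately show False using sep[OF ij] by (simp only: s_def)
    qed
  qed
  have mX: "measure (lebE d) X = real (card J) * (\<beta> ^ d * measure (lebE d) P)"
  proof -
    have "measure (lebE d) X = (\<Sum>j\<in>J. measure (lebE d) (Y j))"
      unfolding X_def
    proof (rule measure_finite_Union[OF J(1) _ disj])
      show "Y ` J \<subseteq> sets (lebE d)" using compact_borel[OF Yc] by auto
      show "emeasure (lebE d) (Y j) \<noteq> \<infinity>" if "j \<in> J" for j
        using emeasure_compact_finite[OF Yc YE[OF that]] by simp
    qed
    also have "\<dots> = (\<Sum>j\<in>J. \<beta> ^ d * measure (lebE d) P)"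
      using \<beta> by (intro sum.cong) (auto simp: Y_def measure_affine_image[OF Pc(1) _ J(2)])
    finally show ?thesis by simp
  qed
  \<comment> \<open>The reflected set -X has the same volume as X, so Brunn--Minkowski with weight
    1/2 has vol(X) itself on the left and the halved difference set on the right.\<close>
  define N where "N = (\<lambda>x. 0 + (- 1) *\<^sub>R x) ` X"
  have Nc: "compact N" unfolding N_def by (rule compact_affine[OF Xc])
  have NE: "N \<subseteq> E d" using XE by (auto simp: N_def intro: E_minus)
  have mN: "measure (lebE d) N = measure (lebE d) X"
    unfolding N_def using measure_affine_image[OF Xc _ E_zero, of "- 1"] by simp
  define C where "C = (\<lambda>x. 0 + (\<gamma> / 2) *\<^sub>R x) ` D"
  have Cc: "compact C" unfolding C_def by (rule compact_affine[OF Dc])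
  have CE: "C \<subseteq> E d" using DE by (auto simp: C_def intro: E_scaleR)
  have mC: "measure (lebE d) C = (\<gamma> / 2) ^ d * measure (lebE d) D"
    unfolding C_def using measure_affine_image[OF Dc _ E_zero, of "\<gamma> / 2"] \<gamma>0 by simp
  have "measure (lebE d) X powr (1 - 1 / 2) * measure (lebE d) N powr (1 / 2) \<le> measure (lebE d) C"
  proof (rule brunn_minkowski[OF Xc XE Nc NE Cc CE])
    fix x y assume "x \<in> X" "y \<in> N"
    then obtain i j p q where ij: "i \<in> J" "j \<in> J" and pq: "p \<in> P" "q \<in> P"
      and x: "x = w i + \<beta> *\<^sub>R p" and y: "y = - (w j + \<beta> *\<^sub>R q)" by (auto simp: X_def N_def Y_def)
    have "\<exists>a\<in>L. \<exists>b\<in>L. w i - w j = \<alpha> *\<^sub>R (a - b)"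
      using near[OF ij] L(4) unfolding \<alpha>_def by (cases "i = j") force+
    then obtain a b where ab: "a \<in> L" "b \<in> L" "w i - w j = \<alpha> *\<^sub>R (a - b)" by blast
    have pqL: "p \<in> L" "q \<in> L" using pq Pc(3) by auto
    \<comment> \<open>Spread and radius are absorbed on each side of the difference separately:
      \<alpha> a + \<beta> p and \<alpha> b + \<beta> q both lie in \<gamma> L, so x + y lies in
      \<gamma> (L - L).\<close>
    obtain k where k: "k \<in> L" "\<alpha> *\<^sub>R a + \<beta> *\<^sub>R p = \<gamma> *\<^sub>R k"
      by (rule convex_cone_combination[OF L(3,4) ab(1) pqL(1) _ _ \<gamma> \<gamma>0]) (use \<alpha> \<beta> in auto)
    obtain l where l: "l \<in> L" "\<alpha> *\<^sub>R b + \<beta> *\<^sub>R q = \<gamma> *\<^sub>R l"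
      by (rule convex_cone_combination[OF L(3,4) ab(2) pqL(2) _ _ \<gamma> \<gamma>0]) (use \<alpha> \<beta> in auto)
    have "x + y = (w i - w j) + (\<beta> *\<^sub>R p - \<beta> *\<^sub>R q)" by (simp add: x y)
    also have "\<dots> = (\<alpha> *\<^sub>R a + \<beta> *\<^sub>R p) - (\<alpha> *\<^sub>R b + \<beta> *\<^sub>R q)" by (simp add: ab(3) scaleR_diff_right)
    also have "\<dots> = \<gamma> *\<^sub>R (k - l)" by (simp only: k l scaleR_diff_right)
    finally have xy: "x + y = \<gamma> *\<^sub>R (k - l)" .
    have "(1 - 1 / 2) *\<^sub>R x + (1 / 2) *\<^sub>R y = (1 / 2) *\<^sub>R (x + y)" by (simp add: scaleR_add_right)
    also have "\<dots> = 0 + (\<gamma> / 2) *\<^sub>R (k - l)" by (simp add: xy)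
    also have "k - l \<in> D" unfolding D_def by (rule image_eqI[of _ _ "(k, l)"]) (use k(1) l(1) in simp_all)
    then have "0 + (\<gamma> / 2) *\<^sub>R (k - l) \<in> C" unfolding C_def by (rule imageI)
    finally show "(1 - 1 / 2) *\<^sub>R x + (1 / 2) *\<^sub>R y \<in> C" .
  qed auto
  then have "measure (lebE d) X \<le> (\<gamma> / 2) ^ d * measure (lebE d) D"
    by (simp add: mN mC powr_half_sqrt flip: powr_add)
  moreover have "(\<gamma> / 2) ^ d = (\<mu> / 2) ^ d * (3 / 2 + 1 / real d) ^ d"
    by (simp add: \<gamma>_def power_mult_distrib[symmetric])
  moreover have "\<beta> ^ d = (\<mu> / 2) ^ d * s ^ d" by (simp add: \<beta>_def power_mult_distrib[symmetric] mult.commute)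
  ultimately have "(\<mu> / 2) ^ d * (real (card J) * s ^ d * measure (lebE d) P)
      \<le> (\<mu> / 2) ^ d * ((3 / 2 + 1 / real d) ^ d * measure (lebE d) D)"
    by (simp add: mX mult_ac)
  then have "real (card J) * s ^ d * measure (lebE d) P \<le> (3 / 2 + 1 / real d) ^ d * measure (lebE d) D"
    using \<mu> by (subst (asm) mult_le_cancel_left_pos) auto
  also have "\<dots> \<le> 3 * (3 / 2) ^ d * measure (lebE d) D"
    by (rule mult_right_mono[OF power_three_halves_bound[OF d]]) simp
  finally have 1: "real (card J) * s ^ d * measure (lebE d) P \<le> 3 * (3 / 2) ^ d * measure (lebE d) D" .
  \<comment> \<open>Removing s^d costs 9; with the 3 from the scale ratio this makes 27.\<close>
  have "(real (card J) * measure (lebE d) P) * (1 / 9) \<le> (real (card J) * measure (lebE d) P) * s ^ d"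
    unfolding s_def by (rule mult_left_mono[OF one_ninth_le_power[OF d]]) simp
  with 1 have "real (card J) * measure (lebE d) P \<le> 27 * (3 / 2) ^ d * measure (lebE d) D"
    by (simp add: mult_ac)
  then show ?thesis by (simp add: P_def D_def)
qed

section \<open>Sorting the members by scale\<close>

lemma scale_between:
  fixes f :: "nat \<Rightarrow> real"
  assumes "f 0 \<le> x" "x < f N"
  shows "\<exists>n<N. f n \<le> x \<and> x < f (Suc n)"
  using assms
proof (induction N)
  case (Suc N)
  show ?case
  proof (cases "x < f N")
    case True
    then show ?thesis using Suc less_Suc_eq by metis
  next
    case False
    then show ?thesis using Suc.prems by (intro exI[of _ N]) auto
  qed
qed auto

text \<open>Since ln(1 + 1/d) >= 1/(2d), about 2 d ln T steps of ratio 1 + 1/d reach T; the extra 1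
  is the rounding.\<close>

lemma number_of_scales:
  assumes d: "2 \<le> d" and T: "T \<ge> 1"
  obtains N where "T \<le> (1 + 1 / real d) ^ N" "real N \<le> 2 * real d * ln T + 1"
proof -
  define N where "N = nat \<lceil>2 * real d * ln T\<rceil>"
  have lT: "0 \<le> 2 * real d * ln T" using T by simp
  have N: "2 * real d * ln T \<le> real N" "real N \<le> 2 * real d * ln T + 1"
    using lT unfolding N_def by linarith+
  define x where "x = 1 / real d"
  have x: "0 < x" "x \<le> 1 / 2" using d by (auto simp: x_def field_simps)
  have "x - x\<^sup>2 \<le> ln (1 + x)" by (rule ln_one_plus_pos_lower_bound) (use x in auto)
  moreover have "x\<^sup>2 \<le> x / 2" using x by (simp add: power2_eq_square)
  ultimately have "x / 2 \<le> ln (1 + x)" by linarith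
  then have "real N * (x / 2) \<le> real N * ln (1 + x)" by (rule mult_left_mono) simp
  also have "\<dots> = ln ((1 + x) ^ N)" using x by (simp add: ln_realpow)
  finally have "real N * (x / 2) \<le> ln ((1 + x) ^ N)" .
  moreover have "ln T = 2 * real d * ln T * (x / 2)" using d by (simp add: x_def)
  moreover have "2 * real d * ln T * (x / 2) \<le> real N * (x / 2)" using N(1) x by (intro mult_right_mono) auto
  ultimately have "ln T \<le> ln ((1 + x) ^ N)" by linarith
  then have "T \<le> (1 + x) ^ N" using T x by simp
  then show thesis using that N(2) by (simp add: x_def)
qed

text \<open>The members of the family are sorted by scale, in ratio \<open>1 + 1/d\<close>, up to \<open>d \<theta>\<close> times the
  smallest one. All the larger ones are treated together: seen from the smallest one and rescaled
  to unit size, their centres are still separated by almost the full core.\<close>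

lemma pairwise_intersecting_bound:
  fixes w :: "'i \<Rightarrow> nat \<Rightarrow> real" and lam :: "'i \<Rightarrow> real"
  assumes L: "compact L" "L \<subseteq> E d" "convex L" "0 \<in> L" and d: "2 \<le> d"
    and \<theta>: "\<theta> \<ge> 1" "\<And>x. x \<in> L \<Longrightarrow> \<exists>y\<in>L. - x = \<theta> *\<^sub>R y"
    and I: "finite I" "\<And>i. i \<in> I \<Longrightarrow> w i \<in> E d" "\<And>i. i \<in> I \<Longrightarrow> lam i > 0"
    and sep: "\<And>i j t l. i \<in> I \<Longrightarrow> j \<in> I \<Longrightarrow> i \<noteq> j \<Longrightarrow> 0 \<le> t \<Longrightarrow> t < lam j \<Longrightarrow> l \<in> L \<Longrightarrow> w i - w j \<noteq> t *\<^sub>R l"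
    and meet: "\<And>i j. i \<in> I \<Longrightarrow> j \<in> I \<Longrightarrow> i \<noteq> j \<Longrightarrow> \<exists>a\<in>L. \<exists>b\<in>L. w i + lam i *\<^sub>R a = w j + lam j *\<^sub>R b"
  shows "real (card I) * measure (lebE d) (core L)
      \<le> 27 * (3 / 2) ^ d * measure (lebE d) ((\<lambda>(x, y). x - y) ` (L \<times> L)) * (4 * real d * (ln (real d) + ln \<theta>))"
proof (cases "I = {}")
  case True
  then show ?thesis using \<theta>(1) d by simp
next
  case False
  define B where "B = 27 * (3 / 2) ^ d * measure (lebE d) ((\<lambda>(x, y). x - y) ` (L \<times> L))"
  have B0: "0 \<le> B" by (simp add: B_def)
  let ?P = "measure (lebE d) (core L)"
  have d1: "real d \<ge> 2" using d by simp
  have d\<theta>: "real d * \<theta> \<ge> 2" using mult_mono[OF d1 \<theta>(1)] by simp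
  obtain i0 where i0: "i0 \<in> I" "\<And>i. i \<in> I \<Longrightarrow> lam i0 \<le> lam i"
  proof -
    have "Min (lam ` I) \<in> lam ` I" using I(1) False by (intro Min_in) auto
    then obtain i0 where "i0 \<in> I" "lam i0 = Min (lam ` I)" by auto
    then show thesis using that[of i0] I(1) by auto
  qed
  have l0: "lam i0 > 0" using I(3) i0(1) .
  have meet': "\<exists>a\<in>L. \<exists>b\<in>L. w i - w j = lam j *\<^sub>R b - lam i *\<^sub>R a" if ij: "i \<in> I" "j \<in> I" "i \<noteq> j" for i j
  proof -
    obtain a b where ab: "a \<in> L" "b \<in> L" "w i + lam i *\<^sub>R a = w j + lam j *\<^sub>R b" using meet[OF ij] by blast
    then have "w i - w j = lam j *\<^sub>R b - lam i *\<^sub>R a" by (simp add: algebra_simps)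
    with ab show ?thesis by blast
  qed
  obtain N where N: "real d * \<theta> \<le> (1 + 1 / real d) ^ N" "real N \<le> 2 * real d * ln (real d * \<theta>) + 1"
    using number_of_scales[OF d, of "real d * \<theta>"] d\<theta> by auto
  define f where "f = (\<lambda>n. lam i0 * (1 + 1 / real d) ^ n)"
  define J where "J = (\<lambda>n. {i \<in> I. f n \<le> lam i \<and> lam i < f (Suc n)})"
  define G where "G = {i \<in> I. real d * \<theta> * lam i0 \<le> lam i}"
  have f0: "f n > 0" for n unfolding f_def using l0 by (intro mult_pos_pos zero_less_power add_pos_nonneg) auto
  have JB: "real (card (J n)) * ?P \<le> B" for n
    unfolding B_def
  proof (rule packing_bound[where w = w and \<mu> = "f n"])
    show "finite (J n)" using I(1) by (simp add: J_def)
    show "w j \<in> E d" if "j \<in> J n" for j using that I(2) by (simp add: J_def)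
    fix i j assume ij: "i \<in> J n" "j \<in> J n" "i \<noteq> j"
    then have ijI: "i \<in> I" "j \<in> I" by (auto simp: J_def)
    show "w i - w j \<noteq> ((1 - 1 / real d) * f n) *\<^sub>R p" if "p \<in> core L" for p
    proof (rule sep[OF ijI ij(3)])
      \<comment> \<open>Strictness matters: \<open>sep\<close> only excludes coefficients strictly
        below \<open>lam j\<close>, and the factor 1 - 1/d supplies the slack.\<close>
      have "(1 - 1 / real d) * f n < 1 * f n" using d f0[of n] by (intro mult_strict_right_mono) auto
      also have "\<dots> \<le> lam j" using ij by (simp add: J_def)
      finally show "(1 - 1 / real d) * f n < lam j" .
      show "0 \<le> (1 - 1 / real d) * f n" using d f0[of n] by (intro mult_nonneg_nonneg) auto
      show "p \<in> L" using that by (simp add: core_def)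
    qed
    have fS: "f (Suc n) = f n * (1 + 1 / real d)" by (simp add: f_def)
    obtain a b where ab: "a \<in> L" "b \<in> L" "w i - w j = lam j *\<^sub>R b - lam i *\<^sub>R a"
      using meet'[OF ijI ij(3)] by blast
    have le: "0 \<le> lam i" "0 \<le> lam j" "lam i \<le> f (Suc n)" "lam j \<le> f (Suc n)"
      using ij I(3)[OF ijI(1)] I(3)[OF ijI(2)] by (auto simp: J_def)
    obtain a' where a': "a' \<in> L" "lam i *\<^sub>R a = f (Suc n) *\<^sub>R a'"
      by (rule convex_scale_mem[OF L(3,4) ab(1) le(1,3) f0]) (rule that)
    obtain b' where b': "b' \<in> L" "lam j *\<^sub>R b = f (Suc n) *\<^sub>R b'"
      by (rule convex_scale_mem[OF L(3,4) ab(2) le(2,4) f0]) (rule that)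
    have "w i - w j = f (Suc n) *\<^sub>R (b' - a')" by (simp only: ab a' b' scaleR_diff_right)
    then show "\<exists>a\<in>L. \<exists>b\<in>L. w i - w j = (f n * (1 + 1 / real d)) *\<^sub>R (a - b)"
      unfolding fS using a' b' by blast
  qed (use L d f0 in auto)
  \<comment> \<open>The dilate of L that, reflected, contains w j - w i0: \<open>lam j\<close> for
    the member itself, and theta times the smallest scale for reflecting the point contributed by
    the smallest member.\<close>
  define \<rho> where "\<rho> = (\<lambda>j. lam j + \<theta> * lam i0)"
  have \<rho>0: "\<rho> j > 0" if "j \<in> I" for j
    using I(3)[OF that] l0 \<theta>(1) by (auto simp: \<rho>_def intro: add_pos_nonneg)
  have "lam i0 < real d * \<theta> * lam i0" using d\<theta> l0 by simp
  then have i0G: "i0 \<notin> G" by (simp add: G_def)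
  have "\<exists>l\<in>L. w j - w i0 = - (\<rho> j *\<^sub>R l)" if "j \<in> G" for j
  proof -
    have j: "j \<in> I" "j \<noteq> i0" using that i0G by (auto simp: G_def)
    obtain a b where ab: "a \<in> L" "b \<in> L" "w j - w i0 = lam i0 *\<^sub>R b - lam j *\<^sub>R a"
      using meet'[OF j(1) i0(1) j(2)] by blast
    \<comment> \<open>The point of the smallest member enters with the opposite sign, and theta is
      what it costs to bring it back into L.\<close>
    obtain b' where b': "b' \<in> L" "- b = \<theta> *\<^sub>R b'" using \<theta>(2)[OF ab(2)] by blast
    have n: "0 \<le> lam j" "0 \<le> \<theta> * lam i0" "lam j + \<theta> * lam i0 \<le> \<rho> j"
      using I(3)[OF j(1)] l0 \<theta>(1) by (auto simp: \<rho>_def)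
    obtain l where l: "l \<in> L" "lam j *\<^sub>R a + (\<theta> * lam i0) *\<^sub>R b' = \<rho> j *\<^sub>R l"
      by (rule convex_cone_combination[OF L(3,4) ab(1) b'(1) n \<rho>0[OF j(1)]]) (rule that)
    have "lam i0 *\<^sub>R b = - (lam i0 *\<^sub>R (- b))" by simp
    also have "\<dots> = - ((\<theta> * lam i0) *\<^sub>R b')" unfolding b'(2) by (simp add: mult.commute)
    finally have "w j - w i0 = - (lam j *\<^sub>R a + (\<theta> * lam i0) *\<^sub>R b')" unfolding ab(3) by simp
    then show ?thesis using l by auto
  qed
  then obtain l where l: "\<And>j. j \<in> G \<Longrightarrow> l j \<in> L" "\<And>j. j \<in> G \<Longrightarrow> w j - w i0 = - (\<rho> j *\<^sub>R l j)" by metis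
  \<comment> \<open>If the normalised centres were too close, then w i - w j = \<rho> i (l j - l i)
    + (\<rho> j - \<rho> i) l j would be a multiple of a point of L with coefficient
    \<open>\<tau>\<close> below \<open>lam j\<close>, which \<open>sep\<close> forbids. The
    assumption that i is not the larger member keeps the second coefficient nonnegative.\<close>
  have Gsep: "l j - l i \<noteq> (1 - 1 / real d) *\<^sub>R p"
    if ij: "i \<in> G" "j \<in> G" "i \<noteq> j" and le: "lam i \<le> lam j" and p: "p \<in> L" for i j p
  proof
    assume e: "l j - l i = (1 - 1 / real d) *\<^sub>R p"
    have ijI: "i \<in> I" "j \<in> I" using ij by (auto simp: G_def)
    define s where "s = 1 - 1 / real d"
    define \<tau> where "\<tau> = \<rho> i * s + (\<rho> j - \<rho> i)"
    have s: "0 < s" "s < 1" using d by (auto simp: s_def)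
    have ji: "0 \<le> \<rho> j - \<rho> i" using le by (simp add: \<rho>_def)
    have \<tau>0: "\<tau> > 0" unfolding \<tau>_def using \<rho>0[OF ijI(1)] s ji by (intro add_pos_nonneg mult_pos_pos) auto
    \<comment> \<open>Here the cut-off defining \<open>G\<close> is used: \<rho> i exceeds lam i by
      a factor of at most 1 + 1/d, which the factor 1 - 1/d more than compensates. As \<rho> j -
      \<rho> i = lam j - lam i, the total stays below lam j.\<close>
    have "\<theta> * lam i0 \<le> lam i / real d" using ij(1) d by (simp add: G_def field_simps)
    then have "\<rho> i \<le> lam i * (1 + 1 / real d)" by (simp add: \<rho>_def algebra_simps)
    then have "\<rho> i * s \<le> lam i * (1 + 1 / real d) * s" using s by (intro mult_right_mono) auto
    also have "\<dots> = lam i * (1 - 1 / (real d)\<^sup>2)" by (simp add: s_def power2_eq_square algebra_simps)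
    also have "\<dots> < lam i * 1" using I(3)[OF ijI(1)] d by (intro mult_strict_left_mono) auto
    finally have "\<tau> < lam j" by (simp add: \<tau>_def \<rho>_def)
    have n: "0 \<le> \<rho> i * s" "\<rho> i * s + (\<rho> j - \<rho> i) \<le> \<tau>"
      using \<rho>0[OF ijI(1)] s by (auto simp: \<tau>_def)
    obtain q where q: "q \<in> L" "(\<rho> i * s) *\<^sub>R p + (\<rho> j - \<rho> i) *\<^sub>R l j = \<tau> *\<^sub>R q"
      by (rule convex_cone_combination[OF L(3,4) p l(1)[OF ij(2)] n(1) ji n(2) \<tau>0]) (rule that)
    have "w i - w j = (w i - w i0) - (w j - w i0)" by simp
    also have "\<dots> = \<rho> j *\<^sub>R l j - \<rho> i *\<^sub>R l i" unfolding l(2)[OF ij(1)] l(2)[OF ij(2)] by simp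
    also have "\<dots> = \<rho> i *\<^sub>R (l j - l i) + (\<rho> j - \<rho> i) *\<^sub>R l j"
      by (simp add: scaleR_diff_left scaleR_diff_right)
    also have "\<dots> = (\<rho> i * s) *\<^sub>R p + (\<rho> j - \<rho> i) *\<^sub>R l j" unfolding e s_def by simp
    also have "\<dots> = \<tau> *\<^sub>R q" by (rule q(2))
    finally show False using sep[OF ijI ij(3) _ \<open>\<tau> < lam j\<close> q(1)] \<tau>0 by simp
  qed
  have GB: "real (card G) * ?P \<le> B"
    unfolding B_def
  proof (rule packing_bound[where w = "\<lambda>j. - l j" and \<mu> = 1])
    show "finite G" using I(1) by (simp add: G_def)
    show "- l j \<in> E d" if "j \<in> G" for j using l(1)[OF that] L(2) by (auto intro: E_minus)
    fix i j assume ij: "i \<in> G" "j \<in> G" "i \<noteq> j"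
    show "- l i - - l j \<noteq> ((1 - 1 / real d) * 1) *\<^sub>R p" if p: "p \<in> core L" for p
    proof
      assume e: "- l i - - l j = ((1 - 1 / real d) * 1) *\<^sub>R p"
      have p': "p \<in> L" "- p \<in> L" using p by (auto simp: core_def)
      show False
      \<comment> \<open>\<open>Gsep\<close> is one-sided, with the larger member in the second
        place; exchanging the roles replaces \<open>p\<close> by its negative, which the core also
        contains.\<close>
      proof (cases "lam i \<le> lam j")
        case True
        have "l j - l i = (1 - 1 / real d) *\<^sub>R p" using e by simp
        then show False using Gsep[OF ij True p'(1)] by simp
      next
        case False
        have "l i - l j = - (- l i - - l j)" by simp
        also have "\<dots> = (1 - 1 / real d) *\<^sub>R (- p)" unfolding e by simp
        finally show False using Gsep[OF ij(2,1) ij(3)[symmetric] _ p'(2)] False by simp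
      qed
    qed
    have pos: "(0::real) < 1 + 1 / real d" "(1::real) \<le> 1 + 1 / real d" using d by (auto intro: add_pos_nonneg)
    obtain a where a: "a \<in> L" "1 *\<^sub>R l j = (1 + 1 / real d) *\<^sub>R a"
      by (rule convex_scale_mem[OF L(3,4) l(1)[OF ij(2)] zero_le_one pos(2,1)]) (rule that)
    obtain b where b: "b \<in> L" "1 *\<^sub>R l i = (1 + 1 / real d) *\<^sub>R b"
      by (rule convex_scale_mem[OF L(3,4) l(1)[OF ij(1)] zero_le_one pos(2,1)]) (rule that)
    have "- l i - - l j = 1 *\<^sub>R l j - 1 *\<^sub>R l i" by simp
    also have "\<dots> = (1 * (1 + 1 / real d)) *\<^sub>R (a - b)" unfolding a(2) b(2) by (simp only: scaleR_diff_right mult_1)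
    finally show "\<exists>a\<in>L. \<exists>b\<in>L. - l i - - l j = (1 * (1 + 1 / real d)) *\<^sub>R (a - b)" using a(1) b(1) by blast
  qed (use L d in auto)
  have cover: "I \<subseteq> G \<union> (\<Union>n<N. J n)"
  proof
    fix i assume i: "i \<in> I"
    show "i \<in> G \<union> (\<Union>n<N. J n)"
    proof (cases "i \<in> G")
      case False
      then have "lam i < real d * \<theta> * lam i0" using i by (simp add: G_def)
      also have "\<dots> \<le> f N" unfolding f_def using N(1) l0 by (simp add: mult.commute)
      finally have "lam i < f N" .
      moreover have "f 0 \<le> lam i" using i0(2)[OF i] by (simp add: f_def)
      ultimately obtain n where "n < N" "f n \<le> lam i" "lam i < f (Suc n)" using scale_between by blast
      then show ?thesis using i by (auto simp: J_def)
    qed simp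
  qed
  have fin: "finite G" "\<And>n. finite (J n)" using I(1) by (auto simp: G_def J_def)
  have "card I \<le> card (G \<union> (\<Union>n<N. J n))" using cover fin by (intro card_mono) auto
  also have "\<dots> \<le> card G + card (\<Union>n<N. J n)" by (rule card_Un_le)
  also have "card (\<Union>n<N. J n) \<le> (\<Sum>n<N. card (J n))" by (rule card_UN_le) simp
  finally have "real (card I) \<le> real (card G) + (\<Sum>n<N. real (card (J n)))"
    by (metis add_left_mono le_trans of_nat_add of_nat_le_iff of_nat_sum)
  then have "real (card I) * ?P \<le> (real (card G) + (\<Sum>n<N. real (card (J n)))) * ?P"
    by (rule mult_right_mono) simp
  also have "\<dots> = real (card G) * ?P + (\<Sum>n<N. real (card (J n)) * ?P)"
    by (simp add: distrib_right sum_distrib_right)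
  also have "\<dots> \<le> B + (\<Sum>n<N. B)" by (intro add_mono sum_mono GB JB)
  also have "\<dots> = B * (1 + real N)" by (simp add: algebra_simps)
  also have "\<dots> \<le> B * (4 * real d * (ln (real d) + ln \<theta>))"
  proof (rule mult_left_mono[OF _ B0])
    \<comment> \<open>As d >= 2, d ln d is at least 1, so the class of large members and the
      rounding, 2 in total, are at most 2 d ln d and merge into the factor 4.\<close>
    have "ln 2 \<le> ln (real d)" using d by simp
    then have "1 / 2 \<le> ln (real d)" using ln2_ge_two_thirds by linarith
    then have "2 * (1 / 2) \<le> real d * ln (real d)" using d1 by (intro mult_mono) auto
    moreover have "0 \<le> real d * ln \<theta>" using \<theta>(1) by simp
    moreover have "ln (real d * \<theta>) = ln (real d) + ln \<theta>" using d \<theta>(1) by (simp add: ln_mult)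
    ultimately show "1 + real N \<le> 4 * real d * (ln (real d) + ln \<theta>)"
      using N(2) by (simp add: algebra_simps)
  qed
  finally show ?thesis by (simp add: B_def)
qed

section \<open>Minkowski arrangements\<close>

text \<open>Cubes and Euclidean balls define the same interior, because the Euclidean norm lies
  between the sup norm and the l1 norm, which is at most d times the sup norm.\<close>

lemma intd_iff_cube:
  assumes "K \<subseteq> E d"
  shows "p \<in> intd d K \<longleftrightarrow> p \<in> K \<and> (\<exists>r>0. \<forall>y\<in>cube d r. p + y \<in> K)"
proof
  assume "p \<in> intd d K"
  then obtain e where p: "p \<in> K" and e: "e > 0"
    and ball: "\<And>y. y \<in> E d \<Longrightarrow> sqrt (\<Sum>i<d. (y i - p i)\<^sup>2) < e \<Longrightarrow> y \<in> K"
    by (auto simp: intd_def)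
  \<comment> \<open>The l1 norm on this cube is at most d r; dividing by d + 1 makes this strictly
    less than \<open>e\<close>.\<close>
  define r where "r = e / (real d + 1)"
  have r: "r > 0" using e by (simp add: r_def add_nonneg_pos)
  have "p + y \<in> K" if y: "y \<in> cube d r" for y
  proof (rule ball)
    show "p + y \<in> E d" using p assms y by (intro E_add) (auto simp: cube_def)
    have "sqrt (\<Sum>i<d. ((p + y) i - p i)\<^sup>2) = L2_set y {..<d}" by (simp add: L2_set_def)
    also have "\<dots> \<le> (\<Sum>i<d. \<bar>y i\<bar>)" by (rule L2_set_le_sum_abs)
    also have "\<dots> \<le> (\<Sum>i<d. r)" using y by (intro sum_mono) (auto simp: cube_def)
    also have "\<dots> = real d * r" by simp
    also have "\<dots> < (real d + 1) * r" using r by (intro mult_strict_right_mono) auto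
    also have "\<dots> = e" by (simp add: r_def)
    finally show "sqrt (\<Sum>i<d. ((p + y) i - p i)\<^sup>2) < e" .
  qed
  then show "p \<in> K \<and> (\<exists>r>0. \<forall>y\<in>cube d r. p + y \<in> K)" using p r by blast
next
  assume "p \<in> K \<and> (\<exists>r>0. \<forall>y\<in>cube d r. p + y \<in> K)"
  then obtain r where p: "p \<in> K" and r: "r > 0" and cb: "\<And>y. y \<in> cube d r \<Longrightarrow> p + y \<in> K" by blast
  have "y \<in> K" if y: "y \<in> E d" "sqrt (\<Sum>i<d. (y i - p i)\<^sup>2) < r" for y
  proof -
    have "\<bar>y i - p i\<bar> \<le> r" if "i < d" for i
    proof -
      have "\<bar>y i - p i\<bar> \<le> L2_set (\<lambda>i. \<bar>y i - p i\<bar>) {..<d}"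
        using that by (intro member_le_L2_set) auto
      also have "\<dots> = sqrt (\<Sum>i<d. (y i - p i)\<^sup>2)" by (simp add: L2_set_def)
      finally show ?thesis using y(2) by linarith
    qed
    then have "y - p \<in> cube d r" using y(1) p assms by (auto simp: cube_def intro: E_diff)
    from cb[OF this] show ?thesis by simp
  qed
  then show "p \<in> intd d K" using p r by (auto simp: intd_def)
qed

lemma convex_bodyD:
  assumes "convex_body d K"
  shows "compact K" "K \<subseteq> E d" "convex K" "\<exists>q. q \<in> intd d K"
proof -
  show "compact K" "K \<subseteq> E d" "\<exists>q. q \<in> intd d K" using assms by (auto simp: convex_body_def)
  have "(1 - u) *\<^sub>R x + u *\<^sub>R y = (\<lambda>i. (1 - u) * x i + u * y i)" for u and x y :: "nat \<Rightarrow> real"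
    by (simp add: fun_eq_iff)
  then show "convex K" using assms unfolding convex_body_def convex_alt by simp
qed

lemma homothet_eq: "homothet S c v = {v + c *\<^sub>R x | x. x \<in> S}"
proof -
  have "(\<lambda>i. v i + c * x i) = v + c *\<^sub>R x" for x by (simp add: fun_eq_iff)
  then show ?thesis by (simp only: homothet_def)
qed

lemma minus_set_eq: "minus_set A B = {x - y | x y. x \<in> A \<and> y \<in> B}"
  by (simp add: minus_set_def fun_diff_def)

text \<open>Contracting K towards \<open>x\<close> by the factor 1 - t carries the cube around
  \<open>p\<close> to a cube around p + t (x - p). This translates the arrangement condition, which
  speaks of the interior, into the exclusion of all dilates by factors t < 1.\<close>

lemma intd_shrink:
  assumes K: "K \<subseteq> E d" "convex K" and p: "p \<in> intd d K" and x: "x \<in> K" and t: "0 \<le> t" "t < 1"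
  shows "p + t *\<^sub>R (x - p) \<in> intd d K"
proof -
  obtain r where r: "r > 0" "\<And>y. y \<in> cube d r \<Longrightarrow> p + y \<in> K" and pK: "p \<in> K"
    using p unfolding intd_iff_cube[OF K(1)] by blast
  have in_K: "p + t *\<^sub>R (x - p) + y \<in> K" if y: "y \<in> cube d ((1 - t) * r)" for y
  proof -
    have "(1 / (1 - t)) *\<^sub>R y \<in> cube d r"
      using y t by (auto simp: cube_def abs_mult pos_divide_le_eq mult.commute intro: E_scaleR)
    from r(2)[OF this] have "(1 - t) *\<^sub>R (p + (1 / (1 - t)) *\<^sub>R y) + t *\<^sub>R x \<in> K"
      using t x by (intro convex_combination_mem[OF K(2)]) auto
    also have "(1 - t) *\<^sub>R (p + (1 / (1 - t)) *\<^sub>R y) + t *\<^sub>R x = (1 - t) *\<^sub>R p + ((1 - t) * (1 / (1 - t))) *\<^sub>R y + t *\<^sub>R x"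
      by (simp only: scaleR_add_right scaleR_scaleR)
    also have "(1 - t) * (1 / (1 - t)) = 1" using t by simp
    also have "(1 - t) *\<^sub>R p + 1 *\<^sub>R y + t *\<^sub>R x = p + t *\<^sub>R (x - p) + y"
      by (simp add: scaleR_diff_left scaleR_diff_right)
    finally show ?thesis .
  qed
  have "p + t *\<^sub>R (x - p) + 0 \<in> K" by (rule in_K) (use r t in \<open>simp add: cube_def E_zero\<close>)
  then show ?thesis unfolding intd_iff_cube[OF K(1)]
    using in_K r t by (intro conjI exI[of _ "(1 - t) * r"]) auto
qed

lemma image_Times_eq: "(\<lambda>(x, y). f x y) ` (A \<times> B) = {f x y | x y. x \<in> A \<and> y \<in> B}"
  by auto

text \<open>The translation is written with the factor 1 so that it is literally an affine image, as
  in \<open>compact_affine\<close> and \<open>measure_affine_image\<close>.\<close>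

definition centred :: "(nat \<Rightarrow> real) set \<Rightarrow> (nat \<Rightarrow> real) \<Rightarrow> (nat \<Rightarrow> real) set" where
  "centred K p = (\<lambda>x. - p + 1 *\<^sub>R x) ` K"

lemma mem_centred: "x \<in> centred K p \<longleftrightarrow> x + p \<in> K"
proof
  assume "x + p \<in> K"
  then show "x \<in> centred K p" unfolding centred_def by (rule rev_image_eqI) simp
qed (auto simp: centred_def)

lemma theta_eq:
  "theta K p = Inf {t. t > 0 \<and> (\<forall>x\<in>centred K p. \<exists>y\<in>centred K p. - x = t *\<^sub>R y)}"
proof -
  have "({(\<lambda>i. p i - x i) | x. x \<in> K} \<subseteq> {(\<lambda>i. t * (x i - p i)) | x. x \<in> K})
      \<longleftrightarrow> (\<forall>x\<in>centred K p. \<exists>y\<in>centred K p. - x = t *\<^sub>R y)" for t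
  proof -
    have 1: "(\<lambda>i. p i - x i) = - (- p + 1 *\<^sub>R x)" "(\<lambda>i. t * (x i - p i)) = t *\<^sub>R (- p + 1 *\<^sub>R x)" for x
      by (simp_all add: fun_eq_iff)
    show ?thesis unfolding 1 centred_def subset_eq by blast
  qed
  then show ?thesis by (simp only: theta_def)
qed

section \<open>A body centred at an interior point: core, difference body and asymmetry\<close>

context
  fixes d K p
  assumes d: "2 \<le> d" and body: "convex_body d K" and p: "p \<in> intd d K"
begin

lemma pE: "p \<in> E d"
  using p convex_bodyD(2)[OF body] by (auto simp: intd_def)

lemma centred_body:
  "compact (centred K p)" "centred K p \<subseteq> E d" "convex (centred K p)" "0 \<in> centred K p"
proof -
  show "compact (centred K p)" unfolding centred_def by (rule compact_affine[OF convex_bodyD(1)[OF body]])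
  show "centred K p \<subseteq> E d"
    unfolding centred_def using convex_bodyD(2)[OF body] pE by (auto intro!: E_diff)
  show "0 \<in> centred K p" using p by (simp add: mem_centred intd_def)
  show "convex (centred K p)"
    unfolding convex_alt
  proof (intro ballI allI impI)
    fix x y and u :: real assume "x \<in> centred K p" "y \<in> centred K p" "0 \<le> u \<and> u \<le> 1"
    then have "(1 - u) *\<^sub>R (x + p) + u *\<^sub>R (y + p) \<in> K"
      using convex_bodyD(3)[OF body] by (intro convex_combination_mem) (auto simp: mem_centred)
    also have "(1 - u) *\<^sub>R (x + p) + u *\<^sub>R (y + p) = ((1 - u) *\<^sub>R x + u *\<^sub>R y) + p"
      by (simp add: scaleR_add_right scaleR_diff_left)
    finally show "(1 - u) *\<^sub>R x + u *\<^sub>R y \<in> centred K p" by (simp only: mem_centred)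
  qed
qed

lemma centred_cube: "\<exists>r>0. cube d r \<subseteq> centred K p"
  using p unfolding intd_iff_cube[OF convex_bodyD(2)[OF body]] by (auto simp: mem_centred add.commute subset_eq)

lemma measure_core_pos: "measure (lebE d) (core (centred K p)) > 0"
proof -
  obtain r where r: "r > 0" "cube d r \<subseteq> centred K p" using centred_cube by blast
  have "0 + y \<in> core (centred K p)" if "y \<in> cube d r" for y
  proof -
    have "- y \<in> cube d r" using that by (auto simp: cube_def intro: E_minus)
    then show ?thesis using that r by (auto simp: core_def)
  qed
  then show ?thesis
    using r centred_body by (intro measure_pos_of_cube[OF compact_core _ E_zero r(1)]) (auto simp: core_def)
qed

lemma difference_body_centred: "(\<lambda>(x, y). x - y) ` (centred K p \<times> centred K p) = minus_set K K"
proof -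
  have "(\<lambda>(x, y). x - y) ` (centred K p \<times> centred K p) = {(- p + 1 *\<^sub>R x) - (- p + 1 *\<^sub>R y) | x y. x \<in> K \<and> y \<in> K}"
    unfolding image_Times_eq centred_def by blast
  also have "\<dots> = {x - y | x y. x \<in> K \<and> y \<in> K}" by simp
  finally show ?thesis by (simp only: minus_set_eq)
qed

lemma core_centred: "core (centred K p) = minus_set K {p} \<inter> minus_set {p} K"
proof (intro set_eqI)
  fix x
  have "x \<in> minus_set K {p} \<longleftrightarrow> x + p \<in> K" unfolding minus_set_eq by (auto intro: exI[of _ "x + p"])
  moreover have "x \<in> minus_set {p} K \<longleftrightarrow> - x + p \<in> K" unfolding minus_set_eq by (auto intro: exI[of _ "- x + p"])
  ultimately show "x \<in> core (centred K p) \<longleftrightarrow> x \<in> minus_set K {p} \<inter> minus_set {p} K"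
    by (simp only: core_def mem_centred Int_iff mem_Collect_eq)
qed

lemma vol_difference_body: "vol d (minus_set K K) = measure (lebE d) (minus_set K K)"
proof -
  have c: "compact (minus_set K K)"
    unfolding difference_body_centred[symmetric] by (rule compact_diff_image[OF centred_body(1) centred_body(1)])
  have "minus_set K K \<subseteq> E d"
    unfolding difference_body_centred[symmetric] using centred_body(2) by (auto intro: E_diff)
  then show ?thesis using compact_borel[OF c] by (rule vol_eq)
qed

lemma vol_core: "vol d (minus_set K {p} \<inter> minus_set {p} K) = measure (lebE d) (core (centred K p))"
proof -
  have "core (centred K p) \<subseteq> E d" using centred_body(2) by (auto simp: core_def)
  moreover have "core (centred K p) \<in> sets borel"
    by (rule compact_borel[OF compact_core[OF centred_body(1)]])
  ultimately show ?thesis unfolding core_centred[symmetric] by (rule vol_eq)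
qed

text \<open>By volume: -L is contained in t L and has the volume of L, so t^d is at least 1.\<close>

lemma reflection_factor_ge_1:
  assumes t: "t > 0" and ref: "\<And>x. x \<in> centred K p \<Longrightarrow> \<exists>y\<in>centred K p. - x = t *\<^sub>R y"
  shows "1 \<le> t"
proof -
  let ?L = "centred K p"
  obtain r where r: "r > 0" "cube d r \<subseteq> ?L" using centred_cube by blast
  have V: "measure (lebE d) ?L > 0"
    by (rule measure_pos_of_cube[OF centred_body(1,2) E_zero r(1)]) (use r in auto)
  have "(\<lambda>x. 0 + (- 1) *\<^sub>R x) ` ?L \<subseteq> (\<lambda>y. 0 + t *\<^sub>R y) ` ?L"
    using ref by force
  then have "measure (lebE d) ((\<lambda>x. 0 + (- 1) *\<^sub>R x) ` ?L) \<le> measure (lebE d) ((\<lambda>y. 0 + t *\<^sub>R y) ` ?L)"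
    using centred_body by (intro measure_compact_mono compact_affine) (auto intro: E_scaleR)
  then have "measure (lebE d) ?L \<le> t ^ d * measure (lebE d) ?L"
    using t measure_affine_image[OF centred_body(1) _ E_zero, of "- 1"]
      measure_affine_image[OF centred_body(1) _ E_zero, of t] by simp
  then have "1 \<le> t ^ d" using V by simp
  then show ?thesis using t d by (smt (verit) power_less_one_iff zero_less_iff_neq_zero not_numeral_le_zero)
qed

text \<open>A cube of radius r inside and one of radius R outside show that R / r works. Hence the
  infimum \<open>theta\<close> is over a nonempty set.\<close>

lemma reflection_factor_exists: "\<exists>t>0. \<forall>x\<in>centred K p. \<exists>y\<in>centred K p. - x = t *\<^sub>R y"
proof -
  obtain r where r: "r > 0" "cube d r \<subseteq> centred K p" using centred_cube by blast
  obtain R where R: "R > 0" "centred K p \<subseteq> cube d R" using compact_bounded_cube[OF centred_body(1,2)] by blast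
  have "\<exists>y\<in>centred K p. - x = (R / r) *\<^sub>R y" if "x \<in> centred K p" for x
  proof
    have "x \<in> cube d R" using that R by auto
    then have "(- (r / R)) *\<^sub>R x \<in> cube d r"
      using r R by (auto simp: cube_def abs_mult pos_divide_le_eq mult.commute mult_left_mono intro: E_scaleR E_minus)
    then show "(- (r / R)) *\<^sub>R x \<in> centred K p" using r by auto
    show "- x = (R / r) *\<^sub>R ((- (r / R)) *\<^sub>R x)" using r R by simp
  qed
  then show ?thesis using r R by (intro exI[of _ "R / r"]) auto
qed

lemma theta_ge_1: "1 \<le> theta K p"
  unfolding theta_eq by (rule cInf_greatest) (use reflection_factor_exists reflection_factor_ge_1 in auto)

lemma card_le_kappa_bound:
  assumes fam: "pw_int_family d K I v lam" and arr: "minkowski_arr d K p I v lam"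
  shows "real (card I) \<le> (3/2) ^ d * vol d (minus_set K K)
              / vol d (minus_set K {p} \<inter> minus_set {p} K)
              * 216 * real d * (ln (real d) + ln (theta K p))"
proof -
  let ?L = "centred K p"
  \<comment> \<open>An actual reflection factor is needed; instead of showing that the infimum is
    attained, one below 2 theta is taken, which exists because theta is positive.\<close>
  obtain t where t: "t > 0" "\<And>x. x \<in> ?L \<Longrightarrow> \<exists>y\<in>?L. - x = t *\<^sub>R y" "t < 2 * theta K p"
  proof -
    have "Inf {t. t > 0 \<and> (\<forall>x\<in>?L. \<exists>y\<in>?L. - x = t *\<^sub>R y)} < 2 * theta K p"
      using theta_ge_1 unfolding theta_eq[symmetric] by linarith
    then obtain t where "t \<in> {t. t > 0 \<and> (\<forall>x\<in>?L. \<exists>y\<in>?L. - x = t *\<^sub>R y)}" "t < 2 * theta K p"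
      using cInf_lessD[of "{t. t > 0 \<and> (\<forall>x\<in>?L. \<exists>y\<in>?L. - x = t *\<^sub>R y)}"] reflection_factor_exists by blast
    then show thesis using that[of t] by blast
  qed
  have t1: "1 \<le> t" by (rule reflection_factor_ge_1[OF t(1,2)])
  have I: "finite I" "\<And>i. i \<in> I \<Longrightarrow> v i \<in> E d" "\<And>i. i \<in> I \<Longrightarrow> lam i > 0"
    using fam by (auto simp: pw_int_family_def)
  \<comment> \<open>The copies of \<open>p\<close> in the members: they are the centres once K is
    translated so that \<open>p\<close> becomes the origin.\<close>
  define w where "w = (\<lambda>i. v i + lam i *\<^sub>R p)"
  have "real (card I) * measure (lebE d) (core ?L)
      \<le> 27 * (3 / 2) ^ d * measure (lebE d) ((\<lambda>(x, y). x - y) ` (?L \<times> ?L)) * (4 * real d * (ln (real d) + ln t))"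
  proof (rule pairwise_intersecting_bound[OF centred_body d t1 t(2) I(1)])
    show "w i \<in> E d" if "i \<in> I" for i unfolding w_def using I(2)[OF that] pE by (intro E_add E_scaleR)
    show "lam i > 0" if "i \<in> I" for i by (rule I(3)[OF that])
    show "w i - w j \<noteq> s *\<^sub>R l" if ij: "i \<in> I" "j \<in> I" "i \<noteq> j" and s: "0 \<le> s" "s < lam j" and l: "l \<in> ?L" for i j s l
    proof
      assume e: "w i - w j = s *\<^sub>R l"
      have lj: "lam j > 0" using I(3)[OF ij(2)] .
      have x: "l + p \<in> K" using l by (simp only: mem_centred)
      have "p + (s / lam j) *\<^sub>R ((l + p) - p) \<in> intd d K"
        by (rule intd_shrink[OF convex_bodyD(2,3)[OF body] p x]) (use s lj in auto)
      then have z: "p + (s / lam j) *\<^sub>R l \<in> intd d K" by simp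
      have "w i = v j + lam j *\<^sub>R p + s *\<^sub>R l" using e unfolding w_def by (metis add.commute diff_add_cancel)
      also have "\<dots> = v j + lam j *\<^sub>R (p + (s / lam j) *\<^sub>R l)" using lj by (simp add: scaleR_add_right add.assoc)
      finally have "w i \<in> homothet (intd d K) (lam j) (v j)" unfolding homothet_eq using z by blast
      moreover have "w i = (\<lambda>k. v i k + lam i * p k)" by (simp add: w_def fun_eq_iff)
      ultimately show False using arr ij unfolding minkowski_arr_def by auto
    qed
    show "\<exists>a\<in>?L. \<exists>b\<in>?L. w i + lam i *\<^sub>R a = w j + lam j *\<^sub>R b" if ij: "i \<in> I" "j \<in> I" "i \<noteq> j" for i j
    proof -
      obtain x y where xy: "x \<in> K" "y \<in> K" "v i + lam i *\<^sub>R x = v j + lam j *\<^sub>R y"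
        using fam ij unfolding pw_int_family_def homothet_eq by blast
      have "w i + lam i *\<^sub>R (x - p) = v i + lam i *\<^sub>R x" "w j + lam j *\<^sub>R (y - p) = v j + lam j *\<^sub>R y"
        by (simp_all add: w_def scaleR_diff_right)
      with xy show ?thesis by (intro bexI[of _ "x - p"] bexI[of _ "y - p"]) (simp_all add: mem_centred)
    qed
  qed
  then have main: "real (card I) * measure (lebE d) (core ?L)
      \<le> 27 * (3 / 2) ^ d * vol d (minus_set K K) * (4 * real d * (ln (real d) + ln t))"
    by (simp only: difference_body_centred vol_difference_body)
  \<comment> \<open>The factor 2 in t < 2 theta only adds ln 2 <= ln d, which at most doubles the
    logarithmic factor; 216 is 27 * 4 * 2.\<close>
  have "ln t \<le> ln (2 * theta K p)" using t by simp
  also have "\<dots> = ln 2 + ln (theta K p)" using theta_ge_1 by (simp add: ln_mult)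
  also have "ln 2 \<le> ln (real d)" using d by simp
  finally have "ln (real d) + ln t \<le> 2 * ln (real d) + ln (theta K p)" by simp
  also have "\<dots> \<le> 2 * (ln (real d) + ln (theta K p))" using theta_ge_1 by simp
  finally have mono: "27 * (3 / 2) ^ d * vol d (minus_set K K) * (4 * real d * (ln (real d) + ln t))
     \<le> 27 * (3 / 2) ^ d * vol d (minus_set K K) * (4 * real d * (2 * (ln (real d) + ln (theta K p))))"
    by (intro mult_left_mono) (auto simp: vol_def)
  have eq: "27 * a * b * (4 * x * (2 * s)) = a * b * 216 * x * s" for a b x s :: real by simp
  have "real (card I) * measure (lebE d) (core ?L)
     \<le> (3 / 2) ^ d * vol d (minus_set K K) * 216 * real d * (ln (real d) + ln (theta K p))"
    using order_trans[OF main mono] unfolding eq .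
  then have "real (card I) \<le> ((3 / 2) ^ d * vol d (minus_set K K) * 216 * real d * (ln (real d) + ln (theta K p)))
      / measure (lebE d) (core ?L)"
    by (subst pos_le_divide_eq[OF measure_core_pos])
  then show ?thesis unfolding vol_core by (simp only: times_divide_eq_left)
qed

lemma kappa_bound:
  "kappa d K p \<le> ereal ((3/2) ^ d * vol d (minus_set K K)
              / vol d (minus_set K {p} \<inter> minus_set {p} K)
              * 216 * real d * (ln (real d) + ln (theta K p)))"
  unfolding kappa_def by (rule Sup_least) (use card_le_kappa_bound in auto)

end

lemma kappa'_le_kappa: "kappa' d K p \<le> kappa d K p"
proof -
  have "minkowski_arr d K p I v lam" if "strict_minkowski_arr d K p I v lam" for I v lam
  proof -
    have "homothet (intd d K) (lam j) (v j) \<subseteq> homothet K (lam j) (v j)" for j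
      by (auto simp: homothet_def intd_def)
    then show ?thesis using that unfolding minkowski_arr_def strict_minkowski_arr_def by blast
  qed
  then show ?thesis unfolding kappa_def kappa'_def by (intro Sup_subset_mono) blast
qed

section \<open>The centroid as reference point\<close>

lemma centroid_interior:
  assumes d: "2 \<le> d" and body: "convex_body d K"
  shows "centroid d K \<in> intd d K"
proof -
  note K = convex_bodyD[OF body]
  obtain q where q: "q \<in> intd d K" using K(4) by blast
  then obtain r where r: "r > 0" "\<And>y. y \<in> cube d r \<Longrightarrow> q + y \<in> K"
    unfolding intd_iff_cube[OF K(2)] by blast
  have qE: "q \<in> E d" using q K(2) by (auto simp: intd_def)
  obtain r' where r': "r' > 0" "\<And>y. y \<in> cube d r' \<Longrightarrow> bary d K + y \<in> K"
    using bary_interior[OF K(1-3) d qE r] by blast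
  have "bary d K + 0 \<in> K" by (rule r'(2)) (use r'(1) in \<open>simp add: cube_def E_zero\<close>)
  then show ?thesis
    unfolding intd_iff_cube[OF K(2)] centroid_eq_bary[OF K(2) compact_borel[OF K(1)]] using r' by auto
qed

text \<open>The two volume inequalities bound the ratio by the binomial coefficient times 2^d, and
  (3/2)^d 2^d = 3^d. The logarithms add up to at most 6 ln d, hence 1296 = 216 * 6.\<close>

theorem kappa_centroid_bound:
  assumes d: "2 \<le> d" and body: "convex_body d K"
  shows "kappa d K (centroid d K) \<le> ereal (3 ^ d * real ((2 * d) choose d) * 1296 * real d * ln (real d))"
proof -
  note K = convex_bodyD[OF body]
  define c where "c = centroid d K"
  have cb: "c = bary d K" unfolding c_def by (rule centroid_eq_bary[OF K(2) compact_borel[OF K(1)]])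
  have c: "c \<in> intd d K" unfolding c_def by (rule centroid_interior[OF d body])
  obtain r where r: "r > 0" "\<And>y. y \<in> cube d r \<Longrightarrow> bary d K + y \<in> K"
    using c unfolding intd_iff_cube[OF K(2)] cb by blast
  have cE: "c \<in> E d" using c K(2) by (auto simp: intd_def)
  let ?V = "measure (lebE d) K"
  let ?P = "vol d (minus_set K {c} \<inter> minus_set {c} K)"
  let ?D = "vol d (minus_set K K)"
  have V: "?V > 0"
    by (rule measure_pos_of_cube[OF K(1,2) cE r(1)]) (use r(2) cb in simp)
  have P0: "?P > 0" unfolding vol_core[OF d body c] by (rule measure_core_pos[OF d body c])
  have P: "?V \<le> 2 ^ d * ?P"
  proof -
    \<comment> \<open>K and its reflection 2c - K in the centroid meet in a translate of the core,
      so the overlap at 2c is the volume needed.\<close>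
    have "core (centred K c) = (\<lambda>x. - c + 1 *\<^sub>R x) ` overlap K (- 1) (2 *\<^sub>R c)"
    proof (intro set_eqI iffI)
      fix x assume x: "x \<in> core (centred K c)"
      have e: "2 *\<^sub>R c + (- 1) *\<^sub>R (x + c) = - x + c" by (simp add: scaleR_2)
      have "x + c \<in> overlap K (- 1) (2 *\<^sub>R c)"
        using x unfolding overlap_def mem_Collect_eq e core_def mem_centred by simp
      then show "x \<in> (\<lambda>x. - c + 1 *\<^sub>R x) ` overlap K (- 1) (2 *\<^sub>R c)" by (rule rev_image_eqI) simp
    next
      fix x assume "x \<in> (\<lambda>x. - c + 1 *\<^sub>R x) ` overlap K (- 1) (2 *\<^sub>R c)"
      then obtain y where y: "y \<in> K" "2 *\<^sub>R c + (- 1) *\<^sub>R y \<in> K" "x = - c + 1 *\<^sub>R y" by (auto simp: overlap_def)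
      have "x + c = y" "- x + c = 2 *\<^sub>R c + (- 1) *\<^sub>R y" unfolding y(3) by (simp_all add: scaleR_2)
      then show "x \<in> core (centred K c)" unfolding core_def mem_Collect_eq mem_centred using y by simp
    qed
    then have "?P = measure (lebE d) (overlap K (- 1) (2 *\<^sub>R c))"
      unfolding vol_core[OF d body c]
      using measure_affine_image[OF compact_overlap[OF K(1)], of "- 1" 1 "- c" d "2 *\<^sub>R c"] cE by (simp add: E_minus)
    then show ?thesis using milman_pajor[OF K(1,2,3) r] unfolding cb by simp
  qed
  have D: "?D \<le> real ((2 * d) choose d) * ?V"
  proof -
    have "minus_set K K = (\<lambda>(x, y). x - y) ` (K \<times> K)" unfolding minus_set_eq image_Times_eq ..
    then show ?thesis
      using rogers_shephard[OF K(1,2,3) V] d unfolding vol_difference_body[OF d body c] by simp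
  qed
  have "?D \<le> real ((2 * d) choose d) * (2 ^ d * ?P)"
    by (rule order_trans[OF D mult_left_mono[OF P]]) simp
  then have "?D / ?P \<le> real ((2 * d) choose d) * 2 ^ d" using P0 by (simp add: pos_divide_le_eq mult.assoc)
  then have "(3 / 2) ^ d * (?D / ?P) \<le> (3 / 2) ^ d * (real ((2 * d) choose d) * 2 ^ d)"
    by (rule mult_left_mono) simp
  also have "\<dots> = 3 ^ d * real ((2 * d) choose d)"
    by (simp add: power_divide)
  finally have ratio: "(3 / 2) ^ d * ?D / ?P \<le> 3 ^ d * real ((2 * d) choose d)" by simp
  have "theta K c \<le> 9 * real d"
    unfolding theta_eq
  proof (rule cInf_lower)
    have "\<exists>y\<in>centred K c. - x = (9 * real d) *\<^sub>R y" if "x \<in> centred K c" for x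
    proof
      have "bary d K - (1 / (9 * real d)) *\<^sub>R ((x + c) - bary d K) \<in> K"
        by (rule reflect_through_centroid[OF K(1,2,3) V d]) (use that in \<open>simp only: mem_centred\<close>)
      then show "- ((1 / (9 * real d)) *\<^sub>R x) \<in> centred K c"
        unfolding mem_centred cb[symmetric] by (simp add: add.commute)
      show "- x = (9 * real d) *\<^sub>R (- ((1 / (9 * real d)) *\<^sub>R x))" using d by simp
    qed
    then show "9 * real d \<in> {t. t > 0 \<and> (\<forall>x\<in>centred K c. \<exists>y\<in>centred K c. - x = t *\<^sub>R y)}" using d by simp
    show "bdd_below {t. t > 0 \<and> (\<forall>x\<in>centred K c. \<exists>y\<in>centred K c. - x = t *\<^sub>R y)}"
      by (auto simp: bdd_below_def intro!: exI[of _ 0])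
  qed
  \<comment> \<open>Everything is expressed through ln d: ln 9 <= 4 ln 2 <= 4 ln d, so ln theta is
    at most 5 ln d.\<close>
  then have "ln (theta K c) \<le> ln (9 * real d)" using theta_ge_1[OF d body c] d by simp
  also have "\<dots> = ln 9 + ln (real d)" using d by (simp add: ln_mult)
  also have "ln (9 :: real) \<le> ln (2 ^ 4)" by simp
  also have "ln (2 ^ 4 :: real) = 4 * ln 2" by (subst ln_realpow) auto
  also have "ln 2 \<le> ln (real d)" using d by simp
  finally have lt: "ln (real d) + ln (theta K c) \<le> 6 * ln (real d)" by simp
  have l0: "0 \<le> ln (real d) + ln (theta K c)" using theta_ge_1[OF d body c] d by simp
  have "kappa d K c \<le> ereal ((3 / 2) ^ d * ?D / ?P * 216 * real d * (ln (real d) + ln (theta K c)))"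
    by (rule kappa_bound[OF d body c])
  also have "(3 / 2) ^ d * ?D / ?P * 216 * real d * (ln (real d) + ln (theta K c))
     \<le> 3 ^ d * real ((2 * d) choose d) * 216 * real d * (6 * ln (real d))"
    by (intro mult_mono ratio lt) (auto simp: l0 vol_def)
  finally show ?thesis by (simp add: c_def mult_ac)
qed

theorem theorem4:
  "\<exists>C>0.
     (\<forall>d K p. 2 \<le> d \<longrightarrow> convex_body d K \<longrightarrow> p \<in> intd d K \<longrightarrow>
        kappa' d K p \<le> kappa d K p \<and>
        kappa d K p \<le> ereal ((3/2) ^ d * vol d (minus_set K K)
              / vol d (minus_set K {p} \<inter> minus_set {p} K)
              * C * real d * (ln (real d) + ln (theta K p)))) \<and>
     (\<forall>d K. 2 \<le> d \<longrightarrow> convex_body d K \<longrightarrow>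
        kappa' d K (centroid d K) \<le> kappa d K (centroid d K) \<and>
        kappa d K (centroid d K) \<le> ereal (3 ^ d * real ((2 * d) choose d) * C * real d * ln (real d)))"
proof (intro exI[of _ "1296 :: real"] conjI allI impI kappa'_le_kappa kappa_centroid_bound)
  fix d K p assume d: "2 \<le> d" and body: "convex_body d K" and p: "p \<in> intd d K"
  let ?Q = "(3/2) ^ d * vol d (minus_set K K) / vol d (minus_set K {p} \<inter> minus_set {p} K)"
  \<comment> \<open>The logarithmic factor is nonnegative, so 216 may be raised to the 1296 that the
    centroid bound requires.\<close>
  have "0 \<le> ln (real d) + ln (theta K p)" using theta_ge_1[OF d body p] d by simp
  then have "?Q * 216 * real d * (ln (real d) + ln (theta K p)) \<le> ?Q * 1296 * real d * (ln (real d) + ln (theta K p))"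
    by (intro mult_right_mono mult_left_mono) (auto simp: vol_def)
  then show "kappa d K p \<le> ereal (?Q * 1296 * real d * (ln (real d) + ln (theta K p)))"
    using kappa_bound[OF d body p] by (meson ereal_less_eq(3) order_trans)
qed auto

end
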